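(* Let $k,n,r$ be integers such that $0\le r\le k$ and $2k\le r+n$. The spinor-helicity variety $\mathrm{SH}(k,n,r)$ is non-empty and irreducible in $\mathbb{P}^{\binom nk-1}\times\mathbb{P}^{\binom nk-1}$. Its dimension equals $$\dim(\mathrm{SH}(k,n,r)) = 2k(n-k)-(k-r)^2 .$$ If $r=0$, then $\mathrm{SH}(k,n,0)$ is linearly isomorphic (i.e. via a linear isomorphism of the ambient projective spaces) to the two-step flag variety $\mathrm{Fl}(k,n-k;\mathbb{C}^n)$ in its Plücker embedding in $\mathbb{P}^{\binom nk-1}\times\mathbb{P}^{\binom nk-1}$.
   Context: $\mathrm{Gr}(k,n)\subset\mathbb{P}^{\binom nk-1}$ is the Grassmannian of $k$-dimensional linear subspaces of $\mathbb{C}^n$ in its Plücker embedding. The spinor-helicity variety is $$\mathrm{SH}(k,n,r)=\{(V,W)\in\mathrm{Gr}(k,n)\times\mathrm{Gr}(k,n) : \dim(V\cap W^\perp)\ge k-r\},$$ where $W^\perp$ is the orthogonal complement of $W$ with respect to the standard bilinear form $\sum_i x_iy_i$ on $\mathbb{C}^n$. Equivalently, if $V,W$ are the row spaces of $k\times n$ matrices $\lambda,\tilde\lambda$ of rank $k$, the condition is $\mathrm{rank}(\lambda\tilde\lambda^T)\le r$. For $k\le n-k$, $\mathrm{Fl}(k,n-k;\mathbb{C}^n)$ is the variety of pairs $(V,U)\in\mathrm{Gr}(k,n)\times\mathrm{Gr}(n-k,n)$ with $V\subseteq U$, embedded by the Plücker coordinates of $V$ and $U$. *)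

theory Defs
  imports
    "HOL-Analysis.Abstract_Topology"
    "HOL-Library.Extended_Nat"
    "Jordan_Normal_Form.VS_Connect"
    "Jordan_Normal_Form.DL_Submatrix"
begin

section \<open>Irreducible spaces and Krull dimension\<close>

definition irreducible_space :: "'a topology \<Rightarrow> bool" where
  "irreducible_space X \<longleftrightarrow> topspace X \<noteq> {} \<and>
     (\<forall>C D. closedin X C \<and> closedin X D \<and> C \<union> D = topspace X \<longrightarrow> C = topspace X \<or> D = topspace X)"

definition irreduciblein :: "'a topology \<Rightarrow> 'a set \<Rightarrow> bool" where
  "irreduciblein X A \<longleftrightarrow> A \<subseteq> topspace X \<and> irreducible_space (subtopology X A)"

definition krull_dim :: "'a topology \<Rightarrow> enat" where
  "krull_dim X = Sup {enat l | l. \<exists>Z :: nat \<Rightarrow> 'a set.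
     (\<forall>i\<le>l. closedin X (Z i) \<and> irreduciblein X (Z i)) \<and> (\<forall>i<l. Z i \<subset> Z (Suc i))}"

section \<open>The Zariski topology on a product of two projective spaces\<close>

text \<open>Projective space with homogeneous coordinates indexed by a finite set \<open>S\<close>: a coordinate
  vector is a function vanishing outside \<open>S\<close>, and a point is the set of all nonzero multiples of
  a nonzero coordinate vector.\<close>

definition coord_space :: "'i set \<Rightarrow> ('i \<Rightarrow> complex) set" where
  "coord_space S = {x. \<forall>i. i \<notin> S \<longrightarrow> x i = 0}"

definition proj_pt :: "('i \<Rightarrow> complex) \<Rightarrow> ('i \<Rightarrow> complex) set" where
  "proj_pt x = {(\<lambda>i. c * x i) | c. c \<noteq> 0}"

definition proj_space :: "'i set \<Rightarrow> ('i \<Rightarrow> complex) set set" where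
  "proj_space S = proj_pt ` (coord_space S - {\<lambda>_. 0})"

text \<open>\<open>bihom_poly S T d e f\<close>: \<open>f\<close> is given by a polynomial in the variables \<open>x i\<close> (\<open>i \<in> S\<close>) and
  \<open>y j\<close> (\<open>j \<in> T\<close>), bihomogeneous of bidegree \<open>(d, e)\<close>.\<close>

inductive bihom_poly ::
  "'i set \<Rightarrow> 'j set \<Rightarrow> nat \<Rightarrow> nat \<Rightarrow> (('i \<Rightarrow> complex) \<Rightarrow> ('j \<Rightarrow> complex) \<Rightarrow> complex) \<Rightarrow> bool"
  for S T where
  const: "bihom_poly S T 0 0 (\<lambda>x y. c)"
| var1: "i \<in> S \<Longrightarrow> bihom_poly S T 1 0 (\<lambda>x y. x i)"
| var2: "j \<in> T \<Longrightarrow> bihom_poly S T 0 1 (\<lambda>x y. y j)"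
| add: "bihom_poly S T d e f \<Longrightarrow> bihom_poly S T d e g \<Longrightarrow> bihom_poly S T d e (\<lambda>x y. f x y + g x y)"
| mult: "bihom_poly S T d e f \<Longrightarrow> bihom_poly S T d' e' g \<Longrightarrow>
    bihom_poly S T (d + d') (e + e') (\<lambda>x y. f x y * g x y)"

definition zero_locus ::
  "'i set \<Rightarrow> 'j set \<Rightarrow> (('i \<Rightarrow> complex) \<Rightarrow> ('j \<Rightarrow> complex) \<Rightarrow> complex) set
     \<Rightarrow> (('i \<Rightarrow> complex) set \<times> ('j \<Rightarrow> complex) set) set" where
  "zero_locus S T F =
     {(P, Q) \<in> proj_space S \<times> proj_space T. \<forall>f\<in>F. \<forall>x\<in>P. \<forall>y\<in>Q. f x y = 0}"

definition zariski_closed ::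
  "'i set \<Rightarrow> 'j set \<Rightarrow> (('i \<Rightarrow> complex) set \<times> ('j \<Rightarrow> complex) set) set \<Rightarrow> bool" where
  "zariski_closed S T Z \<longleftrightarrow>
     (\<exists>F. (\<forall>f\<in>F. \<exists>d e. bihom_poly S T d e f) \<and> Z = zero_locus S T F)"

definition zariski ::
  "'i set \<Rightarrow> 'j set \<Rightarrow> (('i \<Rightarrow> complex) set \<times> ('j \<Rightarrow> complex) set) topology" where
  "zariski S T = topology (\<lambda>U. U \<subseteq> proj_space S \<times> proj_space T \<and>
     zariski_closed S T (proj_space S \<times> proj_space T - U))"

lemma bihom_poly_scale:
  assumes "bihom_poly S T d e f"
  shows "f (\<lambda>i. a * x i) (\<lambda>j. b * y j) = a ^ d * b ^ e * f x y"
  using assms by induction (auto simp: algebra_simps power_add)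

lemma zero_locus_proj_pt:
  assumes "\<forall>f\<in>F. \<exists>d e. bihom_poly S T d e f"
    and "x \<in> coord_space S - {\<lambda>_. 0}" "y \<in> coord_space T - {\<lambda>_. 0}"
  shows "(proj_pt x, proj_pt y) \<in> zero_locus S T F \<longleftrightarrow> (\<forall>f\<in>F. f x y = 0)"
proof
  assume *: "(proj_pt x, proj_pt y) \<in> zero_locus S T F"
  have "x \<in> proj_pt x" "y \<in> proj_pt y"
    unfolding proj_pt_def by (auto intro!: exI[of _ 1])
  with * show "\<forall>f\<in>F. f x y = 0" by (auto simp: zero_locus_def)
next
  assume *: "\<forall>f\<in>F. f x y = 0"
  have "f u v = 0" if f: "f \<in> F" and uv: "u \<in> proj_pt x" "v \<in> proj_pt y" for f u v
  proof -
    obtain d e where "bihom_poly S T d e f" using assms(1) f by blast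
    moreover obtain a b where "u = (\<lambda>i. a * x i)" "v = (\<lambda>j. b * y j)"
      using uv by (auto simp: proj_pt_def)
    ultimately show ?thesis using * f by (simp add: bihom_poly_scale)
  qed
  moreover have "proj_pt x \<in> proj_space S" "proj_pt y \<in> proj_space T"
    using assms(2,3) unfolding proj_space_def by blast+
  ultimately show "(proj_pt x, proj_pt y) \<in> zero_locus S T F"
    by (auto simp: zero_locus_def)
qed

lemma zariski_closed_Un:
  assumes "zariski_closed S T Y" "zariski_closed S T Z"
  shows "zariski_closed S T (Y \<union> Z)"
proof -
  obtain F G where F: "\<forall>f\<in>F. \<exists>d e. bihom_poly S T d e f" "Y = zero_locus S T F"
    and G: "\<forall>f\<in>G. \<exists>d e. bihom_poly S T d e f" "Z = zero_locus S T G"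
    using assms unfolding zariski_closed_def by auto
  define H where "H = {\<lambda>x y. f x y * g x y | f g. f \<in> F \<and> g \<in> G}"
  have H: "\<forall>f\<in>H. \<exists>d e. bihom_poly S T d e f"
  proof
    fix h assume "h \<in> H"
    then obtain f g where fg: "h = (\<lambda>x y. f x y * g x y)" "f \<in> F" "g \<in> G"
      by (auto simp: H_def)
    obtain d e where "bihom_poly S T d e f" using F(1) fg(2) by blast
    moreover obtain d' e' where "bihom_poly S T d' e' g" using G(1) fg(3) by blast
    ultimately show "\<exists>d e. bihom_poly S T d e h"
      using bihom_poly.mult fg(1) by blast
  qed
  have HFG: "(\<forall>h\<in>H. h x y = 0) \<longleftrightarrow> (\<forall>f\<in>F. f x y = 0) \<or> (\<forall>g\<in>G. g x y = 0)" for x y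
  proof
    assume *: "\<forall>h\<in>H. h x y = 0"
    show "(\<forall>f\<in>F. f x y = 0) \<or> (\<forall>g\<in>G. g x y = 0)"
    proof (rule ccontr)
      assume "\<not> ?thesis"
      then obtain f g where fg: "f \<in> F" "g \<in> G" "f x y \<noteq> 0" "g x y \<noteq> 0" by blast
      then have "(\<lambda>x y. f x y * g x y) \<in> H" unfolding H_def by blast
      with * have "f x y * g x y = 0" by (rule bspec)
      with fg show False by simp
    qed
  next
    assume "(\<forall>f\<in>F. f x y = 0) \<or> (\<forall>g\<in>G. g x y = 0)"
    then show "\<forall>h\<in>H. h x y = 0" unfolding H_def by auto
  qed
  have "p \<in> Y \<union> Z \<longleftrightarrow> p \<in> zero_locus S T H" for p
  proof (cases "p \<in> proj_space S \<times> proj_space T")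
    case True
    then obtain x y where x: "x \<in> coord_space S - {\<lambda>_. 0}" and y: "y \<in> coord_space T - {\<lambda>_. 0}"
      and p: "p = (proj_pt x, proj_pt y)"
      by (auto simp: proj_space_def)
    show ?thesis unfolding p Un_iff F(2) G(2)
      using zero_locus_proj_pt[OF F(1) x y] zero_locus_proj_pt[OF G(1) x y]
        zero_locus_proj_pt[OF H x y] HFG[of x y] by blast
  next
    case False
    then show ?thesis unfolding F(2) G(2) zero_locus_def by blast
  qed
  then have "Y \<union> Z = zero_locus S T H" by blast
  with H show ?thesis unfolding zariski_closed_def by blast
qed

lemma zariski_closed_INT:
  assumes "\<And>Z. Z \<in> \<Z> \<Longrightarrow> zariski_closed S T Z"
  shows "zariski_closed S T ((proj_space S \<times> proj_space T) \<inter> \<Inter>\<Z>)"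
proof -
  have "\<forall>Z\<in>\<Z>. \<exists>F. (\<forall>f\<in>F. \<exists>d e. bihom_poly S T d e f) \<and> Z = zero_locus S T F"
    using assms unfolding zariski_closed_def by blast
  then obtain F where F: "\<And>Z. Z \<in> \<Z> \<Longrightarrow> (\<forall>f\<in>F Z. \<exists>d e. bihom_poly S T d e f) \<and> Z = zero_locus S T (F Z)"
    by metis
  have "(proj_space S \<times> proj_space T) \<inter> \<Inter>\<Z> = zero_locus S T (\<Union>(F ` \<Z>))"
  proof (intro Set.set_eqI iffI)
    fix p assume "p \<in> (proj_space S \<times> proj_space T) \<inter> \<Inter>\<Z>"
    moreover have "p \<in> zero_locus S T (F Z)" if "Z \<in> \<Z>" "p \<in> \<Inter>\<Z>" for Z
      using F[OF that(1)] that by blast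
    ultimately show "p \<in> zero_locus S T (\<Union>(F ` \<Z>))" by (auto simp: zero_locus_def)
  next
    fix p assume p: "p \<in> zero_locus S T (\<Union>(F ` \<Z>))"
    then have "p \<in> zero_locus S T (F Z)" if "Z \<in> \<Z>" for Z
      using that by (auto simp: zero_locus_def)
    then have "p \<in> Z" if "Z \<in> \<Z>" for Z using F[OF that] that by blast
    with p show "p \<in> (proj_space S \<times> proj_space T) \<inter> \<Inter>\<Z>" by (auto simp: zero_locus_def)
  qed
  moreover have "\<forall>f\<in>\<Union>(F ` \<Z>). \<exists>d e. bihom_poly S T d e f" using F by blast
  ultimately show ?thesis unfolding zariski_closed_def by blast
qed

lemma zariski_closed_empty: "zariski_closed S T {}"
proof -
  let ?F = "{\<lambda>x y. 1} :: (('a \<Rightarrow> complex) \<Rightarrow> ('b \<Rightarrow> complex) \<Rightarrow> complex) set"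
  have F: "\<forall>f\<in>?F. \<exists>d e. bihom_poly S T d e f"
    using bihom_poly.const[of S T 1] by blast
  have "p \<notin> zero_locus S T ?F" for p
  proof
    assume p: "p \<in> zero_locus S T ?F"
    then obtain x y where x: "x \<in> coord_space S - {\<lambda>_. 0}" and y: "y \<in> coord_space T - {\<lambda>_. 0}"
      and "p = (proj_pt x, proj_pt y)"
      by (auto simp: zero_locus_def proj_space_def)
    with p zero_locus_proj_pt[OF F x y] show False by simp
  qed
  then have "{} = zero_locus S T ?F" by blast
  with F show ?thesis unfolding zariski_closed_def by blast
qed

lemma zariski_closed_UNIV: "zariski_closed S T (proj_space S \<times> proj_space T)"
  using zariski_closed_INT[of "{}"] by simp

lemma openin_zariski:
  "openin (zariski S T) U \<longleftrightarrow> U \<subseteq> proj_space S \<times> proj_space T \<and>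
     zariski_closed S T (proj_space S \<times> proj_space T - U)"
proof -
  let ?P = "proj_space S \<times> proj_space T"
  let ?L = "\<lambda>U. U \<subseteq> ?P \<and> zariski_closed S T (?P - U)"
  have 1: "?L (U \<inter> V)" if "?L U" "?L V" for U V
    using zariski_closed_Un[of S T "?P - U" "?P - V"] that by (auto simp: Diff_Int)
  have 2: "?L (\<Union>\<U>)" if U: "\<forall>U\<in>\<U>. ?L U" for \<U>
  proof -
    have "zariski_closed S T (?P \<inter> \<Inter>((\<lambda>U. ?P - U) ` \<U>))"
      using U by (intro zariski_closed_INT) auto
    moreover have "?P \<inter> \<Inter>((\<lambda>U. ?P - U) ` \<U>) = ?P - \<Union>\<U>" by blast
    ultimately show ?thesis using U by auto
  qed
  have "istopology ?L" unfolding istopology_def using 1 2 by presburger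
  then show ?thesis unfolding zariski_def by (simp add: topology_inverse')
qed

lemma topspace_zariski: "topspace (zariski S T) = proj_space S \<times> proj_space T"
proof
  show "topspace (zariski S T) \<subseteq> proj_space S \<times> proj_space T"
    using openin_topspace[of "zariski S T"] unfolding openin_zariski by blast
  show "proj_space S \<times> proj_space T \<subseteq> topspace (zariski S T)"
    by (rule openin_subset) (simp add: openin_zariski zariski_closed_empty)
qed

lemma closedin_zariski: "closedin (zariski S T) Z \<longleftrightarrow> zariski_closed S T Z"
proof -
  have "Z \<subseteq> proj_space S \<times> proj_space T" if "zariski_closed S T Z"
    using that by (auto simp: zariski_closed_def zero_locus_def)
  then show ?thesis
    unfolding closedin_def openin_zariski topspace_zariski by (auto simp: double_diff)
qed

section \<open>Linear isomorphisms\<close>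

definition lin_iso_on :: "('i \<Rightarrow> complex) set \<Rightarrow> ('j \<Rightarrow> complex) set \<Rightarrow> (('i \<Rightarrow> complex) \<Rightarrow> 'j \<Rightarrow> complex) \<Rightarrow> bool"
  where "lin_iso_on X Y A \<longleftrightarrow> bij_betw A X Y \<and>
    (\<forall>x\<in>X. \<forall>y\<in>X. A (\<lambda>i. x i + y i) = (\<lambda>j. A x j + A y j)) \<and>
    (\<forall>c. \<forall>x\<in>X. A (\<lambda>i. c * x i) = (\<lambda>j. c * A x j))"

text \<open>A subset of \<open>\<P>(S) \<times> \<P>(T)\<close> is carried onto a subset of \<open>\<P>(S') \<times> \<P>(T')\<close> by a pair of linear
  isomorphisms \<open>\<P>(S) \<cong> \<P>(S')\<close>, \<open>\<P>(T) \<cong> \<P>(T')\<close>. Points are sets of coordinate vectors, so the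
  projective map induced by \<open>A\<close> is the image operation \<open>(`) A\<close>.\<close>

definition linearly_isomorphic ::
  "'i set \<Rightarrow> 'j set \<Rightarrow> (('i \<Rightarrow> complex) set \<times> ('j \<Rightarrow> complex) set) set \<Rightarrow>
   'i' set \<Rightarrow> 'j' set \<Rightarrow> (('i' \<Rightarrow> complex) set \<times> ('j' \<Rightarrow> complex) set) set \<Rightarrow> bool" where
  "linearly_isomorphic S T Y S' T' Z \<longleftrightarrow>
     (\<exists>A B. lin_iso_on (coord_space S) (coord_space S') A \<and>
            lin_iso_on (coord_space T) (coord_space T') B \<and>
            map_prod ((`) A) ((`) B) ` Y = Z)"

section \<open>Grassmannians, spinor-helicity varieties and flag varieties\<close>

abbreviation Cn :: "nat \<Rightarrow> (complex, complex vec) module" where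
  "Cn n \<equiv> module_vec TYPE(complex) n"

definition Gr :: "nat \<Rightarrow> nat \<Rightarrow> complex vec set set" where
  "Gr k n = {V. subspace class_ring V (Cn n) \<and> vectorspace.dim class_ring (Cn n\<lparr>carrier := V\<rparr>) = k}"

text \<open>The scalar product underlying \<^const>\<open>vec_module.orthogonal_complement\<close> is bilinear,
  without complex conjugation.\<close>

definition SH :: "nat \<Rightarrow> nat \<Rightarrow> nat \<Rightarrow> (complex vec set \<times> complex vec set) set" where
  "SH k n r = {(V, W) \<in> Gr k n \<times> Gr k n.
     vectorspace.dim class_ring (Cn n\<lparr>carrier := V \<inter> vec_module.orthogonal_complement n W\<rparr>) \<ge> k - r}"

definition Fl :: "nat \<Rightarrow> nat \<Rightarrow> nat \<Rightarrow> (complex vec set \<times> complex vec set) set" where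
  "Fl k m n = {(V, U) \<in> Gr k n \<times> Gr m n. V \<subseteq> U}"

subsection \<open>Pluecker embedding\<close>

definition ksubsets :: "nat \<Rightarrow> nat \<Rightarrow> nat set set" where
  "ksubsets k n = {I. I \<subseteq> {..<n} \<and> card I = k}"

definition max_minors :: "nat \<Rightarrow> nat \<Rightarrow> complex mat \<Rightarrow> nat set \<Rightarrow> complex" where
  "max_minors k n A = (\<lambda>I. if I \<in> ksubsets k n then det (submatrix A UNIV I) else 0)"

text \<open>All \<open>k \<times> n\<close> matrices with row space \<open>V\<close> have proportional vectors of maximal minors, so for
  \<open>V \<in> Gr k n\<close> the union below consists of equal sets and is a single projective point.\<close>

definition plucker :: "nat \<Rightarrow> nat \<Rightarrow> complex vec set \<Rightarrow> (nat set \<Rightarrow> complex) set" where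
  "plucker k n V = (\<Union>A \<in> {A \<in> carrier_mat k n. vec_space.row_space n A = V}. proj_pt (max_minors k n A))"

definition SH_variety :: "nat \<Rightarrow> nat \<Rightarrow> nat \<Rightarrow> ((nat set \<Rightarrow> complex) set \<times> (nat set \<Rightarrow> complex) set) set" where
  "SH_variety k n r = map_prod (plucker k n) (plucker k n) ` SH k n r"

definition Fl_variety :: "nat \<Rightarrow> nat \<Rightarrow> nat \<Rightarrow> ((nat set \<Rightarrow> complex) set \<times> (nat set \<Rightarrow> complex) set) set" where
  "Fl_variety k m n = map_prod (plucker k n) (plucker m n) ` Fl k m n"

end

theory Submission
  imports Defs "HOL-Library.Function_Algebras" "HOL-Computational_Algebra.Polynomial"
    "Jordan_Normal_Form.DL_Rank"
begin

text \<open>Write \<open>m = k - r\<close>. A pair \<open>(V, W)\<close> belongs to the spinor-helicity variety iff some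
\<open>m\<close>-dimensional subspace \<open>P\<close> of \<open>V\<close> is orthogonal to \<open>W\<close>; so one may choose \<open>V\<close>, then \<open>P\<close> in \<open>V\<close>,
then \<open>W\<close> in the orthogonal complement of \<open>P\<close>. For generic choices these spaces have normalised bases:
\<open>V\<close> is the row space of \<open>\<lambda> = [1 | X]\<close>, \<open>P\<close> that of \<open>[1 | C] \<lambda>\<close>, and \<open>W\<close> that of a matrix
\<open>\<mu> = [Y | Z | 1]\<close> whose blocks have \<open>m\<close>, \<open>n - k - m\<close> and \<open>k\<close> columns. The inequality
\<open>2 k \<le> r + n\<close> says \<open>m \<le> n - k\<close>, so there is room for the first block. As \<open>P\<close> has a basis starting
with an identity block, orthogonality to \<open>P\<close> determines \<open>Y\<close> as a polynomial in the entries of \<open>X\<close>, \<open>C\<close>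
and \<open>Z\<close>, and these entries are arbitrary. There are
\<open>k (n - k) + m (k - m) + k (n - k - m) = 2 k (n - k) - m\<^sup>2\<close> of them. This gives a polynomial
map \<open>\<phi>\<close> from affine space of the expected dimension into the variety.

The image of \<open>\<phi>\<close> is dense (\<open>vanishes_SH_if_vanishes_param\<close>): every pair in the variety comes from an
invertible matrix \<open>g\<close> and a matrix \<open>N\<close> whose first \<open>m\<close> columns vanish, \<open>V\<close> being spanned by the
first \<open>k\<close> rows of \<open>g\<close> and \<open>W\<close> by the rows of \<open>N (adj g)\<^sup>T\<close>. The entries of \<open>g\<close> and \<open>N\<close> range over an
affine space, and outside the zero set of one nonzero polynomial the pair is in the image of \<open>\<phi>\<close>.

Everything else about irreducibility and dimension holds for any set \<open>X\<close> with a dense polynomial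
parametrisation by affine \<open>d\<close>-space (locale \<open>parametrised\<close>). Bihomogeneous forms pull back to
polynomial functions, which have no zero divisors, so \<open>X\<close> is irreducible. For a chain
\<open>Z\<^sub>0 \<subset> \<dots> \<subset> Z\<^sub>l\<close> of irreducible closed subsets choose forms \<open>f\<^sub>i\<close> of one common bidegree with \<open>f\<^sub>i\<close> vanishing
on \<open>Z\<^sub>i\<^sub>-\<^sub>1\<close> but not on \<open>Z\<^sub>i\<close>, and \<open>f\<^sub>0\<close> not vanishing on \<open>Z\<^sub>0\<close>. Their monomials of a fixed degree are
linearly independent on \<open>Z\<^sub>l\<close> (\<open>chain_forms_independent\<close>), hence so are the pullbacks. In degree
\<open>D\<close> there are about \<open>D\<^sup>l\<close> of them in a space of polynomials of dimension about \<open>D\<^sup>d\<close>, so \<open>l \<le> d\<close>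
(\<open>independent_forms_le\<close>). Conversely, letting the \<open>d\<close> parameters become nonzero one after the other
gives a growing sequence of coordinate subspaces; the closures of their images form a chain of length \<open>d\<close>
as soon as each step is detected by some form. For the spinor-helicity variety a single Pluecker coordinate
does this at each step, provided the parameters are taken in a suitable order (\<open>detect_param\<close>).

If \<open>r = 0\<close> then \<open>P = V\<close>, so the pairs are those with \<open>V\<close> contained in the orthogonal complement of \<open>W\<close>, and
replacing \<open>W\<close> by its complement gives all two-step flags. On Pluecker coordinates this replacement is a signed
permutation, by Jacobi's theorem on complementary minors (\<open>complementary_minors\<close>).\<close>

section \<open>Polynomial functions\<close>

text \<open>Polynomial functions of the coordinates indexed by \<open>U\<close>, as functions rather than as formal polynomials:
over the complex numbers nothing is lost, and substitution is composition.\<close>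

inductive polyfun :: "'u set \<Rightarrow> (('u \<Rightarrow> complex) \<Rightarrow> complex) \<Rightarrow> bool" for U where
  const: "polyfun U (\<lambda>t. c)"
| var: "u \<in> U \<Longrightarrow> polyfun U (\<lambda>t. t u)"
| add: "polyfun U f \<Longrightarrow> polyfun U g \<Longrightarrow> polyfun U (\<lambda>t. f t + g t)"
| mult: "polyfun U f \<Longrightarrow> polyfun U g \<Longrightarrow> polyfun U (\<lambda>t. f t * g t)"

lemma polyfun_sum:
  assumes "\<And>i. i \<in> I \<Longrightarrow> polyfun U (f i)"
  shows "polyfun U (\<lambda>t. \<Sum>i\<in>I. f i t)"
  using assms
proof (induction I rule: infinite_finite_induct)
  case (insert i I)
  then show ?case by (simp add: polyfun.add)
qed (auto intro: polyfun.const)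

lemma polyfun_prod:
  assumes "\<And>i. i \<in> I \<Longrightarrow> polyfun U (f i)"
  shows "polyfun U (\<lambda>t. \<Prod>i\<in>I. f i t)"
  using assms
proof (induction I rule: infinite_finite_induct)
  case (insert i I)
  then show ?case by (simp add: polyfun.mult)
qed (auto intro: polyfun.const)

lemma polyfun_uminus: "polyfun U f \<Longrightarrow> polyfun U (\<lambda>t. - f t)"
  using polyfun.mult[OF polyfun.const[of U "-1"], of f] by simp

text \<open>Restriction to the line through two points reduces statements about polynomial functions to
polynomials in one variable.\<close>

lemma polyfun_line:
  assumes "polyfun U f"
  shows "\<exists>q. \<forall>z. f (\<lambda>u. a u + z * (b u - a u)) = poly q z"
  using assms
proof induction
  case (const c)
  show ?case by (rule exI[of _ "[:c:]"]) simp
next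
  case (var u)
  show ?case by (rule exI[of _ "[:a u, b u - a u:]"]) simp
next
  case (add f g)
  then obtain p q where "\<forall>z. f (\<lambda>u. a u + z * (b u - a u)) = poly p z"
    "\<forall>z. g (\<lambda>u. a u + z * (b u - a u)) = poly q z" by blast
  then show ?case by (intro exI[of _ "p + q"]) simp
next
  case (mult f g)
  then obtain p q where "\<forall>z. f (\<lambda>u. a u + z * (b u - a u)) = poly p z"
    "\<forall>z. g (\<lambda>u. a u + z * (b u - a u)) = poly q z" by blast
  then show ?case by (intro exI[of _ "p * q"]) simp
qed

text \<open>If \<open>f a\<close> and \<open>g b\<close> are nonzero, then on the line through \<open>a\<close> and \<open>b\<close> both factors are nonzero polynomials
in one variable, and so is their product.\<close>

lemma polyfun_mult_eq_0:
  assumes f: "polyfun U f" and g: "polyfun U g" and "\<And>t. f t * g t = 0"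
  shows "(\<forall>t. f t = 0) \<or> (\<forall>t. g t = 0)"
proof (rule ccontr)
  assume "\<not> ?thesis"
  then obtain a b where ab: "f a \<noteq> 0" "g b \<noteq> 0" by blast
  obtain p q where p: "\<And>z. f (\<lambda>u. a u + z * (b u - a u)) = poly p z"
    and q: "\<And>z. g (\<lambda>u. a u + z * (b u - a u)) = poly q z"
    using polyfun_line[OF f] polyfun_line[OF g] by meson
  have "poly (p * q) z = 0" for z
    using assms(3) by (simp add: p[symmetric] q[symmetric])
  then have "p * q = 0" using poly_all_0_iff_0 by blast
  then have "p = 0 \<or> q = 0" by simp
  with p[of 0] q[of 1] ab show False by auto
qed

text \<open>Projection onto a coordinate subspace; precomposing with it describes restriction to that subspace.\<close>

definition zero_outside :: "'u set \<Rightarrow> ('u \<Rightarrow> complex) \<Rightarrow> 'u \<Rightarrow> complex" where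
  "zero_outside S t = (\<lambda>u. if u \<in> S then t u else 0)"

lemma polyfun_zero_outside:
  assumes "polyfun U f"
  shows "polyfun U (\<lambda>t. f (zero_outside S t))"
  using assms
proof induction
  case (var u)
  then show ?case by (cases "u \<in> S") (auto simp: zero_outside_def intro: polyfun.intros)
qed (auto intro: polyfun.intros)

lemma polyfun_bihom_poly:
  assumes "bihom_poly S T d e f"
    and "\<And>i. i \<in> S \<Longrightarrow> polyfun U (\<lambda>t. \<phi> t i)" "\<And>j. j \<in> T \<Longrightarrow> polyfun U (\<lambda>t. \<psi> t j)"
  shows "polyfun U (\<lambda>t. f (\<phi> t) (\<psi> t))"
  using assms(1) by induction (auto intro: polyfun.intros assms(2,3))

section \<open>Counting monomials\<close>

text \<open>Complex functions on any set form a vector space; linear independence of monomials is meant in it.\<close>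

interpretation fun_space: vector_space
  "(\<lambda>c f x. c * f x) :: complex \<Rightarrow> ('p \<Rightarrow> complex) \<Rightarrow> 'p \<Rightarrow> complex"
  by unfold_locales (auto simp: fun_eq_iff algebra_simps)

definition monomials :: "'u set \<Rightarrow> nat \<Rightarrow> (('u \<Rightarrow> complex) \<Rightarrow> complex) set" where
  "monomials U m = (\<lambda>a t. \<Prod>u\<in>U. t u ^ a u) ` (U \<rightarrow>\<^sub>E {..m})"

lemma monomialsI: "(\<And>u. u \<in> U \<Longrightarrow> a u \<le> m) \<Longrightarrow> (\<lambda>t. \<Prod>u\<in>U. t u ^ a u) \<in> monomials U m"
  unfolding monomials_def by (rule image_eqI[of _ _ "restrict a U"]) auto

lemma finite_monomials: "finite U \<Longrightarrow> finite (monomials U m)"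
  by (simp add: monomials_def finite_PiE)

lemma card_monomials_le: "finite U \<Longrightarrow> card (monomials U m) \<le> (m + 1) ^ card U"
  using card_image_le[of "U \<rightarrow>\<^sub>E {..m}" "\<lambda>a t. \<Prod>u\<in>U. (t u :: complex) ^ a u"]
  by (simp add: monomials_def finite_PiE card_PiE)

lemma span_monomials_mono: "m \<le> m' \<Longrightarrow> fun_space.span (monomials U m) \<subseteq> fun_space.span (monomials U m')"
  by (intro fun_space.span_mono) (fastforce simp: monomials_def PiE_def Pi_def)

lemma span_monomials_mult:
  assumes "f \<in> fun_space.span (monomials U m)" "g \<in> fun_space.span (monomials U m')"
  shows "(\<lambda>t. f t * g t) \<in> fun_space.span (monomials U (m + m'))"
proof -
  have 1: "(\<lambda>t. p t * q t) \<in> fun_space.span (monomials U (m + m'))"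
    if pq: "p \<in> monomials U m" "q \<in> monomials U m'" for p q
  proof -
    obtain a b where ab: "p = (\<lambda>t. \<Prod>u\<in>U. t u ^ a u)" "q = (\<lambda>t. \<Prod>u\<in>U. t u ^ b u)"
      "a \<in> U \<rightarrow>\<^sub>E {..m}" "b \<in> U \<rightarrow>\<^sub>E {..m'}" using pq by (auto simp: monomials_def)
    have "(\<lambda>t. \<Prod>u\<in>U. t u ^ (a u + b u)) \<in> monomials U (m + m')"
      using ab(3,4) by (intro monomialsI add_mono) (auto simp: PiE_def Pi_def)
    then show ?thesis
      unfolding ab by (simp add: power_add prod.distrib fun_space.span_base)
  qed
  have 2: "(\<lambda>t. p t * g t) \<in> fun_space.span (monomials U (m + m'))"
    if p: "p \<in> monomials U m" for p
    using assms(2)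
  proof (induction rule: fun_space.span_induct_alt)
    case base
    then show ?case using fun_space.span_zero by (simp add: zero_fun_def)
  next
    case (step c x y)
    have "(\<lambda>t. p t * ((\<lambda>s. c * x s) + y) t) = (\<lambda>s. c * (p s * x s)) + (\<lambda>t. p t * y t)"
      by (auto simp: fun_eq_iff algebra_simps)
    then show ?case
      using fun_space.span_add[OF fun_space.span_scale[OF 1[OF p step(1)]] step(2)] by simp
  qed
  show ?thesis
    using assms(1)
  proof (induction rule: fun_space.span_induct_alt)
    case base
    then show ?case using fun_space.span_zero by (simp add: zero_fun_def)
  next
    case (step c x y)
    have "(\<lambda>t. ((\<lambda>s. c * x s) + y) t * g t) = (\<lambda>s. c * (x s * g s)) + (\<lambda>t. y t * g t)"
      by (auto simp: fun_eq_iff algebra_simps)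
    then show ?case
      using fun_space.span_add[OF fun_space.span_scale[OF 2[OF step(1)]] step(2)] by simp
  qed
qed

lemma one_in_span_monomials: "(\<lambda>t. 1) \<in> fun_space.span (monomials U 0)"
  using monomialsI[of U "\<lambda>_. 0" 0] by (intro fun_space.span_base) simp

lemma polyfun_in_span_monomials:
  assumes "finite U" "polyfun U f"
  shows "\<exists>m. f \<in> fun_space.span (monomials U m)"
  using assms(2)
proof induction
  case (const c)
  show ?case using fun_space.span_scale[OF one_in_span_monomials, of c U] by auto
next
  case (var u)
  have "(\<Prod>v\<in>U. t v ^ (if v = u then 1 else 0)) = t u" for t :: "'a \<Rightarrow> complex"
    using var assms(1) by (subst prod.remove[of _ u]) auto
  then have "(\<lambda>t. t u) \<in> monomials U 1"
    using monomialsI[of U "\<lambda>v. if v = u then 1 else 0" 1] by simp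
  then show ?case using fun_space.span_base by blast
next
  case (add f g)
  then obtain m m' where "f \<in> fun_space.span (monomials U m)" "g \<in> fun_space.span (monomials U m')"
    by blast
  then have "f \<in> fun_space.span (monomials U (max m m'))" "g \<in> fun_space.span (monomials U (max m m'))"
    using span_monomials_mono[of m "max m m'" U] span_monomials_mono[of m' "max m m'" U] by auto
  then have "f + g \<in> fun_space.span (monomials U (max m m'))"
    by (rule fun_space.span_add)
  then show ?case by (auto simp: plus_fun_def)
next
  case (mult f g)
  then show ?case using span_monomials_mult by blast
qed

text \<open>Exponent vectors of the monomials of degree \<open>D\<close> in \<open>l + 1\<close> letters numbered \<open>0, \<dots>, l\<close>.\<close>

definition exponents :: "nat \<Rightarrow> nat \<Rightarrow> (nat \<Rightarrow> nat) set" where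
  "exponents l D = {a. (\<forall>i>l. a i = 0) \<and> (\<Sum>i\<le>l. a i) = D}"

lemma finite_exponents: "finite (exponents l D)"
proof -
  have "exponents l D \<subseteq> {a. \<forall>i. (i \<in> {..l} \<longrightarrow> a i \<in> {..D}) \<and> (i \<notin> {..l} \<longrightarrow> a i = 0)}"
    by (auto simp: exponents_def intro: member_le_sum[of _ "{..l}"])
  then show ?thesis using finite_set_of_finite_funs[of "{..l}" "{..D}" 0] finite_subset by blast
qed

text \<open>The exponents of the letters \<open>1, \<dots>, l\<close> may be chosen freely below \<open>m\<close>; the letter \<open>0\<close> makes up the total degree.\<close>

lemma card_exponents_ge: "m ^ l \<le> card (exponents l (l * m))"
proof -
  define h where "h b = (\<lambda>i. if i = 0 then l * m - (\<Sum>i=1..l. b i) else if i \<le> l then b i else 0)"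
    for b :: "nat \<Rightarrow> nat"
  have "inj_on h ({1..l} \<rightarrow>\<^sub>E {..<m})"
  proof (rule inj_onI)
    fix b b' assume b: "b \<in> {1..l} \<rightarrow>\<^sub>E {..<m}" "b' \<in> {1..l} \<rightarrow>\<^sub>E {..<m}" "h b = h b'"
    have "b i = b' i" if "i \<in> {1..l}" for i
      using fun_cong[OF b(3), of i] that by (auto simp: h_def)
    with b(1,2) show "b = b'" by (blast intro: PiE_ext)
  qed
  moreover have "h ` ({1..l} \<rightarrow>\<^sub>E {..<m}) \<subseteq> exponents l (l * m)"
  proof (rule image_subsetI)
    fix b assume b: "b \<in> {1..l} \<rightarrow>\<^sub>E {..<m}"
    have "(\<Sum>i=1..l. b i) \<le> (\<Sum>i=1..l. m)"
      using b by (intro sum_mono) (auto simp: PiE_def Pi_def less_imp_le)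
    moreover have "(\<Sum>i\<le>l. h b i) = h b 0 + (\<Sum>i=1..l. b i)"
    proof -
      have "{..l} = insert 0 {1..l}" by auto
      then have "(\<Sum>i\<le>l. h b i) = h b 0 + (\<Sum>i=1..l. h b i)" by simp
      moreover have "(\<Sum>i=1..l. h b i) = (\<Sum>i=1..l. b i)"
        by (rule sum.cong) (auto simp: h_def)
      ultimately show ?thesis by simp
    qed
    ultimately show "h b \<in> exponents l (l * m)"
      by (auto simp: exponents_def) (auto simp: h_def)
  qed
  ultimately have "card ({1..l} \<rightarrow>\<^sub>E {..<m}) \<le> card (exponents l (l * m))"
    by (rule card_inj_on_le[OF _ _ finite_exponents])
  then show ?thesis by (simp add: card_PiE)
qed

text \<open>The monomials of degree \<open>D = l m\<close> in \<open>F\<^sub>0, \<dots>, F\<^sub>l\<close> number at least \<open>m\<^sup>l\<close>. They lie in the span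
of the monomials in the variables from \<open>U\<close> with all exponents at most \<open>m\<^sub>0 D\<close>, where \<open>m\<^sub>0\<close> bounds the exponents
in the \<open>F\<^sub>i\<close>; there are at most \<open>(m\<^sub>0 D + 1)\<^sup>d\<close> of those, with \<open>d = card U\<close>. For \<open>l > d\<close> and large \<open>m\<close> this contradicts
linear independence.\<close>

lemma independent_forms_le:
  assumes U: "finite U"
    and F: "\<And>i. i \<le> l \<Longrightarrow> polyfun U (F i)"
    and indep: "\<And>D c a. (\<And>t. (\<Sum>a\<in>exponents l D. c a * (\<Prod>i\<le>l. F i t ^ a i)) = 0) \<Longrightarrow>
       a \<in> exponents l D \<Longrightarrow> c a = 0"
  shows "l \<le> card U"
proof (rule ccontr)
  assume "\<not> l \<le> card U"
  then have l: "card U + 1 \<le> l" by simp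
  have "\<forall>i. \<exists>m. i \<le> l \<longrightarrow> F i \<in> fun_space.span (monomials U m)"
    using polyfun_in_span_monomials[OF U F] by blast
  then obtain mm where mm: "\<And>i. i \<le> l \<Longrightarrow> F i \<in> fun_space.span (monomials U (mm i))" by metis
  define m0 where "m0 = Max (mm ` {..l})"
  have m0: "F i \<in> fun_space.span (monomials U m0)" if "i \<le> l" for i
    using mm[OF that] span_monomials_mono[of "mm i" m0 U] that by (auto simp: m0_def)
  \<comment> \<open>large enough for \<open>m\<^sup>l\<close> to exceed the dimension bound \<open>((m0 l + 1) m)\<^sup>d\<close>\<close>
  define m where "m = (m0 * l + 1) ^ card U + 1"
  define D where "D = l * m"
  define G where "G a = (\<lambda>t. \<Prod>i\<le>l. F i t ^ a i)" for a :: "nat \<Rightarrow> nat"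
  have pow: "(\<lambda>t. F i t ^ n) \<in> fun_space.span (monomials U (m0 * n))" if "i \<le> l" for i n
  proof (induction n)
    case 0
    show ?case using one_in_span_monomials by simp
  next
    case (Suc n)
    show ?case using span_monomials_mult[OF m0[OF that] Suc] by simp
  qed
  have G_span: "(\<lambda>t. \<Prod>i<j. F i t ^ a i) \<in> fun_space.span (monomials U (m0 * (\<Sum>i<j. a i)))"
    if "j \<le> Suc l" for j a
    using that
  proof (induction j)
    case 0
    show ?case using one_in_span_monomials by simp
  next
    case (Suc j)
    then show ?case using span_monomials_mult[OF Suc.IH pow[of j "a j"]] 
      by (simp add: algebra_simps)
  qed
  \<comment> \<open>equal monomials for different exponents would already be a linear relation\<close>
  have inj: "inj_on G (exponents l D)"
  proof (rule inj_onI, rule ccontr)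
    fix a b assume ab: "a \<in> exponents l D" "b \<in> exponents l D" "G a = G b" "a \<noteq> b"
    define c where "c x = (if x = a then 1 else if x = b then -1 else 0 :: complex)" for x
    have "(\<Sum>x\<in>exponents l D. c x * (\<Prod>i\<le>l. F i t ^ x i)) = 0" for t
    proof -
      have "(\<Sum>x\<in>exponents l D. c x * (\<Prod>i\<le>l. F i t ^ x i)) = (\<Sum>x\<in>{a,b}. c x * G x t)"
        unfolding G_def using ab(1,2) by (intro sum.mono_neutral_right finite_exponents) (auto simp: c_def)
      also have "\<dots> = 0" using ab(3,4) by (auto simp: c_def)
      finally show ?thesis .
    qed
    from indep[OF this ab(1)] show False by (simp add: c_def)
  qed
  have fin: "finite (G ` exponents l D)" by (simp add: finite_exponents)
  have "fun_space.independent (G ` exponents l D)"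
  proof
    assume "fun_space.dependent (G ` exponents l D)"
    then obtain u v where v: "v \<in> G ` exponents l D" "u v \<noteq> 0"
      and s: "(\<Sum>v\<in>G ` exponents l D. (\<lambda>x. u v * v x)) = 0"
      using fun_space.dependent_finite[OF fin] by blast
    obtain b where b: "b \<in> exponents l D" "v = G b" using v(1) by blast
    have "(\<Sum>a\<in>exponents l D. u (G a) * (\<Prod>i\<le>l. F i t ^ a i)) = 0" for t
    proof -
      have "(\<Sum>a\<in>exponents l D. u (G a) * (\<Prod>i\<le>l. F i t ^ a i)) = (\<Sum>v\<in>G ` exponents l D. u v * v t)"
        by (subst sum.reindex[OF inj]) (simp add: G_def)
      also have "\<dots> = (\<Sum>v\<in>G ` exponents l D. (\<lambda>x. u v * v x)) t"
        by (induction rule: infinite_finite_induct) auto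
      finally show ?thesis by (simp add: s)
    qed
    from indep[OF this b(1)] v b show False by simp
  qed
  moreover have "G ` exponents l D \<subseteq> fun_space.span (monomials U (m0 * D))"
  proof (rule image_subsetI)
    fix a assume "a \<in> exponents l D"
    then have "(\<Sum>i<Suc l. a i) = D" by (simp add: exponents_def lessThan_Suc_atMost)
    then show "G a \<in> fun_space.span (monomials U (m0 * D))"
      using G_span[of "Suc l" a] by (simp add: G_def lessThan_Suc_atMost)
  qed
  ultimately have "card (G ` exponents l D) \<le> card (monomials U (m0 * D))"
    using fun_space.independent_span_bound[OF finite_monomials[OF U]] by blast
  then have "card (exponents l D) \<le> (m0 * D + 1) ^ card U"
    using card_monomials_le[OF U, of "m0 * D"] by (simp add: card_image[OF inj])
  then have "m ^ l \<le> (m0 * D + 1) ^ card U"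
    using card_exponents_ge[of m l] by (simp add: D_def)
  also have "\<dots> \<le> ((m0 * l + 1) * m) ^ card U"
    by (rule power_mono) (auto simp: D_def m_def algebra_simps)
  also have "\<dots> = (m0 * l + 1) ^ card U * m ^ card U" by (simp only: power_mult_distrib)
  also have "\<dots> < m * m ^ card U" by (rule mult_strict_right_mono) (auto simp: m_def)
  also have "\<dots> \<le> m ^ l" using power_increasing[OF l, of m] by (simp add: m_def)
  finally show False by simp
qed

section \<open>Forms adapted to a chain of irreducible sets\<close>

lemma exponents_0: "exponents 0 D = {\<lambda>i. if i = 0 then D else 0}"
  by (auto simp: exponents_def fun_eq_iff)

lemma exponents_degree_0: "exponents l 0 = {\<lambda>i. 0}"
  by (auto simp: exponents_def fun_eq_iff) (metis atMost_iff not_le)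

text \<open>A monomial of positive degree either omits the last letter or is that letter times a monomial of smaller degree.
This is the induction step for linear independence along a chain.\<close>

lemma exponents_Suc_Suc:
  fixes j D
  defines "inc \<equiv> \<lambda>a :: nat \<Rightarrow> nat. a(Suc j := Suc (a (Suc j)))"
  shows "exponents (Suc j) (Suc D) = exponents j (Suc D) \<union> inc ` exponents (Suc j) D"
    and "exponents j (Suc D) \<inter> inc ` exponents (Suc j) D = {}"
    and "inj inc"
proof -
  show "exponents j (Suc D) \<inter> inc ` exponents (Suc j) D = {}"
    by (auto simp: exponents_def inc_def)
  show "inj inc"
    by (rule injI) (auto simp: inc_def fun_eq_iff split: if_splits)
  show "exponents (Suc j) (Suc D) = exponents j (Suc D) \<union> inc ` exponents (Suc j) D" (is "?L = ?R")
  proof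
    show "?L \<subseteq> ?R"
    proof
      fix a assume a: "a \<in> ?L"
      show "a \<in> ?R"
      proof (cases "a (Suc j)")
        case 0
        have "\<forall>i>j. a i = 0"
          using a 0 by (auto simp: exponents_def) (metis Suc_lessI)
        then show ?thesis using a 0 by (auto simp: exponents_def)
      next
        case (Suc p)
        have "a = inc (a(Suc j := p))" by (auto simp: inc_def Suc)
        moreover have "a(Suc j := p) \<in> exponents (Suc j) D"
          using a Suc by (auto simp: exponents_def)
        ultimately show ?thesis by blast
      qed
    qed
    show "?R \<subseteq> ?L" by (auto simp: exponents_def inc_def)
  qed
qed

text \<open>Let a form in \<open>f\<^sub>0, \<dots>, f\<^sub>j\<^sub>+\<^sub>1\<close> vanish on \<open>Z\<^sub>j\<^sub>+\<^sub>1\<close>. On \<open>Z\<^sub>j\<close> only the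
monomials without \<open>f\<^sub>j\<^sub>+\<^sub>1\<close> survive, so their coefficients are zero by induction on \<open>j\<close>. What remains is \<open>f\<^sub>j\<^sub>+\<^sub>1\<close> times a form of
smaller degree; since \<open>Z\<^sub>j\<^sub>+\<^sub>1\<close> is irreducible and \<open>f\<^sub>j\<^sub>+\<^sub>1\<close> does not vanish on it, that form vanishes there, and induction on
the degree applies. Irreducibility enters only as primality with respect to the class \<open>\<A>\<close> of functions.\<close>

lemma chain_forms_independent:
  fixes Z :: "nat \<Rightarrow> 'p set" and f :: "nat \<Rightarrow> 'p \<Rightarrow> complex"
  assumes forms: "\<And>j D c. j \<le> l \<Longrightarrow> (\<lambda>p. \<Sum>a\<in>exponents j D. c a * (\<Prod>i\<le>j. f i p ^ a i)) \<in> \<A>"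
    and f: "\<And>i. i \<le> l \<Longrightarrow> f i \<in> \<A>"
    and prime: "\<And>j g h. j \<le> l \<Longrightarrow> g \<in> \<A> \<Longrightarrow> h \<in> \<A> \<Longrightarrow> (\<And>p. p \<in> Z j \<Longrightarrow> g p * h p = 0) \<Longrightarrow>
       (\<forall>p\<in>Z j. g p = 0) \<or> (\<forall>p\<in>Z j. h p = 0)"
    and Z0: "\<exists>p\<in>Z 0. f 0 p \<noteq> 0"
    and zero: "\<And>i p. i < l \<Longrightarrow> p \<in> Z i \<Longrightarrow> f (Suc i) p = 0"
    and nonzero: "\<And>i. i < l \<Longrightarrow> \<exists>p\<in>Z (Suc i). f (Suc i) p \<noteq> 0"
    and mono: "\<And>i. i < l \<Longrightarrow> Z i \<subseteq> Z (Suc i)"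
  shows "j \<le> l \<Longrightarrow> (\<And>p. p \<in> Z j \<Longrightarrow> (\<Sum>a\<in>exponents j D. c a * (\<Prod>i\<le>j. f i p ^ a i)) = 0) \<Longrightarrow>
     a \<in> exponents j D \<Longrightarrow> c a = 0"
proof (induction j arbitrary: D c a)
  case 0
  obtain p where p: "p \<in> Z 0" "f 0 p \<noteq> 0" using Z0 by blast
  show ?case using 0(2)[OF p(1)] 0(3) p(2) by (simp add: exponents_0)
next
  case (Suc j)
  note IH = Suc.IH and j = \<open>Suc j \<le> l\<close>
  show ?case using Suc.prems(2,3)
  proof (induction D arbitrary: c a)
    case 0
    obtain p where "p \<in> Z (Suc j)" using nonzero[of j] j by auto
    from 0(1)[OF this] 0(2) show ?case by (simp add: exponents_degree_0)
  next
    case (Suc D)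
    define inc where "inc = (\<lambda>a :: nat \<Rightarrow> nat. a(Suc j := Suc (a (Suc j))))"
    note ex = exponents_Suc_Suc(1,2)[of j D, folded inc_def] exponents_Suc_Suc(3)[of j, folded inc_def]
    have split: "(\<Sum>a\<in>exponents (Suc j) (Suc D). c a * (\<Prod>i\<le>Suc j. f i p ^ a i)) =
        (\<Sum>a\<in>exponents j (Suc D). c a * (\<Prod>i\<le>j. f i p ^ a i)) +
        f (Suc j) p * (\<Sum>a\<in>exponents (Suc j) D. c (inc a) * (\<Prod>i\<le>Suc j. f i p ^ a i))" for p
    proof -
      have "(\<Sum>a\<in>exponents (Suc j) (Suc D). c a * (\<Prod>i\<le>Suc j. f i p ^ a i)) =
        (\<Sum>a\<in>exponents j (Suc D). c a * (\<Prod>i\<le>Suc j. f i p ^ a i)) +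
        (\<Sum>a\<in>inc ` exponents (Suc j) D. c a * (\<Prod>i\<le>Suc j. f i p ^ a i))"
        unfolding ex(1) by (rule sum.union_disjoint) (use ex(2) in \<open>auto simp: finite_exponents\<close>)
      also have "(\<Sum>a\<in>exponents j (Suc D). c a * (\<Prod>i\<le>Suc j. f i p ^ a i)) =
          (\<Sum>a\<in>exponents j (Suc D). c a * (\<Prod>i\<le>j. f i p ^ a i))"
        by (rule sum.cong) (auto simp: exponents_def)
      also have "(\<Sum>a\<in>inc ` exponents (Suc j) D. c a * (\<Prod>i\<le>Suc j. f i p ^ a i)) =
          (\<Sum>a\<in>exponents (Suc j) D. f (Suc j) p * (c (inc a) * (\<Prod>i\<le>Suc j. f i p ^ a i)))"
        unfolding sum.reindex[OF inj_on_subset[OF ex(3) subset_UNIV]]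
        by (rule sum.cong) (auto simp: inc_def)
      finally show ?thesis by (simp add: sum_distrib_left)
    qed
    have low: "c b = 0" if "b \<in> exponents j (Suc D)" for b
    proof (rule IH[OF _ _ that])
      show "j \<le> l" using j by simp
      fix p assume p: "p \<in> Z j"
      then have "p \<in> Z (Suc j)" using mono[of j] j by auto
      from Suc.prems(1)[OF this] show "(\<Sum>a\<in>exponents j (Suc D). c a * (\<Prod>i\<le>j. f i p ^ a i)) = 0"
        unfolding split using zero[of j p] p j by simp
    qed
    have "(\<forall>p\<in>Z (Suc j). f (Suc j) p = 0) \<or>
       (\<forall>p\<in>Z (Suc j). (\<Sum>a\<in>exponents (Suc j) D. c (inc a) * (\<Prod>i\<le>Suc j. f i p ^ a i)) = 0)"
    proof (rule prime[OF j f[OF j] forms[OF j]])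
      fix p assume p: "p \<in> Z (Suc j)"
      from Suc.prems(1)[OF this] show "f (Suc j) p * (\<Sum>a\<in>exponents (Suc j) D. c (inc a) * (\<Prod>i\<le>Suc j. f i p ^ a i)) = 0"
        unfolding split by (simp add: low)
    qed
    then have "\<forall>p\<in>Z (Suc j). (\<Sum>a\<in>exponents (Suc j) D. c (inc a) * (\<Prod>i\<le>Suc j. f i p ^ a i)) = 0"
      using nonzero[of j] j by auto
    then have "c (inc b) = 0" if "b \<in> exponents (Suc j) D" for b
      using Suc.IH[of "\<lambda>a. c (inc a)" b] that by blast
    then show ?case using Suc.prems(2) low ex(1) by auto
  qed
qed

section \<open>Irreducibility and dimension of parametrised sets\<close>

definition bihom :: "'i set \<Rightarrow> 'j set \<Rightarrow> (('i \<Rightarrow> complex) \<Rightarrow> ('j \<Rightarrow> complex) \<Rightarrow> complex) \<Rightarrow> bool" where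
  "bihom S T f \<longleftrightarrow> (\<exists>d e. bihom_poly S T d e f)"

text \<open>All coordinate vectors of the points of \<open>X\<close>, so that forms can be evaluated on \<open>X\<close>.\<close>

definition cone :: "(('i \<Rightarrow> complex) set \<times> ('j \<Rightarrow> complex) set) set
    \<Rightarrow> (('i \<Rightarrow> complex) \<times> ('j \<Rightarrow> complex)) set" where
  "cone X = (\<Union>(P, Q)\<in>X. P \<times> Q)"

definition vanishes :: "(('i \<Rightarrow> complex) \<Rightarrow> ('j \<Rightarrow> complex) \<Rightarrow> complex)
    \<Rightarrow> (('i \<Rightarrow> complex) set \<times> ('j \<Rightarrow> complex) set) set \<Rightarrow> bool" where
  "vanishes f X \<longleftrightarrow> (\<forall>(x, y)\<in>cone X. f x y = 0)"

lemma bihom_mult: "bihom S T f \<Longrightarrow> bihom S T g \<Longrightarrow> bihom S T (\<lambda>x y. f x y * g x y)"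
  unfolding bihom_def by (elim exE) (rule exI, rule exI, erule bihom_poly.mult)

lemma cone_mono: "X \<subseteq> Y \<Longrightarrow> cone X \<subseteq> cone Y"
  by (auto simp: cone_def)

lemma vanishes_mono: "X \<subseteq> Y \<Longrightarrow> vanishes f Y \<Longrightarrow> vanishes f X"
  unfolding vanishes_def using cone_mono by blast

lemma proj_pt_self: "x \<in> proj_pt x"
  unfolding proj_pt_def by (auto intro!: exI[of _ 1])

lemma subset_zero_locus_iff:
  "X \<subseteq> zero_locus S T F \<longleftrightarrow> X \<subseteq> proj_space S \<times> proj_space T \<and> (\<forall>f\<in>F. vanishes f X)"
  by (fastforce simp: zero_locus_def vanishes_def cone_def)

lemma mem_zero_locus_iff:
  "p \<in> zero_locus S T F \<longleftrightarrow> p \<in> proj_space S \<times> proj_space T \<and> (\<forall>f\<in>F. vanishes f {p})"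
  using subset_zero_locus_iff[of "{p}"] by auto

text \<open>By bihomogeneity the vanishing of a form at a point can be tested on one pair of coordinate vectors.\<close>

lemma vanishes_point:
  assumes "bihom S T f"
  shows "vanishes f {(proj_pt x, proj_pt y)} \<longleftrightarrow> f x y = 0"
proof
  assume "vanishes f {(proj_pt x, proj_pt y)}"
  then show "f x y = 0" by (auto simp: vanishes_def cone_def proj_pt_self)
next
  assume f: "f x y = 0"
  obtain d e where "bihom_poly S T d e f" using assms by (auto simp: bihom_def)
  then show "vanishes f {(proj_pt x, proj_pt y)}"
    using f by (auto simp: vanishes_def cone_def proj_pt_def bihom_poly_scale)
qed

lemma cone_pointI: "(proj_pt x, proj_pt y) \<in> X \<Longrightarrow> (x, y) \<in> cone X"
  unfolding cone_def using proj_pt_self[of x] proj_pt_self[of y] by blast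

text \<open>Primality of the bihomogeneous vanishing ideal of \<open>X\<close>, which is irreducibility of \<open>X\<close> in algebraic terms.\<close>

definition prime_on :: "'i set \<Rightarrow> 'j set \<Rightarrow> (('i \<Rightarrow> complex) set \<times> ('j \<Rightarrow> complex) set) set \<Rightarrow> bool" where
  "prime_on S T X \<longleftrightarrow> X \<noteq> {} \<and> (\<forall>f g. bihom S T f \<longrightarrow> bihom S T g \<longrightarrow>
     vanishes (\<lambda>x y. f x y * g x y) X \<longrightarrow> vanishes f X \<or> vanishes g X)"

lemma closedin_zariski_subtopology:
  "closedin (subtopology (zariski S T) X) C \<longleftrightarrow>
    (\<exists>F. (\<forall>f\<in>F. bihom S T f) \<and> C = X \<inter> zero_locus S T F)"
  unfolding closedin_subtopology closedin_zariski zariski_closed_def bihom_def by blast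

text \<open>Two proper closed subsets covering \<open>X\<close> give two forms that do not vanish on \<open>X\<close> but whose product does; conversely
such forms cut out two proper closed subsets covering \<open>X\<close>.\<close>

lemma irreducible_space_iff_prime_on:
  assumes X: "X \<subseteq> proj_space S \<times> proj_space T"
  shows "irreducible_space (subtopology (zariski S T) X) \<longleftrightarrow> prime_on S T X"
proof
  have top: "topspace (subtopology (zariski S T) X) = X"
    using X by (auto simp: topspace_zariski)
  {
    assume prime: "prime_on S T X"
    show "irreducible_space (subtopology (zariski S T) X)"
      unfolding irreducible_space_def top
    proof (intro conjI allI impI)
      show "X \<noteq> {}" using prime by (simp add: prime_on_def)
      fix C D assume CD: "closedin (subtopology (zariski S T) X) C \<and>
        closedin (subtopology (zariski S T) X) D \<and> C \<union> D = X"
      then obtain F G where F: "\<forall>f\<in>F. bihom S T f" "C = X \<inter> zero_locus S T F"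
        and G: "\<forall>f\<in>G. bihom S T f" "D = X \<inter> zero_locus S T G"
        unfolding closedin_zariski_subtopology by blast
      show "C = X \<or> D = X"
      proof (rule ccontr)
        assume "\<not> (C = X \<or> D = X)"
        then have "\<not> X \<subseteq> zero_locus S T F" "\<not> X \<subseteq> zero_locus S T G" using F(2) G(2) by auto
        then obtain f g where fg: "f \<in> F" "\<not> vanishes f X" "g \<in> G" "\<not> vanishes g X"
          using X by (auto simp: subset_zero_locus_iff)
        have "vanishes f C" "vanishes g D"
          using subset_zero_locus_iff[of C S T F] subset_zero_locus_iff[of D S T G] F(2) G(2) fg by auto
        then have "vanishes (\<lambda>x y. f x y * g x y) (C \<union> D)"
          by (auto simp: vanishes_def cone_def)
        then have "vanishes (\<lambda>x y. f x y * g x y) X" using CD by simp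
        then show False using prime fg F(1) G(1) by (auto simp: prime_on_def)
      qed
    qed
  }
  {
    assume irr: "irreducible_space (subtopology (zariski S T) X)"
    show "prime_on S T X"
      unfolding prime_on_def
    proof (intro conjI allI impI)
      show "X \<noteq> {}" using irr top by (simp add: irreducible_space_def)
      fix f g assume fg: "bihom S T f" "bihom S T g" "vanishes (\<lambda>x y. f x y * g x y) X"
      define C where "C = X \<inter> zero_locus S T {f}"
      define D where "D = X \<inter> zero_locus S T {g}"
      have "closedin (subtopology (zariski S T) X) C" "closedin (subtopology (zariski S T) X) D"
        unfolding closedin_zariski_subtopology C_def D_def using fg by blast+
      moreover have "X \<subseteq> C \<union> D"
      proof
        fix p assume p: "p \<in> X"
        then have "p \<in> proj_space S \<times> proj_space T" using X by blast
        then obtain x y where xy: "p = (proj_pt x, proj_pt y)" by (auto simp: proj_space_def)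
        have "vanishes (\<lambda>x y. f x y * g x y) {p}" using vanishes_mono[OF _ fg(3), of "{p}"] p by simp
        then have "f x y * g x y = 0" using vanishes_point[OF bihom_mult[OF fg(1,2)]] xy by blast
        then have "f x y = 0 \<or> g x y = 0" by simp
        then show "p \<in> C \<union> D"
          using p X fg(1,2) xy by (auto simp: C_def D_def mem_zero_locus_iff vanishes_point)
      qed
      moreover have "C \<subseteq> X" "D \<subseteq> X" by (auto simp: C_def D_def)
      ultimately have "C = X \<or> D = X"
        using irr unfolding irreducible_space_def top by blast
      then show "vanishes f X \<or> vanishes g X"
        using subset_zero_locus_iff[of X S T "{f}"] subset_zero_locus_iff[of X S T "{g}"]
        by (auto simp: C_def D_def)
    qed
  }
qed

lemma bihom_poly_power: "bihom_poly S T d e f \<Longrightarrow> bihom_poly S T (n * d) (n * e) (\<lambda>x y. f x y ^ n)"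
proof (induction n)
  case 0
  show ?case using bihom_poly.const[of S T 1] by simp
next
  case (Suc n)
  show ?case using bihom_poly.mult[OF Suc.prems Suc.IH[OF Suc.prems]] by simp
qed

lemma bihom_poly_prod:
  assumes "finite I" "\<And>i. i \<in> I \<Longrightarrow> bihom_poly S T (d i) (e i) (f i)"
  shows "bihom_poly S T (\<Sum>i\<in>I. d i) (\<Sum>i\<in>I. e i) (\<lambda>x y. \<Prod>i\<in>I. f i x y)"
  using assms
proof (induction I rule: finite_induct)
  case empty
  show ?case using bihom_poly.const[of S T 1] by simp
next
  case (insert i I)
  then show ?case using bihom_poly.mult[of S T "d i" "e i" "f i"] by simp
qed

lemma bihom_poly_sum:
  assumes "finite I" "I \<noteq> {}" "\<And>i. i \<in> I \<Longrightarrow> bihom_poly S T d e (f i)"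
  shows "bihom_poly S T d e (\<lambda>x y. \<Sum>i\<in>I. f i x y)"
  using assms
proof (induction I rule: finite_ne_induct)
  case (singleton i)
  then show ?case by simp
next
  case (insert i I)
  then show ?case by (simp add: bihom_poly.add)
qed

lemma bihom_poly_cmult: "bihom_poly S T d e f \<Longrightarrow> bihom_poly S T d e (\<lambda>x y. c * f x y)"
  using bihom_poly.mult[OF bihom_poly.const[of S T c], of d e f] by simp

text \<open>The forms used along a chain share one bidegree, so that every homogeneous expression in them is again a form.\<close>

lemma bihom_poly_forms:
  assumes "\<And>i. i \<le> j \<Longrightarrow> bihom_poly S T E E' (f i)"
  shows "bihom_poly S T (D * E) (D * E')
    (\<lambda>x y. \<Sum>a\<in>exponents j D. c a * (\<Prod>i\<le>j. f i x y ^ a i))"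
proof (rule bihom_poly_sum[OF finite_exponents])
  have "(\<lambda>i. if i = 0 then D else 0) \<in> exponents j D" by (simp add: exponents_def)
  then show "exponents j D \<noteq> {}" by blast
  fix a assume a: "a \<in> exponents j D"
  have "bihom_poly S T (\<Sum>i\<le>j. a i * E) (\<Sum>i\<le>j. a i * E') (\<lambda>x y. \<Prod>i\<le>j. f i x y ^ a i)"
    by (rule bihom_poly_prod) (auto intro: bihom_poly_power assms)
  moreover have "(\<Sum>i\<le>j. a i * n) = D * n" for n
    using a by (simp add: exponents_def flip: sum_distrib_right)
  ultimately show "bihom_poly S T (D * E) (D * E') (\<lambda>x y. c a * (\<Prod>i\<le>j. f i x y ^ a i))"
    by (simp add: bihom_poly_cmult)
qed

text \<open>\<open>(\<phi>, \<psi>)\<close> is a polynomial map from the affine space with coordinates \<open>U\<close> to pairs of nonzero coordinate vectors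
whose image in \<open>X\<close> is dense for the Zariski topology.\<close>

locale parametrised =
  fixes S :: "'i set" and T :: "'j set" and X :: "(('i \<Rightarrow> complex) set \<times> ('j \<Rightarrow> complex) set) set"
    and U :: "'u set" and \<phi> :: "('u \<Rightarrow> complex) \<Rightarrow> 'i \<Rightarrow> complex" and \<psi> :: "('u \<Rightarrow> complex) \<Rightarrow> 'j \<Rightarrow> complex"
  assumes finite_U: "finite U"
    and X: "X \<subseteq> proj_space S \<times> proj_space T"
    and polyfun_\<phi>: "\<And>i. i \<in> S \<Longrightarrow> polyfun U (\<lambda>t. \<phi> t i)"
    and polyfun_\<psi>: "\<And>j. j \<in> T \<Longrightarrow> polyfun U (\<lambda>t. \<psi> t j)"
    and in_X: "\<And>t. (proj_pt (\<phi> t), proj_pt (\<psi> t)) \<in> X"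
    and dense: "\<And>f. bihom S T f \<Longrightarrow> (\<And>t. f (\<phi> t) (\<psi> t) = 0) \<Longrightarrow> vanishes f X"
begin

abbreviation pullback :: "(('i \<Rightarrow> complex) \<Rightarrow> ('j \<Rightarrow> complex) \<Rightarrow> complex) \<Rightarrow> ('u \<Rightarrow> complex) \<Rightarrow> complex" where
  "pullback f t \<equiv> f (\<phi> t) (\<psi> t)"

abbreviation \<T> :: "(('i \<Rightarrow> complex) set \<times> ('j \<Rightarrow> complex) set) topology" where
  "\<T> \<equiv> subtopology (zariski S T) X"

lemma polyfun_pullback: "bihom S T f \<Longrightarrow> polyfun U (\<lambda>t. pullback f t)"
  unfolding bihom_def using polyfun_bihom_poly polyfun_\<phi> polyfun_\<psi> by blast

lemma vanishes_pullback:
  assumes "vanishes f X" shows "pullback f t = 0"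
proof -
  have "(\<phi> t, \<psi> t) \<in> cone X" using in_X by (rule cone_pointI)
  then show ?thesis using assms by (auto simp: vanishes_def)
qed

lemma prime_on_X: "prime_on S T X"
  unfolding prime_on_def
proof (intro conjI allI impI)
  show "X \<noteq> {}" using in_X by blast
  fix f g assume fg: "bihom S T f" "bihom S T g" "vanishes (\<lambda>x y. f x y * g x y) X"
  have "pullback f t * pullback g t = 0" for t
    using vanishes_pullback[OF fg(3)] by simp
  from polyfun_mult_eq_0[OF polyfun_pullback[OF fg(1)] polyfun_pullback[OF fg(2)] this]
  show "vanishes f X \<or> vanishes g X" using dense fg(1,2) by blast
qed

lemma irreduciblein_X: "irreduciblein (zariski S T) X"
  unfolding irreduciblein_def
  using X prime_on_X irreducible_space_iff_prime_on[OF X] by (simp add: topspace_zariski)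

text \<open>Each strict inclusion in the chain provides a form vanishing on the smaller set only. Multiplying by powers of two
coordinates \<open>x i0\<close> and \<open>y j0\<close> that are nonzero at a point of the smallest member brings all these forms to one bidegree,
and primality keeps them nonzero where they should be. Then the monomials in them are linearly independent.\<close>

lemma chain_length_le:
  assumes Z: "\<And>i. i \<le> l \<Longrightarrow> closedin \<T> (Z i)"
    and irr: "\<And>i. i \<le> l \<Longrightarrow> irreduciblein \<T> (Z i)"
    and strict: "\<And>i. i < l \<Longrightarrow> Z i \<subset> Z (Suc i)"
  shows "l \<le> card U"
proof -
  have ZX: "Z i \<subseteq> X" if "i \<le> l" for i
    using closedin_subset[OF Z[OF that]] by auto
  have prime: "prime_on S T (Z i)" if "i \<le> l" for i
  proof -
    have "subtopology \<T> (Z i) = subtopology (zariski S T) (Z i)"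
      using ZX[OF that] by (simp add: subtopology_subtopology Int_absorb1)
    then have "irreducible_space (subtopology (zariski S T) (Z i))"
      using irr[OF that] by (simp add: irreduciblein_def)
    then show ?thesis using irreducible_space_iff_prime_on[of "Z i" S T] ZX[OF that] X by auto
  qed
  have chain: "Z i \<subseteq> Z j" if "i \<le> j" "j \<le> l" for i j
    using that
  proof (induction j)
    case (Suc j)
    then show ?case using strict[of j] by (cases "i = Suc j") auto
  qed simp
  have "\<exists>f d e. bihom_poly S T d e f \<and> vanishes f (Z i) \<and> \<not> vanishes f (Z (Suc i))" if i: "i < l" for i
  proof -
    obtain F where F: "\<forall>f\<in>F. bihom S T f" "Z i = X \<inter> zero_locus S T F"
      using Z[of i] i unfolding closedin_zariski_subtopology by auto
    have "\<not> Z (Suc i) \<subseteq> zero_locus S T F"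
      using strict[OF i] F(2) ZX[of "Suc i"] i by auto
    moreover have "Z (Suc i) \<subseteq> proj_space S \<times> proj_space T" using ZX[of "Suc i"] X i by auto
    ultimately obtain f where f: "f \<in> F" "\<not> vanishes f (Z (Suc i))"
      by (auto simp: subset_zero_locus_iff)
    moreover have "vanishes f (Z i)"
      using subset_zero_locus_iff[of "Z i" S T F] F(2) f(1) by auto
    moreover obtain d e where "bihom_poly S T d e f" using F(1) f(1) by (auto simp: bihom_def)
    ultimately show ?thesis by blast
  qed
  then obtain f d e where f: "\<And>i. i < l \<Longrightarrow> bihom_poly S T (d i) (e i) (f i)"
    "\<And>i. i < l \<Longrightarrow> vanishes (f i) (Z i)" "\<And>i. i < l \<Longrightarrow> \<not> vanishes (f i) (Z (Suc i))"
    by metis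
  obtain p where "p \<in> Z 0" using prime[of 0] by (auto simp: prime_on_def)
  then obtain x0 y0 where xy: "x0 \<in> coord_space S - {\<lambda>_. 0}" "y0 \<in> coord_space T - {\<lambda>_. 0}"
    "(proj_pt x0, proj_pt y0) \<in> Z 0"
    using ZX[of 0] X by (fastforce simp: proj_space_def)
  then obtain i0 j0 where ij: "x0 i0 \<noteq> 0" "y0 j0 \<noteq> 0" "i0 \<in> S" "j0 \<in> T"
    by (auto simp: coord_space_def fun_eq_iff)
  have xy0: "(x0, y0) \<in> cone (Z 0)" using xy(3) by (rule cone_pointI)
  define h where "h E E' = (\<lambda>(x :: 'i \<Rightarrow> complex) (y :: 'j \<Rightarrow> complex). x i0 ^ E * y j0 ^ E')" for E E' :: nat
  have h: "bihom_poly S T E E' (h E E')" for E E'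
    using bihom_poly.mult[OF bihom_poly_power[OF bihom_poly.var1[OF ij(3)], of T E]
        bihom_poly_power[OF bihom_poly.var2[OF ij(4)], of S E']]
    by (simp add: h_def)
  have h0: "\<not> vanishes (h E E') (Z i)" if "i \<le> l" for i E E'
  proof -
    have "(x0, y0) \<in> cone (Z i)" using xy0 cone_mono[OF chain[of 0 i]] that by auto
    then show ?thesis using ij by (auto simp: vanishes_def h_def)
  qed
  define E where "E = (\<Sum>i<l. d i)"
  define E' where "E' = (\<Sum>i<l. e i)"
  have E: "d i \<le> E" "e i \<le> E'" if "i < l" for i
    using that by (auto simp: E_def E'_def intro: member_le_sum)
  define g where "g i = (case i of 0 \<Rightarrow> h E E' |
     Suc i \<Rightarrow> (\<lambda>x y. f i x y * h (E - d i) (E' - e i) x y))" for i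
  have g: "bihom_poly S T E E' (g i)" if "i \<le> l" for i
  proof (cases i)
    case 0
    then show ?thesis using h by (simp add: g_def)
  next
    case (Suc j)
    then show ?thesis using bihom_poly.mult[OF f(1) h, of j "E - d j" "E' - e j"] E[of j] that
      by (simp add: g_def)
  qed
  have g_zero: "vanishes (g (Suc i)) (Z i)" if "i < l" for i
    using f(2)[OF that] by (auto simp: g_def vanishes_def)
  have g_nonzero: "\<not> vanishes (g i) (Z i)" if "i \<le> l" for i
  proof (cases i)
    case 0
    then show ?thesis using h0 by (simp add: g_def)
  next
    case (Suc j)
    have "bihom S T (f j)" "bihom S T (h (E - d j) (E' - e j))"
      using f(1)[of j] h[of "E - d j" "E' - e j"] that Suc unfolding bihom_def by auto
    then show ?thesis
      using prime[OF that] h0[OF that] f(3)[of j] that Suc by (auto simp: g_def prime_on_def)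
  qed
  define forms where "forms = {\<lambda>(x, y). q x y | q. bihom S T q}"
  show "l \<le> card U"
  proof (rule independent_forms_le[OF finite_U, where F = "\<lambda>i t. g i (\<phi> t) (\<psi> t)"])
    fix i assume "i \<le> l"
    then have "bihom S T (g i)" using g by (auto simp: bihom_def)
    then show "polyfun U (\<lambda>t. g i (\<phi> t) (\<psi> t))" by (rule polyfun_pullback)
  next
    fix D c a
    assume z: "\<And>t. (\<Sum>a\<in>exponents l D. c a * (\<Prod>i\<le>l. g i (\<phi> t) (\<psi> t) ^ a i)) = 0"
      and a: "a \<in> exponents l D"
    define q where "q = (\<lambda>x y. \<Sum>a\<in>exponents l D. c a * (\<Prod>i\<le>l. g i x y ^ a i))"
    have "bihom S T q" unfolding bihom_def q_def using bihom_poly_forms[of l S T E E' g] g by blast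
    then have "vanishes q X" by (rule dense) (use z in \<open>simp add: q_def\<close>)
    then have q: "vanishes q (Z l)" using ZX vanishes_mono by blast
    show "c a = 0"
    proof (rule chain_forms_independent[where l = l and f = "\<lambda>i p. g i (fst p) (snd p)" and \<A> = forms
          and Z = "\<lambda>i. cone (Z i)" and j = l and D = D and c = c and a = a])
      fix j D and c :: "(nat \<Rightarrow> nat) \<Rightarrow> complex" assume "j \<le> l"
      then have "bihom S T (\<lambda>x y. \<Sum>a\<in>exponents j D. c a * (\<Prod>i\<le>j. g i x y ^ a i))"
        unfolding bihom_def using bihom_poly_forms[of j S T E E' g] g by (meson le_trans)
      then show "(\<lambda>p. \<Sum>a\<in>exponents j D. c a * (\<Prod>i\<le>j. g i (fst p) (snd p) ^ a i)) \<in> forms"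
        unfolding forms_def by (force simp: split_def)
    next
      fix i assume "i \<le> l"
      then show "(\<lambda>p. g i (fst p) (snd p)) \<in> forms"
        unfolding forms_def bihom_def using g by (force simp: split_def)
    next
      fix j u v assume j: "j \<le> l" and uv: "u \<in> forms" "v \<in> forms" "\<And>p. p \<in> cone (Z j) \<Longrightarrow> u p * v p = 0"
      obtain u' v' where uv': "u = (\<lambda>(x, y). u' x y)" "v = (\<lambda>(x, y). v' x y)" "bihom S T u'" "bihom S T v'"
        using uv(1,2) by (auto simp: forms_def)
      have "vanishes (\<lambda>x y. u' x y * v' x y) (Z j)"
        using uv(3) uv' by (auto simp: vanishes_def)
      then have "vanishes u' (Z j) \<or> vanishes v' (Z j)" using prime[OF j] uv' by (auto simp: prime_on_def)
      then show "(\<forall>p\<in>cone (Z j). u p = 0) \<or> (\<forall>p\<in>cone (Z j). v p = 0)"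
        by (auto simp: vanishes_def uv')
    next
      show "\<exists>p\<in>cone (Z 0). g 0 (fst p) (snd p) \<noteq> 0"
        using g_nonzero[of 0] by (force simp: vanishes_def)
    next
      fix i p assume "i < l" "p \<in> cone (Z i)"
      then show "g (Suc i) (fst p) (snd p) = 0" using g_zero by (auto simp: vanishes_def split_def)
    next
      fix i assume "i < l"
      then show "\<exists>p\<in>cone (Z (Suc i)). g (Suc i) (fst p) (snd p) \<noteq> 0"
        using g_nonzero[of "Suc i"] by (auto simp: vanishes_def split_def)
    next
      fix i assume "i < l"
      then show "cone (Z i) \<subseteq> cone (Z (Suc i))" using strict cone_mono by blast
    next
      fix p assume "p \<in> cone (Z l)"
      then show "(\<Sum>a\<in>exponents l D. c a * (\<Prod>i\<le>l. g i (fst p) (snd p) ^ a i)) = 0"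
        using q by (auto simp: vanishes_def q_def split_def)
    qed (use a in auto)
  qed
qed

lemma zero_locus_antimono: "F \<subseteq> G \<Longrightarrow> zero_locus S T G \<subseteq> zero_locus S T F"
  unfolding zero_locus_def by auto

text \<open>The closure in \<open>X\<close> of the image of the coordinate subspace on which the parameters outside \<open>L\<close> vanish.\<close>

definition param_hull :: "'u set \<Rightarrow> (('i \<Rightarrow> complex) set \<times> ('j \<Rightarrow> complex) set) set" where
  "param_hull L = X \<inter> zero_locus S T
     {f. bihom S T f \<and> (\<forall>t. pullback f (zero_outside L t) = 0)}"

lemma in_param_hull:
  "(proj_pt (\<phi> (zero_outside L t)), proj_pt (\<psi> (zero_outside L t))) \<in> param_hull L" (is "?p \<in> _")
proof -
  have "vanishes f {?p}"
    if "bihom S T f" "\<forall>t. pullback f (zero_outside L t) = 0" for f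
    by (rule iffD2[OF vanishes_point[OF that(1)] spec[OF that(2)]])
  moreover have "?p \<in> X" by (rule in_X)
  ultimately show ?thesis
    using X unfolding param_hull_def mem_zero_locus_iff Int_iff mem_Collect_eq by (auto simp only:)
qed

lemma vanishes_param_hull_iff:
  assumes "bihom S T f"
  shows "vanishes f (param_hull L) \<longleftrightarrow> (\<forall>t. pullback f (zero_outside L t) = 0)"
proof
  assume v: "vanishes f (param_hull L)"
  show "\<forall>t. pullback f (zero_outside L t) = 0"
  proof
    fix t
    let ?p = "(proj_pt (\<phi> (zero_outside L t)), proj_pt (\<psi> (zero_outside L t)))"
    have "?p \<in> param_hull L" by (rule in_param_hull)
    then have "vanishes f {?p}" using vanishes_mono[OF _ v, of "{?p}"] by blast
    then show "pullback f (zero_outside L t) = 0" by (rule iffD1[OF vanishes_point[OF assms]])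
  qed
next
  assume z: "\<forall>t. pullback f (zero_outside L t) = 0"
  have "\<forall>g \<in> {f. bihom S T f \<and> (\<forall>t. pullback f (zero_outside L t) = 0)}.
      vanishes g (param_hull L)"
    by (rule conjunct2[OF iffD1[OF subset_zero_locus_iff[of _ S T]]]) (simp add: param_hull_def)
  then show "vanishes f (param_hull L)"
    by (rule bspec) (intro CollectI conjI assms z)
qed

lemma param_hull_closed_irreducible:
  "closedin \<T> (param_hull L)"
  "irreduciblein \<T> (param_hull L)"
proof -
  show "closedin \<T> (param_hull L)"
    unfolding closedin_zariski_subtopology param_hull_def
    by (rule exI, rule conjI[OF _ refl]) simp
  have sub: "param_hull L \<subseteq> X" by (simp add: param_hull_def)
  have "prime_on S T (param_hull L)"
    unfolding prime_on_def
  proof (intro conjI allI impI)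
    show "param_hull L \<noteq> {}" using in_param_hull by blast
    fix f g assume fg: "bihom S T f" "bihom S T g" "vanishes (\<lambda>x y. f x y * g x y) (param_hull L)"
    let ?r = "\<lambda>f t. pullback f (zero_outside L t)"
    have "?r f t * ?r g t = 0" for t
      using iffD1[OF vanishes_param_hull_iff[OF bihom_mult[OF fg(1,2)]] fg(3)] by (rule spec)
    from polyfun_mult_eq_0[OF polyfun_zero_outside[OF polyfun_pullback[OF fg(1)]]
        polyfun_zero_outside[OF polyfun_pullback[OF fg(2)]] this]
    show "vanishes f (param_hull L) \<or> vanishes g (param_hull L)"
      unfolding vanishes_param_hull_iff[OF fg(1)] vanishes_param_hull_iff[OF fg(2)] .
  qed
  then have "irreducible_space (subtopology (zariski S T) (param_hull L))"
    using irreducible_space_iff_prime_on[OF subset_trans[OF sub X]] by simp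
  moreover have "param_hull L \<subseteq> topspace \<T>"
    using sub X by (simp add: topspace_zariski)
  ultimately show "irreduciblein \<T> (param_hull L)"
    using sub by (simp add: irreduciblein_def subtopology_subtopology Int_absorb1)
qed

lemma param_hull_mono:
  assumes "L \<subseteq> L'"
  shows "param_hull L \<subseteq> param_hull L'"
proof -
  have restr: "zero_outside L' (zero_outside L t) = zero_outside L t" for t :: "'u \<Rightarrow> complex"
    using assms by (auto simp: zero_outside_def fun_eq_iff)
  have "{f. bihom S T f \<and> (\<forall>t. pullback f (zero_outside L' t) = 0)} \<subseteq>
     {f. bihom S T f \<and> (\<forall>t. pullback f (zero_outside L t) = 0)}"
  proof clarify
    fix f t assume "\<forall>t. pullback f (zero_outside L' t) = 0"
    from this[rule_format, of "zero_outside L t"]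
    show "pullback f (zero_outside L t) = 0" unfolding restr .
  qed
  then show ?thesis unfolding param_hull_def by (intro Int_mono order_refl zero_locus_antimono)
qed

text \<open>Releasing the parameters in the order \<open>us\<close> gives an increasing sequence of irreducible closed sets, the closures of the
images of coordinate subspaces. It is strict when for each parameter some form vanishes on the image before, but not
after, that parameter is released.\<close>

theorem krull_dim_X:
  assumes us: "distinct us" "set us = U"
    and detect: "\<And>i. i < length us \<Longrightarrow> \<exists>f. bihom S T f \<and>
      (\<forall>t. pullback f (zero_outside (set (take i us)) t) = 0) \<and>
      (\<exists>t. f (\<phi> (zero_outside (set (take (Suc i) us)) t)) (\<psi> (zero_outside (set (take (Suc i) us)) t)) \<noteq> 0)"
  shows "krull_dim \<T> = enat (card U)"
proof (rule antisym)
  show "krull_dim \<T> \<le> enat (card U)"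
    unfolding krull_dim_def
  proof (rule Sup_least)
    fix x assume "x \<in> {enat l | l. \<exists>Z. (\<forall>i\<le>l. closedin \<T> (Z i) \<and>
      irreduciblein \<T> (Z i)) \<and> (\<forall>i<l. Z i \<subset> Z (Suc i))}"
    then have "\<exists>l. x = enat l \<and> (\<exists>Z. (\<forall>i\<le>l. closedin \<T> (Z i) \<and>
      irreduciblein \<T> (Z i)) \<and> (\<forall>i<l. Z i \<subset> Z (Suc i)))"
      unfolding mem_Collect_eq .
    then obtain l Z where x: "x = enat l"
      and Z: "(\<forall>i\<le>l. closedin \<T> (Z i) \<and>
      irreduciblein \<T> (Z i)) \<and> (\<forall>i<l. Z i \<subset> Z (Suc i))"
      by (elim exE conjE[of "x = _"]) (rule that)
    have "l \<le> card U" by (rule chain_length_le[of l Z]) (use Z in simp_all)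
    then show "x \<le> enat (card U)" by (simp add: x)
  qed
  have "param_hull (set (take i us)) \<subset> param_hull (set (take (Suc i) us))" if "i < card U" for i
  proof -
    have i: "i < length us" using that distinct_card[OF us(1)] us(2) by simp
    obtain f where f: "bihom S T f"
      "\<forall>t. pullback f (zero_outside (set (take i us)) t) = 0"
      "\<exists>t. f (\<phi> (zero_outside (set (take (Suc i) us)) t)) (\<psi> (zero_outside (set (take (Suc i) us)) t)) \<noteq> 0"
      using detect[OF i] by (elim exE[of "\<lambda>f. bihom S T f \<and> _ f"] conjE) (rule that)
    have v: "vanishes f (param_hull (set (take i us)))"
      by (rule iffD2[OF vanishes_param_hull_iff[OF f(1)] f(2)])
    have nv: "\<not> vanishes f (param_hull (set (take (Suc i) us)))"
    proof
      assume "vanishes f (param_hull (set (take (Suc i) us)))"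
      from iffD1[OF vanishes_param_hull_iff[OF f(1)] this] f(3) show False by blast
    qed
    have ne: "param_hull (set (take i us)) \<noteq> param_hull (set (take (Suc i) us))"
    proof
      assume "param_hull (set (take i us)) = param_hull (set (take (Suc i) us))"
      with v nv show False by (simp only: simp_thms)
    qed
    have "set (take i us) \<subseteq> set (take (Suc i) us)" by (rule set_take_subset_set_take) (rule le_SucI, rule order_refl)
    then have "param_hull (set (take i us)) \<subseteq> param_hull (set (take (Suc i) us))" by (rule param_hull_mono)
    then show ?thesis using ne by (rule psubsetI)
  qed
  then have "(\<forall>i\<le>card U. closedin \<T> (param_hull (set (take i us))) \<and>
      irreduciblein \<T> (param_hull (set (take i us)))) \<and>
      (\<forall>i<card U. param_hull (set (take i us)) \<subset> param_hull (set (take (Suc i) us)))"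
    using param_hull_closed_irreducible by simp
  then have "\<exists>Z. (\<forall>i\<le>card U. closedin \<T> (Z i) \<and>
      irreduciblein \<T> (Z i)) \<and> (\<forall>i<card U. Z i \<subset> Z (Suc i))"
    by (rule exI[of _ "\<lambda>i. param_hull (set (take i us))"])
  then show "enat (card U) \<le> krull_dim \<T>"
    unfolding krull_dim_def by (intro Sup_upper CollectI exI[of _ "card U"] conjI refl)
qed

end

section \<open>Subspaces and matrices of full row rank\<close>

abbreviation row_sp :: "nat \<Rightarrow> complex mat \<Rightarrow> complex vec set" where
  "row_sp n \<equiv> vec_space.row_space n"

abbreviation perp :: "nat \<Rightarrow> complex vec set \<Rightarrow> complex vec set" where
  "perp n \<equiv> vec_module.orthogonal_complement n"

abbreviation lin_indep :: "nat \<Rightarrow> complex vec set \<Rightarrow> bool" where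
  "lin_indep n \<equiv> module.lin_indpt class_ring (Cn n)"

abbreviation sdim :: "nat \<Rightarrow> complex vec set \<Rightarrow> nat" where
  "sdim n W \<equiv> vectorspace.dim class_ring (Cn n\<lparr>carrier := W\<rparr>)"

text \<open>Full row rank, expressed by a right inverse: an equation between matrices is easier to produce and to use than
a statement about dimensions.\<close>

definition full_row_rank :: "nat \<Rightarrow> nat \<Rightarrow> complex mat \<Rightarrow> bool" where
  "full_row_rank k n A \<longleftrightarrow> A \<in> carrier_mat k n \<and> (\<exists>R\<in>carrier_mat n k. A * R = 1\<^sub>m k)"

lemma full_row_rank_carrier: "full_row_rank k n A \<Longrightarrow> A \<in> carrier_mat k n"
  by (simp add: full_row_rank_def)

lemma full_row_rank_square: "full_row_rank n n A \<Longrightarrow> det A \<noteq> 0"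
  by (auto simp: full_row_rank_def) (metis det_mult det_one mult_zero_left zero_neq_one)

lemma det_nonzero_inverse:
  fixes A :: "complex mat"
  assumes A: "A \<in> carrier_mat n n" and d: "det A \<noteq> 0"
  obtains B where "B \<in> carrier_mat n n" "A * B = 1\<^sub>m n" "B * A = 1\<^sub>m n"
proof
  let ?B = "(1 / det A) \<cdot>\<^sub>m adj_mat A"
  show B: "?B \<in> carrier_mat n n" using adj_mat(1)[OF A] by simp
  have "A * ?B = (1 / det A) \<cdot>\<^sub>m (A * adj_mat A)"
    using A adj_mat(1)[OF A] by (intro mult_smult_distrib) auto
  also have "\<dots> = 1\<^sub>m n" unfolding adj_mat(2)[OF A] using d by (intro eq_matI) auto
  finally show AB: "A * ?B = 1\<^sub>m n" .
  show "?B * A = 1\<^sub>m n" by (rule mat_mult_left_right_inverse[OF A B AB])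
qed

lemma row_space_iff:
  assumes A: "A \<in> carrier_mat k n"
  shows "v \<in> row_sp n A \<longleftrightarrow> (\<exists>y\<in>carrier_vec k. v = A\<^sup>T *\<^sub>v y)"
  unfolding vec_space.row_space_eq[OF A] using A by auto

lemma row_in_row_space:
  assumes A: "A \<in> carrier_mat k n" and i: "i < k"
  shows "row A i \<in> row_sp n A"
  unfolding row_space_iff[OF A]
proof (rule bexI[of _ "unit_vec k i"])
  show "row A i = A\<^sup>T *\<^sub>v unit_vec k i"
    using A i by (intro eq_vecI) (auto simp: scalar_prod_right_unit)
qed simp

text \<open>A maximal linearly independent subset of \<open>W\<close> containing \<open>S\<close> spans \<open>W\<close>.\<close>

lemma (in vec_space) basis_of_subspace_extending:
  assumes W: "subspace class_ring W V" and S: "lin_indpt S" "S \<subseteq> W"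
  shows "\<exists>B. finite B \<and> S \<subseteq> B \<and> B \<subseteq> W \<and> lin_indpt B \<and> span B = W \<and>
    card B = vectorspace.dim class_ring (V\<lparr>carrier := W\<rparr>)"
proof -
  have sub: "submodule class_ring W V" using W by (simp add: subspace_def)
  have WV: "W \<subseteq> carrier_vec n" using sub by (simp add: submodule_def)
  have fin: "finite A \<and> card A \<le> n" if "S \<subseteq> A \<and> A \<subseteq> W \<and> lin_indpt A" for A
  proof -
    have "A \<subseteq> carrier_vec n" using that WV by blast
    then show ?thesis using li_le_dim[of A] that unfolding dim_is_n by simp
  qed
  obtain B where B: "finite B" "maximal B (\<lambda>A. S \<subseteq> A \<and> A \<subseteq> W \<and> lin_indpt A)"
    using maximal_exists[of "\<lambda>A. S \<subseteq> A \<and> A \<subseteq> W \<and> lin_indpt A" n S] fin S by auto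
  have B': "S \<subseteq> B" "B \<subseteq> W" "lin_indpt B" using B(2) by (auto simp: maximal_def)
  have BV: "B \<subseteq> carrier_vec n" using B'(2) WV by blast
  have "W \<subseteq> span B"
  proof
    fix v assume v: "v \<in> W"
    show "v \<in> span B"
    proof (rule ccontr)
      assume nv: "v \<notin> span B"
      then have "v \<notin> B" using in_own_span[OF BV] by blast
      moreover from this have "lin_indpt (B \<union> {v})"
        using lin_dep_iff_in_span[of B v] BV B'(3) v WV nv by auto
      ultimately show False
        using B(2) B'(1,2) v unfolding maximal_def by blast
    qed
  qed
  moreover have "span B \<subseteq> W" by (rule span_is_subset[OF B'(2) sub])
  ultimately have span: "span B = W" by blast
  interpret W: vectorspace class_ring "V\<lparr>carrier := W\<rparr>" by (rule subspace_is_vs[OF W])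
  have "W.span B = W" "\<not> W.lin_dep B"
    using span_li_not_depend[OF B'(2) sub] span B'(3) by auto
  then have "W.basis B" using B'(2) by (simp add: W.basis_def)
  then have "W.dim = card B" using W.dim_basis[OF B(1)] by simp
  then show ?thesis using B(1) B' span by auto
qed

text \<open>The columns of a right inverse express the unit vectors through the columns of \<open>A\<close>.\<close>

lemma full_row_rank_if_spanning:
  assumes A: "A \<in> carrier_mat k n" and sp: "module.span class_ring (Cn k) (set (cols A)) = carrier_vec k"
  shows "full_row_rank k n A"
proof -
  have "\<exists>x\<in>carrier_vec n. A *\<^sub>v x = unit_vec k i" if "i < k" for i
  proof -
    have "unit_vec k i \<in> vec_space.col_space k A"
      using sp by (simp add: vec_space.col_space_def)
    then show ?thesis using vec_space.col_space_eq[OF A] A by auto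
  qed
  then obtain x where x: "\<And>i. i < k \<Longrightarrow> x i \<in> carrier_vec n" "\<And>i. i < k \<Longrightarrow> A *\<^sub>v x i = unit_vec k i"
    by metis
  define R where "R = mat n k (\<lambda>(i, j). x j $ i)"
  have R: "R \<in> carrier_mat n k" by (simp add: R_def)
  have colR: "col R j = x j" if "j < k" for j using x(1)[OF that] that by (auto simp: R_def)
  have "A * R = 1\<^sub>m k"
  proof (rule eq_matI)
    fix i j assume ij: "i < dim_row (1\<^sub>m k :: complex mat)" "j < dim_col (1\<^sub>m k :: complex mat)"
    have "(A * R) $$ (i, j) = (A *\<^sub>v col R j) $ i" using ij A R by simp
    also have "\<dots> = unit_vec k j $ i" using x(2)[of j] colR[of j] ij by simp
    finally show "(A * R) $$ (i, j) = 1\<^sub>m k $$ (i, j)" using ij by (auto simp: unit_vec_def)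
  qed (use A R in auto)
  then show ?thesis using A R by (auto simp: full_row_rank_def)
qed

lemma full_row_rank_rows:
  assumes "full_row_rank k n A"
  shows "distinct (rows A)" "lin_indep n (set (rows A))"
proof -
  interpret vec_space "TYPE(complex)" n .
  obtain R where A: "A \<in> carrier_mat k n" and R: "R \<in> carrier_mat n k" "A * R = 1\<^sub>m k"
    using assms by (auto simp: full_row_rank_def)
  show d: "distinct (rows A)"
    unfolding distinct_conv_nth
  proof (intro allI impI notI)
    fix i j assume ij: "i < length (rows A)" "j < length (rows A)" "i \<noteq> j" "rows A ! i = rows A ! j"
    then have "row A i = row A j" using A by simp
    then have "(A * R) $$ (i, i) = (A * R) $$ (j, i)" using ij A R(1) by simp
    then show False using R(2) ij A by simp
  qed
  show "lin_indpt (set (rows A))"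
  proof
    assume "lin_dep (set (rows A))"
    then obtain v where v: "v \<in> carrier_vec k" "v \<noteq> 0\<^sub>v k" "A\<^sup>T *\<^sub>v v = 0\<^sub>v n"
      using lin_depE[of "A\<^sup>T" k] A d by auto
    have "R\<^sup>T * A\<^sup>T = 1\<^sub>m k" using transpose_mult[OF A R(1)] R(2) by simp
    then have "v = R\<^sup>T *\<^sub>v (A\<^sup>T *\<^sub>v v)"
      using v(1) A R(1) by (metis assoc_mult_mat_vec one_mult_mat_vec transpose_carrier_mat)
    also have "\<dots> = 0\<^sub>v k" unfolding v(3) using R(1) by auto
    finally show False using v(2) by simp
  qed
qed

lemma full_row_rank_Gr:
  assumes "full_row_rank k n A"
  shows "row_sp n A \<in> Gr k n"
proof -
  interpret vec_space "TYPE(complex)" n .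
  have A: "A \<in> carrier_mat k n" using assms by (rule full_row_rank_carrier)
  have rows: "set (rows A) \<subseteq> carrier_vec n" using A by (metis rows_carrier carrier_matD(2))
  have sub: "subspace class_ring (span (set (rows A))) V" by (rule span_is_subspace) (use rows in simp)
  obtain B where B: "set (rows A) \<subseteq> B" "B \<subseteq> span (set (rows A))" "lin_indpt B"
    "card B = vectorspace.dim class_ring (V\<lparr>carrier := span (set (rows A))\<rparr>)"
    using basis_of_subspace_extending[OF sub full_row_rank_rows(2)[OF assms] in_own_span[OF rows]] by blast
  have "B = set (rows A)"
  proof (rule ccontr)
    assume "B \<noteq> set (rows A)"
    then obtain v where v: "v \<in> B" "v \<notin> set (rows A)" using B(1) by blast
    have BV: "B \<subseteq> carrier_vec n" using B(2) span_is_subset2[OF rows] by blast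
    have "lin_dep (set (rows A) \<union> {v})"
      using lin_dep_iff_in_span[of "set (rows A)" v] rows full_row_rank_rows(2)[OF assms] v B(2) BV by blast
    moreover have "set (rows A) \<union> {v} \<subseteq> B" using v B(1) by blast
    ultimately show False using B(3) supset_ld_is_ld by blast
  qed
  then have "vectorspace.dim class_ring (V\<lparr>carrier := span (set (rows A))\<rparr>) = k"
    using B(4) distinct_card[OF full_row_rank_rows(1)[OF assms]] A by simp
  then show ?thesis using sub by (simp add: Gr_def row_space_def)
qed

lemma mat_of_independent_rows_extends:
  assumes vs: "distinct vs" "set vs \<subseteq> carrier_vec n" "lin_indep n (set vs)"
  shows "\<exists>G\<in>carrier_mat n n. det G \<noteq> 0 \<and> length vs \<le> n \<and> (\<forall>i<length vs. row G i = vs ! i)"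
proof -
  interpret vec_space "TYPE(complex)" n .
  have sub: "subspace class_ring (carrier_vec n) V"
    using span_is_subspace[OF unit_vecs_carrier] unfolding span_unit_vecs_is_carrier .
  obtain B where B: "finite B" "set vs \<subseteq> B" "B \<subseteq> carrier_vec n" "span B = carrier_vec n"
    "card B = vectorspace.dim class_ring (V\<lparr>carrier := carrier_vec n\<rparr>)"
    using basis_of_subspace_extending[OF sub vs(3,2)] by blast
  have "V\<lparr>carrier := carrier_vec n\<rparr> = V" by (simp add: module_vec_def)
  then have cB: "card B = n" using B(5) dim_is_n by metis
  obtain us where us: "distinct us" "set us = B - set vs"
    using finite_distinct_list[of "B - set vs"] B(1) by auto
  have ws: "distinct (vs @ us)" "set (vs @ us) = B" using vs(1) us B(2) by auto
  then have len: "length (vs @ us) = n" using distinct_card[OF ws(1)] cB by simp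
  define G where "G = mat_of_rows n (vs @ us)"
  have G: "G \<in> carrier_mat n n" using len by (auto simp: G_def intro: mat_of_rows_carrier)
  have rG: "rows G = vs @ us" unfolding G_def by (rule rows_mat_of_rows) (use ws B(3) in auto)
  have "full_row_rank n n G\<^sup>T"
    by (rule full_row_rank_if_spanning) (use G rG ws B(4) in auto)
  then have "det G \<noteq> 0" using full_row_rank_square det_transpose[OF G] by force
  moreover have "row G i = vs ! i" if "i < length vs" for i
    using rG that G len nth_rows[of i G] by (auto simp: nth_append)
  ultimately show ?thesis using G len by auto
qed

lemma full_row_rank_top:
  assumes G: "G \<in> carrier_mat n n" "det G \<noteq> 0" and k: "k \<le> n"
  shows "full_row_rank k n (mat k n (\<lambda>(i, j). G $$ (i, j)))"
proof -
  obtain H where H: "H \<in> carrier_mat n n" "G * H = 1\<^sub>m n" using det_nonzero_inverse[OF G] by metis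
  have "mat k n (\<lambda>(i, j). G $$ (i, j)) * mat n k (\<lambda>(i, j). H $$ (i, j)) = 1\<^sub>m k"
  proof (rule eq_matI)
    fix i j assume ij: "i < dim_row (1\<^sub>m k :: complex mat)" "j < dim_col (1\<^sub>m k :: complex mat)"
    have "(mat k n (\<lambda>(i, j). G $$ (i, j)) * mat n k (\<lambda>(i, j). H $$ (i, j))) $$ (i, j) = (G * H) $$ (i, j)"
      using ij k G H(1) by (simp add: scalar_prod_def)
    then show "(mat k n (\<lambda>(i, j). G $$ (i, j)) * mat n k (\<lambda>(i, j). H $$ (i, j))) $$ (i, j) = 1\<^sub>m k $$ (i, j)"
      using ij k H(2) by simp
  qed auto
  then show ?thesis by (auto simp: full_row_rank_def)
qed

lemma mat_of_independent_rows_full_row_rank: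
  assumes vs: "distinct vs" "set vs \<subseteq> carrier_vec n" "lin_indep n (set vs)"
  shows "full_row_rank (length vs) n (mat_of_rows n vs)"
proof -
  obtain G where G: "G \<in> carrier_mat n n" "det G \<noteq> 0" "length vs \<le> n"
    "\<And>i. i < length vs \<Longrightarrow> row G i = vs ! i"
    using mat_of_independent_rows_extends[OF assms] by blast
  have "mat (length vs) n (\<lambda>(i, j). G $$ (i, j)) = mat_of_rows n vs"
  proof (rule eq_matI)
    fix i j assume "i < dim_row (mat_of_rows n vs)" "j < dim_col (mat_of_rows n vs)"
    then have ij: "i < length vs" "j < n" by auto
    have "G $$ (i, j) = row G i $ j" using ij G(1,3) by simp
    then show "mat (length vs) n (\<lambda>(i, j). G $$ (i, j)) $$ (i, j) = mat_of_rows n vs $$ (i, j)"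
      using ij G(4) by (simp add: mat_of_rows_index)
  qed auto
  with full_row_rank_top[OF G(1,2,3)] show ?thesis by simp
qed

lemma Gr_basis_extending:
  assumes V: "V \<in> Gr k n" and S: "finite S" "S \<subseteq> V" "lin_indep n S"
  shows "\<exists>vs. distinct vs \<and> length vs = k \<and> set (take (card S) vs) = S \<and> card S \<le> k \<and> set vs \<subseteq> carrier_vec n \<and>
    lin_indep n (set vs) \<and> row_sp n (mat_of_rows n vs) = V"
proof -
  interpret vec_space "TYPE(complex)" n .
  have sub: "subspace class_ring V (Cn n)" and dim: "sdim n V = k"
    using V by (auto simp: Gr_def)
  have VV: "V \<subseteq> carrier_vec n" using sub by (simp add: subspace_def submodule_def)
  obtain B where B: "finite B" "S \<subseteq> B" "B \<subseteq> V" "lin_indpt B" "span B = V" "card B = k"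
    using basis_of_subspace_extending[OF sub S(3,2)] dim by auto
  obtain ss where ss: "distinct ss" "set ss = S" using finite_distinct_list[OF S(1)] by blast
  obtain us where us: "distinct us" "set us = B - S"
    using finite_distinct_list[of "B - S"] B(1) by auto
  have ws: "distinct (ss @ us)" "set (ss @ us) = B" using ss us B(2) by auto
  have len: "length ss = card S" "length (ss @ us) = k"
    using distinct_card[OF ss(1)] distinct_card[OF ws(1)] ss(2) ws(2) B(6) by auto
  have "rows (mat_of_rows n (ss @ us)) = ss @ us" by (rule rows_mat_of_rows) (use ws B(3) VV in auto)
  then have "row_space (mat_of_rows n (ss @ us)) = V"
    using ws(2) B(5) by (simp only: row_space_def)
  moreover have "card S \<le> k" using B(1,2,6) card_mono by blast
  ultimately show ?thesis
    using ws len ss(2) B(3,4) VV by (intro exI[of _ "ss @ us"] conjI) auto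
qed

lemma Gr_obtain_matrix:
  assumes "V \<in> Gr k n"
  obtains A where "full_row_rank k n A" "row_sp n A = V"
proof -
  interpret vec_space "TYPE(complex)" n .
  have "lin_indpt {}" by (simp add: lin_dep_def)
  then obtain vs where vs: "distinct vs" "length vs = k" "set vs \<subseteq> carrier_vec n"
    "lin_indpt (set vs)" "row_space (mat_of_rows n vs) = V"
    using Gr_basis_extending[OF assms, of "{}"] by auto
  show thesis using that[of "mat_of_rows n vs"] mat_of_independent_rows_full_row_rank[OF vs(1,3,4)] vs by simp
qed

text \<open>Each of the two matrices is a square matrix times the other, and a right inverse of \<open>A\<close> shows that the two square
matrices are inverse to each other.\<close>

lemma row_space_eq_change_of_basis:
  assumes A: "full_row_rank k n A" and A': "A' \<in> carrier_mat k n"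
    and eq: "row_sp n A = row_sp n A'"
  obtains P where "P \<in> carrier_mat k k" "det P \<noteq> 0" "A' = P * A"
proof -
  have ex: "\<exists>P\<in>carrier_mat k k. C = P * B"
    if B: "B \<in> carrier_mat k n" and C: "C \<in> carrier_mat k n"
      and sub: "row_sp n C \<subseteq> row_sp n B" for B C :: "complex mat"
  proof -
    have "\<exists>y\<in>carrier_vec k. row C i = B\<^sup>T *\<^sub>v y" if "i < k" for i
      using row_in_row_space[OF C that] sub row_space_iff[OF B] by blast
    then obtain y where y: "\<And>i. i < k \<Longrightarrow> y i \<in> carrier_vec k" "\<And>i. i < k \<Longrightarrow> row C i = B\<^sup>T *\<^sub>v y i"
      by metis
    define P where "P = mat k k (\<lambda>(i, j). y i $ j)"
    have rP: "row P i = y i" if "i < k" for i using y(1)[OF that] that by (auto simp: P_def)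
    have "C = P * B"
    proof (rule eq_matI)
      fix i j assume "i < dim_row (P * B)" "j < dim_col (P * B)"
      then have ij: "i < k" "j < n" using B by (auto simp: P_def)
      have "C $$ (i, j) = row C i $ j" using ij C by simp
      also have "\<dots> = (B\<^sup>T *\<^sub>v y i) $ j" by (simp only: y(2)[OF ij(1)])
      also have "\<dots> = col B j \<bullet> y i" using ij B by simp
      also have "\<dots> = row P i \<bullet> col B j"
        unfolding rP[OF ij(1)] by (rule comm_scalar_prod) (use y(1)[OF ij(1)] B ij in auto)
      finally show "C $$ (i, j) = (P * B) $$ (i, j)" using ij B by (simp add: P_def)
    qed (use B C in \<open>auto simp: P_def\<close>)
    moreover have "P \<in> carrier_mat k k" by (simp add: P_def)
    ultimately show ?thesis by blast
  qed
  have Ac: "A \<in> carrier_mat k n" using A by (rule full_row_rank_carrier)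
  obtain P where P: "P \<in> carrier_mat k k" "A' = P * A" by (rule bexE[OF ex[OF Ac A' equalityD2[OF eq]]])
  obtain Q where Q: "Q \<in> carrier_mat k k" "A = Q * A'" by (rule bexE[OF ex[OF A' Ac equalityD1[OF eq]]])
  obtain R where R: "R \<in> carrier_mat n k" "A * R = 1\<^sub>m k" using A by (auto simp only: full_row_rank_def)
  have QP: "Q * P \<in> carrier_mat k k" using Q(1) P(1) by simp
  have QPA: "(Q * P) * A = A" by (simp only: assoc_mult_mat[OF Q(1) P(1) Ac] P(2)[symmetric] Q(2)[symmetric])
  have "(Q * P) * (A * R) = A * R" by (simp only: assoc_mult_mat[OF QP Ac R(1), symmetric] QPA)
  then have "Q * P = 1\<^sub>m k" by (simp only: R(2) right_mult_one_mat[OF QP])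
  then have "det Q * det P = 1" using det_mult[OF Q(1) P(1)] by simp
  then have "det P \<noteq> 0" by auto
  with P that show thesis by blast
qed

section \<open>Maximal minors and Pluecker coordinates\<close>

lemma ksubsetsD:
  assumes "I \<in> ksubsets k n"
  shows "finite I" "card I = k" "I \<subseteq> {..<n}" "{j. j < n \<and> j \<in> I} = I"
  using assms by (auto simp: ksubsets_def intro: finite_subset)

lemma bij_betw_pick:
  assumes "finite I"
  shows "bij_betw (pick I) {..<card I} I"
proof -
  have "inj_on (pick I) {..<card I}"
    by (rule inj_onI) (metis lessThan_iff card_pick_le)
  moreover have "pick I ` {..<card I} \<subseteq> I" using pick_in_set_le by blast
  ultimately show ?thesis
    by (metis assms bij_betw_def card_image card_lessThan card_subset_eq)
qed

lemma sum_pick: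
  assumes "I \<in> ksubsets k n"
  shows "(\<Sum>j<k. f (pick I j)) = sum f I"
  using sum.reindex_bij_betw[OF bij_betw_pick, of I f] ksubsetsD[OF assms] by simp

lemma pick_ksubset:
  assumes "I \<in> ksubsets k n" "j < k"
  shows "pick I j \<in> I" "pick I j < n"
  using pick_in_set_le[of j I] ksubsetsD[OF assms(1)] assms(2) by auto

lemma submatrix_UNIV_carrier:
  assumes "A \<in> carrier_mat k n" "I \<in> ksubsets k n"
  shows "submatrix A UNIV I \<in> carrier_mat k k"
  using assms ksubsetsD[OF assms(2)] by (auto simp: dim_submatrix)

lemma submatrix_UNIV_index:
  assumes "A \<in> carrier_mat k n" "I \<in> ksubsets k n" "i < k" "j < k"
  shows "submatrix A UNIV I $$ (i, j) = A $$ (i, pick I j)"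
  using assms ksubsetsD[OF assms(2)] by (subst submatrix_index) (auto simp: pick_UNIV)

lemma submatrix_UNIV_mult:
  fixes P :: "complex mat"
  assumes P: "P \<in> carrier_mat k k" and A: "A \<in> carrier_mat k n" and I: "I \<in> ksubsets k n"
  shows "submatrix (P * A) UNIV I = P * submatrix A UNIV I"
proof (rule eq_matI)
  note S = submatrix_UNIV_carrier[OF A I]
  have PA: "P * A \<in> carrier_mat k n" using P A by simp
  fix i j assume "i < dim_row (P * submatrix A UNIV I)" "j < dim_col (P * submatrix A UNIV I)"
  then have ij: "i < k" "j < k" using P S by auto
  have "col (submatrix A UNIV I) j = col A (pick I j)"
    using S A ij pick_ksubset[OF I] by (intro eq_vecI) (auto simp: submatrix_UNIV_index[OF A I])
  then show "submatrix (P * A) UNIV I $$ (i, j) = (P * submatrix A UNIV I) $$ (i, j)"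
    using ij P A S pick_ksubset[OF I] by (simp add: submatrix_UNIV_index[OF PA I])
qed (use P submatrix_UNIV_carrier[OF mult_carrier_mat[OF P A] I] submatrix_UNIV_carrier[OF A I] in auto)

lemma max_minors_mult:
  assumes P: "P \<in> carrier_mat k k" and A: "A \<in> carrier_mat k n"
  shows "max_minors k n (P * A) = (\<lambda>I. det P * max_minors k n A I)"
proof
  fix I
  show "max_minors k n (P * A) I = det P * max_minors k n A I"
    using submatrix_UNIV_mult[OF P A, of I] det_mult[OF P submatrix_UNIV_carrier[OF A, of I]]
    by (simp add: max_minors_def)
qed

lemma proj_pt_scale:
  fixes x :: "'i \<Rightarrow> complex"
  assumes "c \<noteq> 0"
  shows "proj_pt (\<lambda>i. c * x i) = proj_pt x"
proof -
  have sub: "proj_pt (\<lambda>i. a * y i) \<subseteq> proj_pt y" if "a \<noteq> 0" for a and y :: "'i \<Rightarrow> complex"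
  proof
    fix z assume "z \<in> proj_pt (\<lambda>i. a * y i)"
    then obtain d where d: "d \<noteq> 0" "z = (\<lambda>i. d * (a * y i))" unfolding proj_pt_def by blast
    have "z = (\<lambda>i. (d * a) * y i)" unfolding d(2) by (rule ext) (rule mult.assoc[symmetric])
    moreover have "d * a \<noteq> 0" using d(1) that by simp
    ultimately have "\<exists>c. z = (\<lambda>i. c * y i) \<and> c \<noteq> 0" by (intro exI conjI)
    then show "z \<in> proj_pt y" unfolding proj_pt_def by simp
  qed
  have inv: "(\<lambda>i. (1 / c) * (c * x i)) = x" using assms by auto
  show ?thesis
  proof
    show "proj_pt (\<lambda>i. c * x i) \<subseteq> proj_pt x" by (rule sub[OF assms])
    have "1 / c \<noteq> 0" using assms by simp
    from sub[OF this, of "\<lambda>i. c * x i"] show "proj_pt x \<subseteq> proj_pt (\<lambda>i. c * x i)" unfolding inv .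
  qed
qed

lemma max_minors_coord_space: "max_minors k n A \<in> coord_space (ksubsets k n)"
  by (simp add: coord_space_def max_minors_def)

text \<open>The columns of \<open>A\<close> span the column space \<open>\<complex>\<^sup>k\<close>, so \<open>k\<close> of them form a basis.\<close>

lemma full_row_rank_minor:
  assumes A: "full_row_rank k n A"
  shows "\<exists>J\<in>ksubsets k n. det (submatrix A UNIV J) \<noteq> 0"
proof -
  interpret vec_space "TYPE(complex)" k .
  obtain R where Ac: "A \<in> carrier_mat k n" and R: "R \<in> carrier_mat n k" "A * R = 1\<^sub>m k"
    using A by (auto simp: full_row_rank_def)
  have cA: "set (cols A) \<subseteq> carrier_vec k" using cols_dim[of A] Ac by simp
  have sp: "span (set (cols A)) = carrier_vec k"
  proof
    show "span (set (cols A)) \<subseteq> carrier_vec k" by (rule span_is_subset2[OF cA])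
    show "carrier_vec k \<subseteq> span (set (cols A))"
    proof
      fix v :: "complex vec" assume v: "v \<in> carrier_vec k"
      have "A *\<^sub>v (R *\<^sub>v v) = v"
        using assoc_mult_mat_vec[OF Ac R(1) v] R(2) v by simp
      then have "v \<in> col_space A"
        unfolding col_space_eq[OF Ac] using Ac R(1) v by (auto intro!: bexI[of _ "R *\<^sub>v v"])
      then show "v \<in> span (set (cols A))" by (simp add: col_space_def)
    qed
  qed
  obtain S where S: "finite S" "maximal S (\<lambda>T. T \<subseteq> set (cols A) \<and> lin_indpt T)"
    using maximal_exists_superset[of "set (cols A)" "\<lambda>T. T \<subseteq> set (cols A) \<and> lin_indpt T" "{}"]
    by (auto simp: lin_dep_def)
  then have SA: "S \<subseteq> set (cols A)" "lin_indpt S" by (auto simp: maximal_def)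
  have SC: "S \<subseteq> carrier_vec k" using SA(1) cA by blast
  have "set (cols A) \<subseteq> span S"
  proof
    fix v assume v: "v \<in> set (cols A)"
    show "v \<in> span S"
    proof (rule ccontr)
      assume nv: "v \<notin> span S"
      then have nS: "v \<notin> S" using in_own_span[OF SC] by blast
      then have "lin_indpt (S \<union> {v})"
        using lin_dep_iff_in_span[OF SC SA(2) _ nS] v cA nv by blast
      then have "S \<union> {v} = S" using S(2) SA(1) v unfolding maximal_def by blast
      then show False using nS by blast
    qed
  qed
  then have spS: "span S = carrier_vec k"
    using span_subsetI[OF SC, of "set (cols A)"] sp span_is_subset2[OF SC] by simp
  have "basis S" using SA(2) spS SC by (simp add: basis_def)
  then have cS: "card S = k" using dim_basis[OF S(1)] dim_is_n by simp
  have "\<exists>j. j < n \<and> col A j = s" if "s \<in> S" for s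
  proof -
    have "s \<in> set (cols A)" using SA(1) that by blast
    then obtain j where "j < length (cols A)" "s = cols A ! j" by (auto simp: in_set_conv_nth)
    then show ?thesis using Ac by auto
  qed
  then obtain f where f: "\<And>s. s \<in> S \<Longrightarrow> f s < n \<and> col A (f s) = s" by metis
  have inj: "inj_on f S" by (rule inj_onI) (metis f)
  define J where "J = f ` S"
  have J: "J \<in> ksubsets k n"
    using f card_image[OF inj] cS by (auto simp: J_def ksubsets_def)
  let ?M = "submatrix A UNIV J"
  have M: "?M \<in> carrier_mat k k" by (rule submatrix_UNIV_carrier[OF Ac J])
  have "S \<subseteq> set (cols ?M)"
  proof
    fix s assume s: "s \<in> S"
    then have "f s \<in> pick J ` {..<k}"
      using bij_betw_pick[OF ksubsetsD(1)[OF J]] ksubsetsD(2)[OF J] by (auto simp: bij_betw_def J_def)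
    then obtain j where j: "j < k" "pick J j = f s" by auto
    have "col ?M j = s"
    proof (rule eq_vecI)
      fix i assume "i < dim_vec s"
      then have i: "i < k" using s SC by (auto dest: carrier_vecD)
      have fs: "f s < n" "col A (f s) = s" using f[OF s] by simp_all
      have "col A (f s) $ i = A $$ (i, f s)" by (rule index_col) (use i Ac fs(1) in simp_all)
      then have "s $ i = A $$ (i, f s)" by (simp only: fs(2))
      then show "col ?M j $ i = s $ i"
        using i j M by (simp add: submatrix_UNIV_index[OF Ac J])
    qed (use s SC M in auto)
    then show "s \<in> set (cols ?M)" using j(1) M by (auto simp: cols_def)
  qed
  then have "span S \<subseteq> span (set (cols ?M))" by (rule span_is_monotone)
  moreover have "set (cols ?M) \<subseteq> carrier_vec k" using cols_dim[of ?M] M by simp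
  ultimately have "span (set (cols ?M)) = carrier_vec k" using spS span_is_subset2[of "set (cols ?M)"] by simp
  then have "det ?M \<noteq> 0" by (rule full_row_rank_square[OF full_row_rank_if_spanning[OF M]])
  then show ?thesis using J by blast
qed

lemma max_minors_nonzero:
  assumes "full_row_rank k n A"
  shows "max_minors k n A \<in> coord_space (ksubsets k n) - {\<lambda>_. 0}"
proof -
  obtain J where "J \<in> ksubsets k n" "det (submatrix A UNIV J) \<noteq> 0"
    using full_row_rank_minor[OF assms] by blast
  then have "max_minors k n A J \<noteq> 0" by (simp add: max_minors_def)
  then show ?thesis using max_minors_coord_space[of k n A] by auto
qed

text \<open>The union in the definition of the Pluecker point has only one member: a change of basis multiplies all maximal minors
by the same determinant.\<close>

lemma plucker_row_space:
  assumes A: "full_row_rank k n A"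
  shows "plucker k n (row_sp n A) = proj_pt (max_minors k n A)"
proof -
  have Ac: "A \<in> carrier_mat k n" by (rule full_row_rank_carrier[OF A])
  have all_eq: "proj_pt (max_minors k n A') = proj_pt (max_minors k n A)"
    if A': "A' \<in> carrier_mat k n" and eq: "row_sp n A' = row_sp n A" for A'
  proof -
    obtain P where P: "P \<in> carrier_mat k k" "det P \<noteq> 0" "A' = P * A"
      by (rule row_space_eq_change_of_basis[OF A A' eq[symmetric]])
    show ?thesis unfolding P(3) max_minors_mult[OF P(1) Ac] by (rule proj_pt_scale[OF P(2)])
  qed
  show ?thesis
  proof
    show "plucker k n (row_sp n A) \<subseteq> proj_pt (max_minors k n A)"
      unfolding plucker_def by (rule UN_least) (simp add: all_eq)
    show "proj_pt (max_minors k n A) \<subseteq> plucker k n (row_sp n A)"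
      unfolding plucker_def by (rule UN_upper) (simp add: Ac)
  qed
qed

lemma plucker_in_proj_space:
  assumes "V \<in> Gr k n"
  shows "plucker k n V \<in> proj_space (ksubsets k n)"
proof -
  obtain A where A: "full_row_rank k n A" "row_sp n A = V" by (rule Gr_obtain_matrix[OF assms])
  have "plucker k n V = proj_pt (max_minors k n A)" using plucker_row_space[OF A(1)] by (simp only: A(2))
  then show ?thesis unfolding proj_space_def using max_minors_nonzero[OF A(1)] by (rule image_eqI)
qed

lemma minor_zero_row:
  fixes A :: "complex mat"
  assumes A: "A \<in> carrier_mat k n" and I: "I \<in> ksubsets k n"
    and i: "i < k" and z: "\<And>c. c \<in> I \<Longrightarrow> A $$ (i, c) = 0"
  shows "det (submatrix A UNIV I) = 0"
proof -
  let ?M = "submatrix A UNIV I"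
  have M: "?M \<in> carrier_mat k k" by (rule submatrix_UNIV_carrier[OF A I])
  have "det ?M = (\<Sum>p | p permutes {0..<k}. signof p * (\<Prod>i = 0..<k. ?M $$ (i, p i)))"
    by (rule det_def'[OF M])
  also have "\<dots> = 0"
  proof (rule sum.neutral, clarify)
    fix p assume p: "p permutes {0..<k}"
    then have "p i < k" using i permutes_in_image[OF p, of i] by simp
    then have "?M $$ (i, p i) = 0"
      using z pick_ksubset[OF I] i by (simp add: submatrix_UNIV_index[OF A I])
    then have "(\<Prod>i = 0..<k. ?M $$ (i, p i)) = 0" using i by (intro prod_zero) auto
    then show "signof p * (\<Prod>i = 0..<k. ?M $$ (i, p i)) = 0" by simp
  qed
  finally show ?thesis .
qed

text \<open>The selected square matrix \<open>M\<close> is a signed permutation matrix. The identity \<open>M M\<^sup>T = 1\<close> gives a nonzero determinant without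
computing the sign of the permutation.\<close>

lemma minor_signed_permutation:
  fixes A :: "complex mat"
  assumes A: "A \<in> carrier_mat k n" and I: "I \<in> ksubsets k n"
    and inj: "inj_on \<tau> {..<k}" and im: "\<tau> ` {..<k} \<subseteq> I"
    and s: "\<And>i. i < k \<Longrightarrow> s i * s i = 1"
    and A_entry: "\<And>i c. i < k \<Longrightarrow> c \<in> I \<Longrightarrow> A $$ (i, c) = (if c = \<tau> i then s i else 0)"
  shows "det (submatrix A UNIV I) \<noteq> 0"
proof -
  let ?M = "submatrix A UNIV I"
  have M: "?M \<in> carrier_mat k k" by (rule submatrix_UNIV_carrier[OF A I])
  have "?M * ?M\<^sup>T = 1\<^sub>m k"
  proof (rule eq_matI)
    fix i j assume "i < dim_row (1\<^sub>m k :: complex mat)" "j < dim_col (1\<^sub>m k :: complex mat)"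
    then have ij: "i < k" "j < k" by auto
    have "(?M * ?M\<^sup>T) $$ (i, j) = (\<Sum>p<k. ?M $$ (i, p) * ?M $$ (j, p))"
      using M ij by (simp add: scalar_prod_def atLeast0LessThan)
    also have "\<dots> = (\<Sum>p<k. A $$ (i, pick I p) * A $$ (j, pick I p))"
      using ij by (intro sum.cong) (auto simp: submatrix_UNIV_index[OF A I])
    also have "\<dots> = (\<Sum>c\<in>I. A $$ (i, c) * A $$ (j, c))"
      by (rule sum_pick[OF I, where f = "\<lambda>c. A $$ (i, c) * A $$ (j, c)"])
    also have "\<dots> = (\<Sum>c\<in>I. if c = \<tau> i then (if \<tau> i = \<tau> j then s i * s j else 0) else 0)"
      using ij by (intro sum.cong) (auto simp: A_entry)
    also have "\<dots> = (if i = j then 1 else 0)"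
      using im ij inj ksubsetsD(1)[OF I] s by (auto simp: inj_on_def)
    finally show "(?M * ?M\<^sup>T) $$ (i, j) = 1\<^sub>m k $$ (i, j)" using ij by simp
  qed (use M in auto)
  then have "full_row_rank k k ?M" using M by (auto simp: full_row_rank_def)
  then show ?thesis by (rule full_row_rank_square)
qed

section \<open>Frames adapted to a pair of subspaces\<close>

lemma subspace_Int_orthogonal_complement:
  assumes V: "V \<in> Gr k n" and W: "W \<subseteq> carrier_vec n"
  shows "subspace class_ring (V \<inter> perp n W) (Cn n)"
proof -
  interpret vec_space "TYPE(complex)" n .
  have sub: "submodule class_ring V (Cn n)" using V by (simp add: Gr_def subspace_def)
  have VC: "V \<subseteq> carrier_vec n" and Vadd: "\<And>v w. v \<in> V \<Longrightarrow> w \<in> V \<Longrightarrow> v + w \<in> V"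
    and V0: "0\<^sub>v n \<in> V" and Vsm: "\<And>c v. v \<in> V \<Longrightarrow> c \<cdot>\<^sub>v v \<in> V"
    using sub by (simp_all add: submodule_def)
  have "submodule class_ring (V \<inter> orthogonal_complement W) (Cn n)"
  proof (rule submodule.intro)
    show "module class_ring (Cn n)" using sub by (simp add: submodule_def)
    show "V \<inter> orthogonal_complement W \<subseteq> carrier (Cn n)" using VC by auto
    show "zero (Cn n) \<in> V \<inter> orthogonal_complement W"
      using V0 W by (auto simp: orthogonal_complement_def)
  next
    fix a b assume ab: "a \<in> V \<inter> orthogonal_complement W" "b \<in> V \<inter> orthogonal_complement W"
    have "(a + b) \<bullet> y = 0" if "y \<in> W" for y
      using ab that W by (auto simp: orthogonal_complement_def add_scalar_prod_distrib[of _ n])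
    then show "a \<oplus>\<^bsub>Cn n\<^esub> b \<in> V \<inter> orthogonal_complement W"
      using ab Vadd VC by (auto simp: orthogonal_complement_def)
  next
    fix c :: complex and a assume "c \<in> carrier class_ring" and a: "a \<in> V \<inter> orthogonal_complement W"
    then have aC: "a \<in> carrier_vec n" using VC by blast
    have "(c \<cdot>\<^sub>v a) \<bullet> y = 0" if y: "y \<in> W" for y
    proof -
      have "(c \<cdot>\<^sub>v a) \<bullet> y = c * (a \<bullet> y)"
        by (rule smult_scalar_prod_distrib[OF aC]) (use y W in blast)
      then show ?thesis using a y by (auto simp: orthogonal_complement_def)
    qed
    then show "c \<odot>\<^bsub>Cn n\<^esub> a \<in> V \<inter> orthogonal_complement W"
      using a aC Vsm[of a c] by (auto simp: orthogonal_complement_def)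
  qed
  then show ?thesis using vec_vs by (auto simp: subspace_def)
qed

lemma mem_orthogonal_complement_row_space:
  fixes L :: "complex mat"
  assumes L: "L \<in> carrier_mat k n" and x: "x \<in> carrier_vec n"
  shows "x \<in> perp n (row_sp n L) \<longleftrightarrow>
    (\<forall>j<k. x \<bullet> row L j = 0)"
proof -
  interpret vec_space "TYPE(complex)" n .
  have "set (rows L) \<subseteq> carrier_vec n" using L by (metis rows_carrier carrier_matD(2))
  then have "orthogonal_complement (row_space L) = orthogonal_complement (set (rows L))"
    unfolding row_space_def by (rule in_orthogonal_complement_span)
  also have "x \<in> \<dots> \<longleftrightarrow> (\<forall>j<k. x \<bullet> row L j = 0)"
  proof -
    have "set (rows L) = row L ` {..<k}" using L by (auto simp: rows_def)
    then show ?thesis using x by (auto simp: orthogonal_complement_def)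
  qed
  finally show ?thesis .
qed

lemma row_space_carrier:
  assumes "L \<in> carrier_mat k n"
  shows "row_sp n L \<subseteq> carrier_vec n"
  using row_space_iff[OF assms] assms by auto

text \<open>The rows of \<open>P = C A\<close> are \<open>m\<close> linearly independent vectors in the intersection of the row space of \<open>A\<close> with the orthogonal
complement of the row space of \<open>L\<close>.\<close>

lemma SH_memI:
  assumes A: "full_row_rank k n A" and L: "full_row_rank k n L"
    and P: "full_row_rank m n P" and C: "C \<in> carrier_mat m k" "P = C * A"
    and orth: "P * L\<^sup>T = 0\<^sub>m m k" and m: "k - r \<le> m"
  shows "(row_sp n A, row_sp n L) \<in> SH k n r"
proof -
  interpret vec_space "TYPE(complex)" n .
  let ?V = "row_space A" and ?W = "row_space L"
  let ?Q = "?V \<inter> orthogonal_complement ?W"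
  note Ac = full_row_rank_carrier[OF A] and Lc = full_row_rank_carrier[OF L]
    and Pc = full_row_rank_carrier[OF P]
  have V: "?V \<in> Gr k n" and W: "?W \<in> Gr k n" using full_row_rank_Gr A L by auto
  have sub: "subspace class_ring ?Q (Cn n)"
    by (rule subspace_Int_orthogonal_complement[OF V row_space_carrier[OF Lc]])
  have PQ: "row P i \<in> ?Q" if i: "i < m" for i
  proof
    have "row P i = A\<^sup>T *\<^sub>v row C i"
    proof (rule eq_vecI)
      fix j assume "j < dim_vec (A\<^sup>T *\<^sub>v row C i)"
      then have j: "j < n" using Ac by simp
      have "row P i $ j = row C i \<bullet> col A j" unfolding C(2) using i j C(1) Ac by simp
      also have "\<dots> = col A j \<bullet> row C i"
        by (rule comm_scalar_prod[of _ k]) (use i j C(1) Ac in auto)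
      finally show "row P i $ j = (A\<^sup>T *\<^sub>v row C i) $ j" using j Ac by simp
    qed (use Ac Pc in auto)
    then show "row P i \<in> ?V" unfolding row_space_iff[OF Ac] using C(1) i by auto
    have rP: "row P i \<in> carrier_vec n" using Pc i by auto
    have "row P i \<bullet> row L j = 0" if j: "j < k" for j
    proof -
      have "(P * L\<^sup>T) $$ (i, j) = row P i \<bullet> row L j" using i j Pc Lc by simp
      then show ?thesis using i j by (simp add: orth)
    qed
    then show "row P i \<in> orthogonal_complement ?W"
      using mem_orthogonal_complement_row_space[OF Lc rP] by simp
  qed
  have "set (rows P) \<subseteq> ?Q" using PQ Pc by (auto simp: rows_def)
  then obtain B where B: "finite B" "set (rows P) \<subseteq> B"
    "card B = sdim n ?Q"
    using basis_of_subspace_extending[OF sub full_row_rank_rows(2)[OF P]] by metis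
  have "m = card (set (rows P))" using distinct_card[OF full_row_rank_rows(1)[OF P]] Pc by simp
  also have "\<dots> \<le> card B" by (rule card_mono[OF B(1,2)])
  finally have "k - r \<le> sdim n ?Q" using m B(3) by simp
  then show ?thesis using V W by (simp add: SH_def)
qed

definition top_rows :: "nat \<Rightarrow> nat \<Rightarrow> complex mat \<Rightarrow> complex mat" where
  "top_rows k n G = mat k n (\<lambda>(i, j). G $$ (i, j))"

lemma top_rows_carrier [simp]: "top_rows k n G \<in> carrier_mat k n"
  by (simp add: top_rows_def)

text \<open>Start with \<open>k - r\<close> independent vectors in the intersection of \<open>V\<close> with the orthogonal complement of \<open>W\<close>, extend them to a basis of
\<open>V\<close> and then to a basis of \<open>\<complex>\<^sup>n\<close>, the rows of \<open>G\<close>. If \<open>L\<close> has row space \<open>W\<close>, then \<open>L = N (adj G)\<^sup>T\<close> for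
\<open>N = (1 / det G) L G\<^sup>T\<close>, whose first columns are scalar products of rows of \<open>L\<close> with the first rows of \<open>G\<close>. The adjugate
appears instead of the inverse because its entries are polynomials.\<close>

lemma SH_obtain_frame:
  assumes VW: "(V, W) \<in> SH k n r"
  obtains G N where "G \<in> carrier_mat n n" "det G \<noteq> 0" "k \<le> n" "N \<in> carrier_mat k n"
    "\<forall>i<k. \<forall>j<k - r. N $$ (i, j) = 0"
    "full_row_rank k n (top_rows k n G)" "V = row_sp n (top_rows k n G)"
    "full_row_rank k n (N * (adj_mat G)\<^sup>T)" "W = row_sp n (N * (adj_mat G)\<^sup>T)"
proof -
  interpret vec_space "TYPE(complex)" n .
  let ?Q = "V \<inter> orthogonal_complement W"
  let ?m = "k - r"
  have V: "V \<in> Gr k n" and W: "W \<in> Gr k n"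
    and dim: "?m \<le> sdim n ?Q"
    using VW by (auto simp: SH_def)
  obtain L where L: "full_row_rank k n L" "row_space L = W" by (rule Gr_obtain_matrix[OF W])
  note Lc = full_row_rank_carrier[OF L(1)]
  have sub: "subspace class_ring ?Q (Cn n)"
    by (rule subspace_Int_orthogonal_complement[OF V]) (use row_space_carrier[OF Lc] L(2) in simp)
  have li0: "lin_indpt {}" by (simp add: lin_dep_def)
  obtain B where B: "finite B" "B \<subseteq> ?Q" "lin_indpt B"
    "card B = sdim n ?Q"
    using basis_of_subspace_extending[OF sub li0 empty_subsetI] by metis
  obtain S where S: "S \<subseteq> B" "card S = ?m" "finite S"
    using obtain_subset_with_card_n[of ?m B] dim B(4) by metis
  have liS: "lin_indpt S" by (rule subset_li_is_li[OF B(3) S(1)])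
  have SV: "S \<subseteq> V" using S(1) B(2) by blast
  obtain vs where vs: "distinct vs" "length vs = k" "set (take ?m vs) = S" "set vs \<subseteq> carrier_vec n"
    "lin_indpt (set vs)" "row_space (mat_of_rows n vs) = V"
    using Gr_basis_extending[OF V S(3) SV liS] S(2) by metis
  obtain G where G: "G \<in> carrier_mat n n" "det G \<noteq> 0" "k \<le> n" "\<And>i. i < k \<Longrightarrow> row G i = vs ! i"
    using mat_of_independent_rows_extends[OF vs(1,4,5)] vs(2) by metis
  have "top_rows k n G = mat_of_rows n vs"
  proof (rule eq_matI)
    fix i j assume "i < dim_row (mat_of_rows n vs)" "j < dim_col (mat_of_rows n vs)"
    then have ij: "i < k" "j < n" using vs(2) by auto
    have "G $$ (i, j) = row G i $ j" using ij G(1,3) by simp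
    then show "top_rows k n G $$ (i, j) = mat_of_rows n vs $$ (i, j)"
      using ij vs(2) G(4)[OF ij(1)] by (simp add: mat_of_rows_index top_rows_def)
  qed (use vs(2) in \<open>auto simp: top_rows_def\<close>)
  then have topV: "V = row_space (top_rows k n G)" using vs(6) by simp
  have topfr: "full_row_rank k n (top_rows k n G)"
    unfolding top_rows_def by (rule full_row_rank_top[OF G(1,2,3)])
  define N where "N = (1 / det G) \<cdot>\<^sub>m (L * G\<^sup>T)"
  have N: "N \<in> carrier_mat k n" using Lc G(1) by (auto simp: N_def)
  have Nz: "N $$ (i, j) = 0" if ij: "i < k" "j < ?m" for i j
  proof -
    have jn: "j < n" "j < k" using ij G(3) by auto
    have "vs ! j \<in> S" using vs(2,3) ij by (metis in_set_conv_nth jn(2) length_take min_less_iff_conj nth_take)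
    then have "row G j \<in> orthogonal_complement W" using G(4)[OF jn(2)] S(1) B(2) by auto
    then have "row G j \<bullet> row L i = 0"
      using mem_orthogonal_complement_row_space[OF Lc, of "row G j"] L(2) ij(1) G(1) jn by auto
    moreover have "row G j \<bullet> row L i = row L i \<bullet> row G j"
      by (rule comm_scalar_prod[of _ n]) (use G(1) Lc jn ij in auto)
    ultimately show ?thesis using ij jn Lc G(1) by (simp add: N_def)
  qed
  have adj: "adj_mat G \<in> carrier_mat n n" by (rule adj_mat(1)[OF G(1)])
  have "N * (adj_mat G)\<^sup>T = (1 / det G) \<cdot>\<^sub>m ((L * G\<^sup>T) * (adj_mat G)\<^sup>T)"
    unfolding N_def by (rule mult_smult_assoc_mat[of _ k n _ n]) (use Lc G(1) adj in auto)
  also have "(L * G\<^sup>T) * (adj_mat G)\<^sup>T = L * (G\<^sup>T * (adj_mat G)\<^sup>T)"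
    by (rule assoc_mult_mat[of _ k n _ n _ n]) (use Lc G(1) adj in auto)
  also have "G\<^sup>T * (adj_mat G)\<^sup>T = (adj_mat G * G)\<^sup>T"
    by (rule transpose_mult[symmetric, OF adj G(1)])
  also have "\<dots> = det G \<cdot>\<^sub>m 1\<^sub>m n" unfolding adj_mat(3)[OF G(1)] by (intro eq_matI) auto
  also have "L * (det G \<cdot>\<^sub>m 1\<^sub>m n) = det G \<cdot>\<^sub>m L"
    using mult_smult_distrib[OF Lc one_carrier_mat[of n], of "det G"] Lc by simp
  also have "(1 / det G) \<cdot>\<^sub>m (det G \<cdot>\<^sub>m L) = L" using G(2) by (intro eq_matI) auto
  finally have NL: "N * (adj_mat G)\<^sup>T = L" .
  show thesis
    by (rule that[OF G(1,2,3) N _ topfr topV]) (simp_all add: NL L Nz)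
qed

section \<open>A polynomial parametrisation of the spinor-helicity variety\<close>

lemma full_row_rank_identity_columns:
  assumes A: "A \<in> carrier_mat k n" and on: "off + k \<le> n"
    and id: "\<And>i j. i < k \<Longrightarrow> j < k \<Longrightarrow> A $$ (i, off + j) = (if i = j then 1 else 0)"
  shows "full_row_rank k n A"
proof -
  define R :: "complex mat" where "R = mat n k (\<lambda>(c, j). if c = off + j then 1 else 0)"
  have R: "R \<in> carrier_mat n k" by (simp add: R_def)
  have "A * R = 1\<^sub>m k"
  proof (rule eq_matI)
    fix i j assume "i < dim_row (1\<^sub>m k :: complex mat)" "j < dim_col (1\<^sub>m k :: complex mat)"
    then have ij: "i < k" "j < k" by auto
    have "(A * R) $$ (i, j) = (\<Sum>c = 0..<n. A $$ (i, c) * R $$ (c, j))"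
      using ij A R by (simp add: scalar_prod_def)
    also have "\<dots> = (\<Sum>c = 0..<n. if c = off + j then A $$ (i, c) else 0)"
      using ij by (intro sum.cong) (auto simp: R_def)
    also have "\<dots> = A $$ (i, off + j)" using ij on by simp
    finally show "(A * R) $$ (i, j) = 1\<^sub>m k $$ (i, j)" using ij id by simp
  qed (use A R in auto)
  then show ?thesis using A R by (auto simp: full_row_rank_def)
qed

lemma mult_transpose_index:
  fixes P L :: "complex mat"
  assumes "P \<in> carrier_mat m n" "L \<in> carrier_mat k n" "a < m" "j < k"
  shows "(P * L\<^sup>T) $$ (a, j) = (\<Sum>c = 0..<n. P $$ (a, c) * L $$ (j, c))"
  using assms by (simp add: scalar_prod_def)

text \<open>Reduction to echelon form: a nonzero minor on consecutive columns can be made the identity by row operations.\<close>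

lemma normalise_columns:
  fixes A :: "complex mat"
  assumes A: "A \<in> carrier_mat k n" and on: "off + k \<le> n"
    and d: "det (mat k k (\<lambda>(i, j). A $$ (i, off + j))) \<noteq> 0"
  obtains B Q where "B \<in> carrier_mat k n" "A = mat k k (\<lambda>(i, j). A $$ (i, off + j)) * B"
    "\<forall>i<k. \<forall>j<k. B $$ (i, off + j) = (if i = j then 1 else 0)"
    "Q \<in> carrier_mat k k" "B = Q * A"
proof -
  let ?M = "mat k k (\<lambda>(i, j). A $$ (i, off + j))"
  have M: "?M \<in> carrier_mat k k" by simp
  obtain Q where Q: "Q \<in> carrier_mat k k" "?M * Q = 1\<^sub>m k" "Q * ?M = 1\<^sub>m k"
    by (rule det_nonzero_inverse[OF M d])
  have QA: "Q * A \<in> carrier_mat k n" using Q(1) A by simp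
  show thesis
  proof (rule that[OF QA])
    have "?M * (Q * A) = (?M * Q) * A" by (rule assoc_mult_mat[OF M Q(1) A, symmetric])
    then show "A = ?M * (Q * A)" using A by (simp add: Q(2))
    show "Q \<in> carrier_mat k k" "Q * A = Q * A" using Q(1) by simp_all
    show "\<forall>i<k. \<forall>j<k. (Q * A) $$ (i, off + j) = (if i = j then 1 else 0)"
    proof (intro allI impI)
      fix i j assume ij: "i < k" "j < k"
      have "(Q * A) $$ (i, off + j) = (Q * ?M) $$ (i, j)"
        using ij on A Q(1) by (simp add: scalar_prod_def)
      then show "(Q * A) $$ (i, off + j) = (if i = j then 1 else 0)" using ij by (simp add: Q(3))
    qed
  qed
qed

context
  fixes k n m :: nat
begin

text \<open>\<open>[1 | X]\<close>, the normalised basis of \<open>V\<close>. Throughout, the first component of a parameter index tells the matrix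
that the parameter is an entry of: \<open>0\<close> for \<open>X\<close>, \<open>1\<close> for \<open>C\<close> and \<open>2\<close> for \<open>Z\<close>. The other two components are row and column
in the surrounding matrix.\<close>

definition lambda_mat :: "(nat \<times> nat \<times> nat \<Rightarrow> complex) \<Rightarrow> complex mat" where
  "lambda_mat t = mat k n (\<lambda>(i, c). if c < k then (if i = c then 1 else 0) else t (0, i, c))"

text \<open>\<open>[1 | C]\<close>, the coordinates with respect to the basis of \<open>V\<close> of the \<open>m\<close>-dimensional subspace orthogonal to \<open>W\<close>.\<close>

definition common_mat :: "(nat \<times> nat \<times> nat \<Rightarrow> complex) \<Rightarrow> complex mat" where
  "common_mat t = mat m k (\<lambda>(a, b). if b < m then (if a = b then 1 else 0) else t (1, a, b))"

text \<open>The blocks \<open>[Z | 1]\<close> of the normalised basis of \<open>W\<close>; meaningful for columns \<open>c \<ge> m\<close>.\<close>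

definition mu_free :: "(nat \<times> nat \<times> nat \<Rightarrow> complex) \<Rightarrow> nat \<Rightarrow> nat \<Rightarrow> complex" where
  "mu_free t j c = (if c < n - k then t (2, j, c) else if c = n - k + j then 1 else 0)"

text \<open>\<open>[Y | Z | 1]\<close>, the normalised basis of \<open>W\<close>. The entries of \<open>Y\<close> are the solution of the linear equations expressing
orthogonality to the rows of \<open>[1 | C] [1 | X]\<close>, which start with an identity block.\<close>

definition mu_mat :: "(nat \<times> nat \<times> nat \<Rightarrow> complex) \<Rightarrow> complex mat" where
  "mu_mat t = mat k n (\<lambda>(j, c). if c < m then - (\<Sum>c'=m..<n. (common_mat t * lambda_mat t) $$ (c, c') * mu_free t j c')
     else mu_free t j c)"

lemma lambda_mat_carrier [simp]: "lambda_mat t \<in> carrier_mat k n" by (simp add: lambda_mat_def)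
lemma common_mat_carrier [simp]: "common_mat t \<in> carrier_mat m k" by (simp add: common_mat_def)
lemma mu_mat_carrier [simp]: "mu_mat t \<in> carrier_mat k n" by (simp add: mu_mat_def)

context
  assumes kn: "k \<le> n" and mk: "m \<le> k" and mn: "m \<le> n - k"
begin

lemma common_lambda_entry_low:
  assumes "a < m" "c < k"
  shows "(common_mat t * lambda_mat t) $$ (a, c) = common_mat t $$ (a, c)"
proof -
  have "(common_mat t * lambda_mat t) $$ (a, c) = (\<Sum>b = 0..<k. common_mat t $$ (a, b) * lambda_mat t $$ (b, c))"
    using assms kn by (simp add: scalar_prod_def lambda_mat_def common_mat_def)
  also have "\<dots> = (\<Sum>b = 0..<k. if b = c then common_mat t $$ (a, b) else 0)"
    using assms kn by (intro sum.cong) (auto simp: lambda_mat_def)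
  also have "\<dots> = common_mat t $$ (a, c)" using assms by simp
  finally show ?thesis .
qed

lemma common_lambda_identity:
  assumes "a < m" "c < m"
  shows "(common_mat t * lambda_mat t) $$ (a, c) = (if a = c then 1 else 0)"
  using common_lambda_entry_low[of a c t] assms mk by (simp add: common_mat_def)

lemma common_lambda_orthogonal_mu: "(common_mat t * lambda_mat t) * (mu_mat t)\<^sup>T = 0\<^sub>m m k"
proof (rule eq_matI)
  let ?P = "common_mat t * lambda_mat t"
  have P: "?P \<in> carrier_mat m n" by (rule mult_carrier_mat[OF common_mat_carrier lambda_mat_carrier])
  have muT: "(mu_mat t)\<^sup>T \<in> carrier_mat n k" by simp
  fix a j assume "a < dim_row (0\<^sub>m m k :: complex mat)" "j < dim_col (0\<^sub>m m k :: complex mat)"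
  then have aj: "a < m" "j < k" by auto
  have mn': "m \<le> n" using mk kn by simp
  have "(?P * (mu_mat t)\<^sup>T) $$ (a, j) = (\<Sum>c = 0..<n. ?P $$ (a, c) * mu_mat t $$ (j, c))"
    by (rule mult_transpose_index[OF P mu_mat_carrier aj])
  also have "\<dots> = (\<Sum>c = 0..<m. ?P $$ (a, c) * mu_mat t $$ (j, c)) + (\<Sum>c = m..<n. ?P $$ (a, c) * mu_mat t $$ (j, c))"
    using sum.atLeastLessThan_concat[of 0 m n "\<lambda>c. ?P $$ (a, c) * mu_mat t $$ (j, c)"] mn' by simp
  also have "(\<Sum>c = 0..<m. ?P $$ (a, c) * mu_mat t $$ (j, c)) = (\<Sum>c = 0..<m. if c = a then mu_mat t $$ (j, c) else 0)"
    using aj by (intro sum.cong) (auto simp: common_lambda_identity)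
  also have "\<dots> = mu_mat t $$ (j, a)" using aj by simp
  also have "\<dots> = - (\<Sum>c = m..<n. ?P $$ (a, c) * mu_free t j c)"
    using aj mk kn by (simp add: mu_mat_def)
  also have "(\<Sum>c = m..<n. ?P $$ (a, c) * mu_mat t $$ (j, c)) = (\<Sum>c = m..<n. ?P $$ (a, c) * mu_free t j c)"
    using aj by (intro sum.cong) (auto simp: mu_mat_def)
  finally show "(?P * (mu_mat t)\<^sup>T) $$ (a, j) = 0\<^sub>m m k $$ (a, j)" using aj by simp
qed (simp_all add: common_mat_def mu_mat_def)

lemma full_row_rank_lambda_mat: "full_row_rank k n (lambda_mat t)"
  by (rule full_row_rank_identity_columns[of _ k n 0]) (use kn in \<open>auto simp: lambda_mat_def\<close>)

lemma full_row_rank_mu_mat: "full_row_rank k n (mu_mat t)"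
  by (rule full_row_rank_identity_columns[of _ k n "n - k"])
    (use kn mn in \<open>auto simp: mu_mat_def mu_free_def\<close>)

lemma full_row_rank_common_lambda: "full_row_rank m n (common_mat t * lambda_mat t)"
  by (rule full_row_rank_identity_columns[of _ m n 0])
    (use kn mk in \<open>simp_all add: common_lambda_identity mult_carrier_mat[OF common_mat_carrier lambda_mat_carrier] del: index_mult_mat(1)\<close>)

lemma param_in_SH:
  assumes "k - r \<le> m"
  shows "(row_sp n (lambda_mat t), row_sp n (mu_mat t)) \<in> SH k n r"
  by (rule SH_memI[OF full_row_rank_lambda_mat full_row_rank_mu_mat full_row_rank_common_lambda common_mat_carrier refl
      common_lambda_orthogonal_mu assms])

text \<open>The image of the parametrisation contains every pair for which the three minors used for normalisation are nonzero:
those of \<open>A\<close> on the first \<open>k\<close> columns, of the common subspace on the first \<open>m\<close> columns, and of \<open>L\<close> on the last \<open>k\<close>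
columns. After normalising, the parameters are read off from the entries.\<close>

lemma chart_covers:
  fixes A L T E :: "complex mat"
  assumes A: "A \<in> carrier_mat k n" and L: "L \<in> carrier_mat k n" and E: "E \<in> carrier_mat m k"
    and T: "T = E * A" and TL: "T * L\<^sup>T = 0\<^sub>m m k"
    and dA: "det (mat k k (\<lambda>(i, j). A $$ (i, 0 + j))) \<noteq> 0"
    and dT: "det (mat m m (\<lambda>(i, j). T $$ (i, 0 + j))) \<noteq> 0"
    and dL: "det (mat k k (\<lambda>(i, j). L $$ (i, (n - k) + j))) \<noteq> 0"
  obtains t where "A = mat k k (\<lambda>(i, j). A $$ (i, 0 + j)) * lambda_mat t"
    "L = mat k k (\<lambda>(i, j). L $$ (i, (n - k) + j)) * mu_mat t"
proof -
  let ?MA = "mat k k (\<lambda>(i, j). A $$ (i, 0 + j))"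
  have Tc: "T \<in> carrier_mat m n" unfolding T by (rule mult_carrier_mat[OF E A])
  have on: "0 + k \<le> n" "0 + m \<le> n" "(n - k) + k \<le> n" using kn mk by auto
  obtain A0 Q0 where A0: "A0 \<in> carrier_mat k n" "A = ?MA * A0"
    "\<forall>i<k. \<forall>j<k. A0 $$ (i, 0 + j) = (if i = j then 1 else 0)"
    "Q0 \<in> carrier_mat k k" "A0 = Q0 * A"
    by (rule normalise_columns[OF A on(1) dA])
  obtain P0 Q1 where P0: "P0 \<in> carrier_mat m n" "T = mat m m (\<lambda>(i, j). T $$ (i, 0 + j)) * P0"
    "\<forall>i<m. \<forall>j<m. P0 $$ (i, 0 + j) = (if i = j then 1 else 0)"
    "Q1 \<in> carrier_mat m m" "P0 = Q1 * T"
    by (rule normalise_columns[OF Tc on(2) dT])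
  obtain L0 Q2 where L0: "L0 \<in> carrier_mat k n" "L = mat k k (\<lambda>(i, j). L $$ (i, (n - k) + j)) * L0"
    "\<forall>i<k. \<forall>j<k. L0 $$ (i, (n - k) + j) = (if i = j then 1 else 0)"
    "Q2 \<in> carrier_mat k k" "L0 = Q2 * L"
    by (rule normalise_columns[OF L on(3) dL])
  note Q1 = P0(4,5) and Q2 = L0(4,5)
  define t where "t = (\<lambda>(s :: nat, i, j). if s = 0 then A0 $$ (i, j) else if s = 1 then P0 $$ (i, j) else L0 $$ (i, j))"
  have lam: "lambda_mat t = A0"
    by (rule eq_matI) (use A0(1) A0(3) in \<open>auto simp: lambda_mat_def t_def\<close>)
  have P0lam: "P0 = (Q1 * (E * ?MA)) * A0"
  proof -
    have MA: "?MA \<in> carrier_mat k k" by simp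
    have "P0 = Q1 * (E * (?MA * A0))" using Q1(2) T A0(2) by simp
    also have "E * (?MA * A0) = (E * ?MA) * A0" by (rule assoc_mult_mat[OF E MA A0(1), symmetric])
    also have "Q1 * ((E * ?MA) * A0) = (Q1 * (E * ?MA)) * A0"
      by (rule assoc_mult_mat[OF Q1(1) mult_carrier_mat[OF E MA] A0(1), symmetric])
    finally show ?thesis .
  qed
  define K where "K = Q1 * (E * ?MA)"
  have K: "K \<in> carrier_mat m k"
    unfolding K_def by (rule mult_carrier_mat[OF Q1(1)], rule mult_carrier_mat[OF E]) simp
  have P0K: "P0 = K * A0" using P0lam by (simp only: K_def)
  have K_entry: "K $$ (a, c) = P0 $$ (a, c)" if ac: "a < m" "c < k" for a c
  proof -
    have "P0 $$ (a, c) = (\<Sum>b = 0..<k. K $$ (a, b) * A0 $$ (b, c))"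
      unfolding P0K using ac K A0(1) kn by (simp add: scalar_prod_def)
    also have "\<dots> = (\<Sum>b = 0..<k. if b = c then K $$ (a, b) else 0)"
      using ac A0(3) by (intro sum.cong) auto
    also have "\<dots> = K $$ (a, c)" using ac by simp
    finally show ?thesis by simp
  qed
  \<comment> \<open>the first \<open>k\<close> columns of \<open>A0\<close> are the identity, so the coordinates of \<open>P0\<close> with respect to \<open>A0\<close> are its own first columns\<close>
  have com: "common_mat t = K"
  proof (rule eq_matI)
    fix a c assume "a < dim_row K" "c < dim_col K"
    then have ac: "a < m" "c < k" using K by auto
    show "common_mat t $$ (a, c) = K $$ (a, c)"
      using ac K_entry[OF ac] P0(3)[rule_format, of a c] by (auto simp: common_mat_def t_def)
  qed (use K in \<open>simp_all add: common_mat_def\<close>)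
  have P: "common_mat t * lambda_mat t = P0" by (simp only: com lam P0K)
  have PL: "P0 * L0\<^sup>T = 0\<^sub>m m k"
  proof -
    have LT: "L\<^sup>T \<in> carrier_mat n k" "Q2\<^sup>T \<in> carrier_mat k k" using L Q2(1) by auto
    have "P0 * L0\<^sup>T = (Q1 * T) * (L\<^sup>T * Q2\<^sup>T)"
      using Q1(2) Q2(2) transpose_mult[OF Q2(1) L] by simp
    also have "\<dots> = Q1 * (T * (L\<^sup>T * Q2\<^sup>T))"
      by (rule assoc_mult_mat[OF Q1(1) Tc mult_carrier_mat[OF LT]])
    also have "T * (L\<^sup>T * Q2\<^sup>T) = (T * L\<^sup>T) * Q2\<^sup>T" by (rule assoc_mult_mat[OF Tc LT, symmetric])
    also have "\<dots> = 0\<^sub>m m k" unfolding TL using LT by simp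
    also have "Q1 * 0\<^sub>m m k = 0\<^sub>m m k" using Q1(1) by simp
    finally show ?thesis .
  qed
  have mu_free: "mu_free t j c = L0 $$ (j, c)" if jc: "j < k" "c < n" for j c
  proof (cases "c < n - k")
    case True
    then show ?thesis by (simp add: mu_free_def t_def)
  next
    case False
    then have "L0 $$ (j, c) = (if j = c - (n - k) then 1 else 0)"
      using L0(3)[rule_format, of j "c - (n - k)"] jc by auto
    then show ?thesis using False jc by (auto simp: mu_free_def)
  qed
  have "mu_mat t = L0"
  proof (rule eq_matI)
    fix j c assume "j < dim_row L0" "c < dim_col L0"
    then have jc: "j < k" "c < n" using L0(1) by auto
    show "mu_mat t $$ (j, c) = L0 $$ (j, c)"
    proof (cases "c < m")
      case False
      then show ?thesis using jc mu_free by (simp add: mu_mat_def)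
    next
      case True
      have mn': "m \<le> n" using on by simp
      have "0 = (P0 * L0\<^sup>T) $$ (c, j)" using True jc by (simp add: PL)
      also have "\<dots> = (\<Sum>c' = 0..<n. P0 $$ (c, c') * L0 $$ (j, c'))"
        by (rule mult_transpose_index[OF P0(1) L0(1) True jc(1)])
      also have "\<dots> = (\<Sum>c' = 0..<m. P0 $$ (c, c') * L0 $$ (j, c')) + (\<Sum>c' = m..<n. P0 $$ (c, c') * L0 $$ (j, c'))"
        using sum.atLeastLessThan_concat[of 0 m n "\<lambda>c'. P0 $$ (c, c') * L0 $$ (j, c')"] mn' by simp
      also have "(\<Sum>c' = 0..<m. P0 $$ (c, c') * L0 $$ (j, c')) = (\<Sum>c' = 0..<m. if c' = c then L0 $$ (j, c') else 0)"
        using True P0(3) by (intro sum.cong) auto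
      also have "\<dots> = L0 $$ (j, c)" using True by simp
      finally have "L0 $$ (j, c) = - (\<Sum>c' = m..<n. P0 $$ (c, c') * L0 $$ (j, c'))"
        by (simp add: eq_neg_iff_add_eq_0)
      moreover have "(\<Sum>c' = m..<n. P0 $$ (c, c') * L0 $$ (j, c')) = (\<Sum>c' = m..<n. P0 $$ (c, c') * mu_free t j c')"
        using jc mu_free by (intro sum.cong) auto
      ultimately show ?thesis using True jc by (simp add: mu_mat_def P)
    qed
  qed (use L0(1) in \<open>simp_all add: mu_mat_def\<close>)
  then show thesis using that[of t] A0(2) L0(2) lam by simp
qed

end

end

section \<open>Density of the parametrisation\<close>

lemma polyfun_det:
  assumes A: "\<And>t. A t \<in> carrier_mat k k"
    and e: "\<And>i j. i < k \<Longrightarrow> j < k \<Longrightarrow> polyfun U (\<lambda>t. A t $$ (i, j))"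
  shows "polyfun U (\<lambda>t. det (A t))"
proof -
  have eq: "(\<lambda>t. det (A t)) = (\<lambda>t. \<Sum>p | p permutes {0..<k}. signof p * (\<Prod>i = 0..<k. A t $$ (i, p i)))"
    using det_def'[OF A] by simp
  show ?thesis
    unfolding eq
  proof (rule polyfun_sum, rule polyfun.mult[OF polyfun.const], rule polyfun_prod)
    fix p i assume "p \<in> {p. p permutes {0..<k}}" "i \<in> {0..<k}"
    then have "p i < k" "i < k" using permutes_in_image[of p "{0..<k}" i] by auto
    then show "polyfun U (\<lambda>t. A t $$ (i, p i))" using e by simp
  qed
qed

lemma polyfun_mat_mult:
  assumes A: "\<And>t. A t \<in> carrier_mat k l" and B: "\<And>t. B t \<in> carrier_mat l n"
    and eA: "\<And>i j. i < k \<Longrightarrow> j < l \<Longrightarrow> polyfun U (\<lambda>t. A t $$ (i, j))"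
    and eB: "\<And>i j. i < l \<Longrightarrow> j < n \<Longrightarrow> polyfun U (\<lambda>t. B t $$ (i, j))"
    and ij: "i < k" "j < n"
  shows "polyfun U (\<lambda>t. (A t * B t) $$ (i, j))"
proof -
  have eq: "(A t * B t) $$ (i, j) = (\<Sum>c = 0..<l. A t $$ (i, c) * B t $$ (c, j))" for t
    using A[of t] B[of t] ij by (simp add: scalar_prod_def)
  show ?thesis
    unfolding eq by (rule polyfun_sum, rule polyfun.mult) (use ij eA eB in auto)
qed

lemma polyfun_max_minors:
  assumes A: "\<And>t. A t \<in> carrier_mat k n"
    and e: "\<And>i j. i < k \<Longrightarrow> j < n \<Longrightarrow> polyfun U (\<lambda>t. A t $$ (i, j))"
  shows "polyfun U (\<lambda>t. max_minors k n (A t) I)"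
proof (cases "I \<in> ksubsets k n")
  case True
  have "polyfun U (\<lambda>t. det (submatrix (A t) UNIV I))"
    by (rule polyfun_det) (use e pick_ksubset[OF True] in
      \<open>auto simp: submatrix_UNIV_index[OF A True] intro: submatrix_UNIV_carrier[OF A True]\<close>)
  then show ?thesis using True by (simp add: max_minors_def)
next
  case False
  then show ?thesis by (simp add: max_minors_def polyfun.const)
qed

lemma polyfun_adj_mat:
  assumes A: "\<And>t. A t \<in> carrier_mat n n"
    and e: "\<And>i j. i < n \<Longrightarrow> j < n \<Longrightarrow> polyfun U (\<lambda>t. A t $$ (i, j))"
    and ij: "i < n" "j < n"
  shows "polyfun U (\<lambda>t. adj_mat (A t) $$ (i, j))"
proof -
  have eq: "adj_mat (A t) $$ (i, j) = (-1) ^ (j + i) * det (mat_delete (A t) j i)" for t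
    using A[of t] ij by (simp add: adj_mat_def cofactor_def)
  have "polyfun U (\<lambda>t. det (mat_delete (A t) j i))"
  proof (rule polyfun_det[where k = "n - 1"])
    show "mat_delete (A t) j i \<in> carrier_mat (n - 1) (n - 1)" for t
      by (rule mat_delete_carrier[OF A])
    fix i' j' assume "i' < n - 1" "j' < n - 1"
    moreover have "dim_row (A t) = n" "dim_col (A t) = n" for t using A[of t] by auto
    ultimately show "polyfun U (\<lambda>t. mat_delete (A t) j i $$ (i', j'))"
      using e by (auto simp: mat_delete_def)
  qed
  then show ?thesis unfolding eq by (intro polyfun.mult polyfun.const)
qed

lemma vanishes_if_points: "(\<And>p. p \<in> X \<Longrightarrow> vanishes f {p}) \<Longrightarrow> vanishes f X"
  by (auto simp: vanishes_def cone_def)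

text \<open>The matrix \<open>g\<close> with independent variables as entries, and the matrix \<open>N\<close> whose first \<open>m\<close> columns vanish and whose other entries are
independent variables. Together they describe all pairs in the variety, by \<open>SH_obtain_frame\<close>.\<close>

definition frame_mat :: "nat \<Rightarrow> (nat \<times> nat \<times> nat \<Rightarrow> complex) \<Rightarrow> complex mat" where
  "frame_mat n u = mat n n (\<lambda>(i, j). u (0, i, j))"

definition coeff_mat :: "nat \<Rightarrow> nat \<Rightarrow> nat \<Rightarrow> (nat \<times> nat \<times> nat \<Rightarrow> complex) \<Rightarrow> complex mat" where
  "coeff_mat k n m u = mat k n (\<lambda>(i, j). if j < m then 0 else u (1, i, j))"

lemma frame_mat_carrier: "frame_mat n u \<in> carrier_mat n n" by (simp add: frame_mat_def)
lemma coeff_mat_carrier: "coeff_mat k n m u \<in> carrier_mat k n" by (simp add: coeff_mat_def)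
lemma adj_frame_carrier: "(adj_mat (frame_mat n u))\<^sup>T \<in> carrier_mat n n" using adj_mat(1)[OF frame_mat_carrier] by simp

lemma adj_mat_one: "adj_mat (1\<^sub>m n :: complex mat) = 1\<^sub>m n"
proof -
  have "1\<^sub>m n * adj_mat (1\<^sub>m n :: complex mat) = det (1\<^sub>m n :: complex mat) \<cdot>\<^sub>m 1\<^sub>m n"
    by (rule adj_mat(2)) simp
  moreover have "1\<^sub>m n * adj_mat (1\<^sub>m n :: complex mat) = adj_mat (1\<^sub>m n)"
    by (rule left_mult_one_mat) (rule adj_mat(1), simp)
  moreover have "det (1\<^sub>m n :: complex mat) \<cdot>\<^sub>m 1\<^sub>m n = 1\<^sub>m n" by (intro eq_matI) auto
  ultimately show ?thesis by simp
qed

text \<open>For \<open>L = N (adj g)\<^sup>T\<close> one has \<open>g L\<^sup>T = det g N\<^sup>T\<close>, whose first \<open>m\<close> rows vanish.\<close>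

lemma frame_orthogonal:
  assumes mn: "m \<le> n"
  shows "top_rows m n (frame_mat n u) * (coeff_mat k n m u * (adj_mat (frame_mat n u))\<^sup>T)\<^sup>T = 0\<^sub>m m k"
proof (rule eq_matI)
  let ?G = "frame_mat n u" and ?N = "coeff_mat k n m u"
  let ?L = "?N * (adj_mat ?G)\<^sup>T"
  have L: "?L \<in> carrier_mat k n" by (rule mult_carrier_mat[OF coeff_mat_carrier adj_frame_carrier])
  have adj: "adj_mat ?G \<in> carrier_mat n n" by (rule adj_mat(1)[OF frame_mat_carrier])
  have NT: "?N\<^sup>T \<in> carrier_mat n k" using coeff_mat_carrier by simp
  have "?L\<^sup>T = ((adj_mat ?G)\<^sup>T)\<^sup>T * ?N\<^sup>T" by (rule transpose_mult[OF coeff_mat_carrier adj_frame_carrier])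
  then have "?G * ?L\<^sup>T = ?G * (adj_mat ?G * ?N\<^sup>T)" by simp
  also have "\<dots> = (?G * adj_mat ?G) * ?N\<^sup>T" by (rule assoc_mult_mat[OF frame_mat_carrier adj NT, symmetric])
  also have "\<dots> = (det ?G \<cdot>\<^sub>m 1\<^sub>m n) * ?N\<^sup>T" by (simp only: adj_mat(2)[OF frame_mat_carrier])
  also have "\<dots> = det ?G \<cdot>\<^sub>m ?N\<^sup>T"
    using mult_smult_assoc_mat[OF one_carrier_mat NT, of "det ?G"] NT by simp
  finally have GL: "?G * ?L\<^sup>T = det ?G \<cdot>\<^sub>m ?N\<^sup>T" .
  fix a j assume "a < dim_row (0\<^sub>m m k :: complex mat)" "j < dim_col (0\<^sub>m m k :: complex mat)"
  then have aj: "a < m" "j < k" by auto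
  then have an: "a < n" using mn by simp
  have "(top_rows m n ?G * ?L\<^sup>T) $$ (a, j) = (\<Sum>c = 0..<n. top_rows m n ?G $$ (a, c) * ?L $$ (j, c))"
    by (rule mult_transpose_index[OF top_rows_carrier L aj])
  also have "\<dots> = (\<Sum>c = 0..<n. ?G $$ (a, c) * ?L $$ (j, c))"
    using aj by (intro sum.cong) (auto simp: top_rows_def)
  also have "\<dots> = (?G * ?L\<^sup>T) $$ (a, j)"
    by (rule mult_transpose_index[OF frame_mat_carrier L an aj(2), symmetric])
  also have "\<dots> = 0" unfolding GL using aj an NT by (simp add: coeff_mat_def)
  finally show "(top_rows m n ?G * ?L\<^sup>T) $$ (a, j) = 0\<^sub>m m k $$ (a, j)" using aj by simp
qed (use mult_carrier_mat[OF coeff_mat_carrier adj_frame_carrier] in \<open>simp_all add: top_rows_def coeff_mat_def\<close>)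

text \<open>Density of the parametrisation. The product \<open>?h\<close> of the three minors of \<open>chart_covers\<close> is a polynomial in the entries of \<open>g\<close> and \<open>N\<close>.
Where it is nonzero, the pair given by \<open>g\<close> and \<open>N\<close> is in the image of the parametrisation and \<open>f\<close> vanishes on it. Hence the pullback \<open>?F\<close> of \<open>f\<close>
satisfies \<open>?F ?h = 0\<close>, and as \<open>?h\<close> is nonzero for \<open>g = 1\<close> and \<open>N = [0 | 1]\<close>, the factor \<open>?F\<close> is zero everywhere.\<close>

lemma vanishes_SH_if_vanishes_param:
  fixes f :: "(nat set \<Rightarrow> complex) \<Rightarrow> (nat set \<Rightarrow> complex) \<Rightarrow> complex"
  assumes rk: "r \<le> k" and krn: "2 * k \<le> r + n" and m: "m = k - r"
    and f: "bihom (ksubsets k n) (ksubsets k n) f"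
    and z: "\<And>t. f (max_minors k n (lambda_mat k n t)) (max_minors k n (mu_mat k n m t)) = 0"
  shows "vanishes f (SH_variety k n r)"
proof -
  have kn: "k \<le> n" and mk: "m \<le> k" and mn: "m \<le> n - k" using rk krn m by auto
  obtain d e where de: "bihom_poly (ksubsets k n) (ksubsets k n) d e f" using f by (auto simp: bihom_def)
  let ?A = "\<lambda>u. top_rows k n (frame_mat n u)"
  let ?L = "\<lambda>u. coeff_mat k n m u * (adj_mat (frame_mat n u))\<^sup>T"
  let ?h1 = "\<lambda>u. det (mat k k (\<lambda>(i, j). ?A u $$ (i, 0 + j)))"
  let ?h2 = "\<lambda>u. det (mat m m (\<lambda>(i, j). top_rows m n (frame_mat n u) $$ (i, 0 + j)))"
  let ?h3 = "\<lambda>u. det (mat k k (\<lambda>(i, j). ?L u $$ (i, (n - k) + j)))"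
  let ?h = "\<lambda>u. ?h1 u * (?h2 u * ?h3 u)"
  let ?F = "\<lambda>u. f (max_minors k n (?A u)) (max_minors k n (?L u))"
  have L: "?L u \<in> carrier_mat k n" for u by (rule mult_carrier_mat[OF coeff_mat_carrier adj_frame_carrier])
  have prod0: "?F u * ?h u = 0" for u
  proof (cases "?h u = 0")
    case False
    define E :: "complex mat" where "E = mat m k (\<lambda>(i, j). if i = j then 1 else 0)"
    have E: "E \<in> carrier_mat m k" by (simp add: E_def)
    have T: "top_rows m n (frame_mat n u) = E * ?A u"
    proof (rule eq_matI)
      fix i j assume "i < dim_row (E * ?A u)" "j < dim_col (E * ?A u)"
      then have ij: "i < m" "j < n" by (auto simp: E_def top_rows_def)
      have "(E * ?A u) $$ (i, j) = (\<Sum>b = 0..<k. E $$ (i, b) * ?A u $$ (b, j))"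
        using ij E top_rows_carrier[of k n "frame_mat n u"] by (simp add: scalar_prod_def top_rows_def)
      also have "\<dots> = (\<Sum>b = 0..<k. if b = i then ?A u $$ (b, j) else 0)"
        using ij by (intro sum.cong) (auto simp: E_def)
      also have "\<dots> = ?A u $$ (i, j)" using ij mk by simp
      finally show "top_rows m n (frame_mat n u) $$ (i, j) = (E * ?A u) $$ (i, j)"
        using ij mk by (simp add: top_rows_def)
    qed (simp_all add: E_def top_rows_def)
    have TL: "top_rows m n (frame_mat n u) * (?L u)\<^sup>T = 0\<^sub>m m k"
      by (rule frame_orthogonal) (use mk kn in simp)
    have h: "?h1 u \<noteq> 0" "?h2 u \<noteq> 0" "?h3 u \<noteq> 0" using False by auto
    obtain t where t: "?A u = mat k k (\<lambda>(i, j). ?A u $$ (i, 0 + j)) * lambda_mat k n t"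
      "?L u = mat k k (\<lambda>(i, j). ?L u $$ (i, (n - k) + j)) * mu_mat k n m t"
      by (rule chart_covers[OF kn mk mn top_rows_carrier L E T TL h])
    have mmA: "max_minors k n (?A u) = (\<lambda>I. ?h1 u * max_minors k n (lambda_mat k n t) I)"
      by (subst t(1)) (rule max_minors_mult[OF mat_carrier lambda_mat_carrier])
    have mmL: "max_minors k n (?L u) = (\<lambda>I. ?h3 u * max_minors k n (mu_mat k n m t) I)"
      by (subst t(2)) (rule max_minors_mult[OF mat_carrier mu_mat_carrier])
    have "?F u = 0" unfolding mmA mmL bihom_poly_scale[OF de] z by simp
    then show ?thesis by simp
  qed simp
  have frame_mat_poly: "polyfun UNIV (\<lambda>u. frame_mat n u $$ (i, j))" if "i < n" "j < n" for i j
    using that by (simp add: frame_mat_def polyfun.var)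
  have coeff_mat_poly: "polyfun UNIV (\<lambda>u. coeff_mat k n m u $$ (i, j))" if "i < k" "j < n" for i j
    using that by (cases "j < m") (simp_all add: coeff_mat_def polyfun.var polyfun.const)
  have top_poly: "polyfun UNIV (\<lambda>u. top_rows l n (frame_mat n u) $$ (i, j))" if "i < l" "j < n" "l \<le> n" for i j l
    using that frame_mat_poly[of i j] by (simp add: top_rows_def)
  have L_poly: "polyfun UNIV (\<lambda>u. ?L u $$ (i, j))" if ij: "i < k" "j < n" for i j
  proof (rule polyfun_mat_mult[OF coeff_mat_carrier adj_frame_carrier coeff_mat_poly _ ij])
    fix i j assume ij: "i < n" "j < n"
    have eq: "(adj_mat (frame_mat n u))\<^sup>T $$ (i, j) = adj_mat (frame_mat n u) $$ (j, i)" for u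
      using ij adj_mat(1)[OF frame_mat_carrier, of n u] by simp
    show "polyfun UNIV (\<lambda>u. (adj_mat (frame_mat n u))\<^sup>T $$ (i, j))"
      unfolding eq by (rule polyfun_adj_mat[OF frame_mat_carrier frame_mat_poly ij(2,1)])
  qed
  have F_poly: "polyfun UNIV ?F"
    by (rule polyfun_bihom_poly[OF de])
      (rule polyfun_max_minors[OF top_rows_carrier top_poly[OF _ _ kn]], assumption, assumption,
       rule polyfun_max_minors[OF L L_poly])
  have h1: "polyfun UNIV ?h1" by (rule polyfun_det) (use top_poly kn in auto)
  have h2: "polyfun UNIV ?h2" by (rule polyfun_det) (use top_poly kn mk in auto)
  have h3: "polyfun UNIV ?h3" by (rule polyfun_det) (use L_poly kn in auto)
  have h_poly: "polyfun UNIV ?h" by (intro polyfun.mult h1 h2 h3)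
  \<comment> \<open>the base point \<open>g = 1\<close>, \<open>N = [0 | 1]\<close>\<close>
  define u0 :: "nat \<times> nat \<times> nat \<Rightarrow> complex" where
    "u0 = (\<lambda>(s, i, j). if s = 0 then (if i = j then 1 else 0) else (if j = n - k + i then 1 else 0))"
  have gm0: "frame_mat n u0 = 1\<^sub>m n" by (rule eq_matI) (auto simp: frame_mat_def u0_def)
  have L0: "?L u0 = coeff_mat k n m u0"
    unfolding gm0 adj_mat_one using coeff_mat_carrier[of k n m u0] by simp
  have 1: "mat k k (\<lambda>(i, j). ?A u0 $$ (i, 0 + j)) = 1\<^sub>m k"
    unfolding gm0 by (rule eq_matI) (use kn in \<open>auto simp: top_rows_def\<close>)
  have 2: "mat m m (\<lambda>(i, j). top_rows m n (frame_mat n u0) $$ (i, 0 + j)) = 1\<^sub>m m"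
    unfolding gm0 by (rule eq_matI) (use kn mk in \<open>auto simp: top_rows_def\<close>)
  have 3: "mat k k (\<lambda>(i, j). ?L u0 $$ (i, (n - k) + j)) = 1\<^sub>m k"
    unfolding L0 by (rule eq_matI) (use kn mn in \<open>auto simp: coeff_mat_def u0_def\<close>)
  have h0: "?h u0 = 1" unfolding 1 2 3 det_one by simp
  have F0: "?F u = 0" for u
    using polyfun_mult_eq_0[OF F_poly h_poly prod0]
  proof
    assume "\<forall>u. ?h u = 0"
    from this[rule_format, of u0] show ?thesis unfolding h0 by simp
  next
    assume "\<forall>u. ?F u = 0"
    then show ?thesis by (rule spec)
  qed
  show ?thesis
  proof (rule vanishes_if_points)
    fix p assume "p \<in> SH_variety k n r"
    then obtain V W where VW: "(V, W) \<in> SH k n r" and p: "p = (plucker k n V, plucker k n W)"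
      by (auto simp: SH_variety_def)
    obtain G N where G: "G \<in> carrier_mat n n" "det G \<noteq> 0" "k \<le> n" and N: "N \<in> carrier_mat k n"
      "\<forall>i<k. \<forall>j<k - r. N $$ (i, j) = 0"
      and V: "full_row_rank k n (top_rows k n G)" "V = row_sp n (top_rows k n G)"
      and W: "full_row_rank k n (N * (adj_mat G)\<^sup>T)" "W = row_sp n (N * (adj_mat G)\<^sup>T)"
      by (rule SH_obtain_frame[OF VW])
    define u :: "nat \<times> nat \<times> nat \<Rightarrow> complex" where
      "u = (\<lambda>(s, i, j). if s = 0 then G $$ (i, j) else N $$ (i, j))"
    have gmu: "frame_mat n u = G" by (rule eq_matI) (use G(1) in \<open>auto simp: frame_mat_def u_def\<close>)
    have nmu: "coeff_mat k n m u = N" by (rule eq_matI) (use N m in \<open>auto simp: coeff_mat_def u_def\<close>)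
    have "p = (proj_pt (max_minors k n (?A u)), proj_pt (max_minors k n (?L u)))"
      unfolding p V(2) W(2) gmu nmu plucker_row_space[OF V(1)] plucker_row_space[OF W(1)] ..
    then show "vanishes f {p}" using vanishes_point[OF f] F0[of u] by simp
  qed
qed

section \<open>Dimension of the spinor-helicity variety\<close>

definition params :: "nat \<Rightarrow> nat \<Rightarrow> nat \<Rightarrow> (nat \<times> nat \<times> nat) set" where
  "params k n m = {0} \<times> {..<k} \<times> {k..<n} \<union> {1} \<times> {..<m} \<times> {m..<k} \<union> {2} \<times> {..<k} \<times> {m..<n - k}"

lemma finite_params: "finite (params k n m)"
  by (simp add: params_def)

lemma card_params:
  assumes "k \<le> n" "m \<le> k" "m \<le> n - k"
  shows "card (params k n m) = 2 * k * (n - k) - m^2"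
proof -
  let ?A = "{0 :: nat} \<times> {..<k} \<times> {k..<n}" and ?B = "{1 :: nat} \<times> {..<m} \<times> {m..<k}"
    and ?C = "{2 :: nat} \<times> {..<k} \<times> {m..<n - k}"
  have "card (?A \<union> ?B \<union> ?C) = card (?A \<union> ?B) + card ?C" by (rule card_Un_disjoint) auto
  also have "card (?A \<union> ?B) = card ?A + card ?B" by (rule card_Un_disjoint) auto
  finally have "card (params k n m) = k * (n - k) + m * (k - m) + k * (n - k - m)"
    by (simp add: params_def card_cartesian_product)
  moreover have arith: "k * N + m * (k - m) + k * (N - m) = 2 * k * N - m^2" if N: "m \<le> N" for N
  proof -
    obtain p where "N = m + p" using N le_Suc_ex by blast
    moreover obtain q where "k = m + q" using assms(2) le_Suc_ex by blast
    ultimately show ?thesis by (simp add: algebra_simps power2_eq_square)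
  qed
  ultimately show ?thesis by (simp only: arith[OF assms(3)])
qed

lemma polyfun_lambda_mat:
  assumes "i < k" "c < n"
  shows "polyfun (params k n m) (\<lambda>t. lambda_mat k n t $$ (i, c))"
proof (cases "c < k")
  case False
  then have "(0, i, c) \<in> params k n m" using assms by (auto simp: params_def)
  then show ?thesis using assms False by (simp add: lambda_mat_def polyfun.var)
qed (use assms in \<open>simp add: lambda_mat_def polyfun.const\<close>)

lemma polyfun_common_mat:
  assumes "a < m" "b < k"
  shows "polyfun (params k n m) (\<lambda>t. common_mat k m t $$ (a, b))"
proof (cases "b < m")
  case False
  then have "(1, a, b) \<in> params k n m" using assms by (auto simp: params_def)
  then show ?thesis using assms False by (simp add: common_mat_def polyfun.var)
qed (use assms in \<open>simp add: common_mat_def polyfun.const\<close>)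

lemma polyfun_mu_free:
  assumes "j < k" "m \<le> c"
  shows "polyfun (params k n m) (\<lambda>t. mu_free k n t j c)"
proof (cases "c < n - k")
  case True
  then have "(2, j, c) \<in> params k n m" using assms by (auto simp: params_def)
  then show ?thesis using True by (simp add: mu_free_def polyfun.var)
qed (simp add: mu_free_def polyfun.const)

lemma polyfun_mu_mat:
  assumes "m \<le> n" "j < k" "c < n"
  shows "polyfun (params k n m) (\<lambda>t. mu_mat k n m t $$ (j, c))"
proof (cases "c < m")
  case True
  have "polyfun (params k n m) (\<lambda>t. - (\<Sum>c'=m..<n. (common_mat k m t * lambda_mat k n t) $$ (c, c') * mu_free k n t j c'))"
  proof (rule polyfun_uminus, rule polyfun_sum, rule polyfun.mult)
    fix c' assume c': "c' \<in> {m..<n}"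
    show "polyfun (params k n m) (\<lambda>t. (common_mat k m t * lambda_mat k n t) $$ (c, c'))"
      by (rule polyfun_mat_mult[OF common_mat_carrier lambda_mat_carrier polyfun_common_mat polyfun_lambda_mat]) (use True c' in auto)
    show "polyfun (params k n m) (\<lambda>t. mu_free k n t j c')"
      by (rule polyfun_mu_free) (use assms c' in auto)
  qed
  then show ?thesis using True assms by (simp add: mu_mat_def)
next
  case False
  then show ?thesis using assms polyfun_mu_free[of j k m c n] by (simp add: mu_mat_def)
qed

lemma SH_variety_subset: "SH_variety k n r \<subseteq> proj_space (ksubsets k n) \<times> proj_space (ksubsets k n)"
  using plucker_in_proj_space by (auto simp: SH_variety_def SH_def)

lemma parametrised_SH:
  assumes rk: "r \<le> k" and krn: "2 * k \<le> r + n" and m: "m = k - r"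
  shows "parametrised (ksubsets k n) (ksubsets k n) (SH_variety k n r) (params k n m)
    (\<lambda>t. max_minors k n (lambda_mat k n t)) (\<lambda>t. max_minors k n (mu_mat k n m t))"
proof
  have kn: "k \<le> n" and mk: "m \<le> k" and mn: "m \<le> n - k" using rk krn m by auto
  show "finite (params k n m)" by (rule finite_params)
  show "SH_variety k n r \<subseteq> proj_space (ksubsets k n) \<times> proj_space (ksubsets k n)"
    by (rule SH_variety_subset)
  show "polyfun (params k n m) (\<lambda>t. max_minors k n (lambda_mat k n t) I)" for I
    by (rule polyfun_max_minors[OF lambda_mat_carrier polyfun_lambda_mat])
  show "polyfun (params k n m) (\<lambda>t. max_minors k n (mu_mat k n m t) I)" for I
    by (rule polyfun_max_minors[OF mu_mat_carrier polyfun_mu_mat]) (use mk kn in auto)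
  show "vanishes f (SH_variety k n r)" if "bihom (ksubsets k n) (ksubsets k n) f"
    "\<And>t. f (max_minors k n (lambda_mat k n t)) (max_minors k n (mu_mat k n m t)) = 0" for f
    by (rule vanishes_SH_if_vanishes_param[OF rk krn m that])
  fix t
  have "(row_sp n (lambda_mat k n t), row_sp n (mu_mat k n m t)) \<in> SH k n r"
    by (rule param_in_SH[OF kn mk mn]) (simp add: m)
  then have "map_prod (plucker k n) (plucker k n)
      (row_sp n (lambda_mat k n t), row_sp n (mu_mat k n m t)) \<in> SH_variety k n r"
    unfolding SH_variety_def by (rule imageI)
  then show "(proj_pt (max_minors k n (lambda_mat k n t)), proj_pt (max_minors k n (mu_mat k n m t))) \<in> SH_variety k n r"
    by (simp add: plucker_row_space[OF full_row_rank_lambda_mat[OF kn mk mn]]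
        plucker_row_space[OF full_row_rank_mu_mat[OF kn mk mn]])
qed

section \<open>Pluecker coordinates detecting the parameters\<close>

text \<open>The columns \<open>off, \<dots>, off + k - 1\<close> with \<open>off + i\<close> replaced by \<open>c\<close>. If a matrix has the identity on these columns, then its minor on
the exchanged columns is, up to sign, its entry in row \<open>i\<close> and column \<open>c\<close>. The next lemmas state what is used of this and avoid
the sign.\<close>

definition exchange :: "nat \<Rightarrow> nat \<Rightarrow> nat \<Rightarrow> nat \<Rightarrow> nat set" where
  "exchange off k i c = insert c ({off..<off + k} - {off + i})"

lemma exchange_ksubset:
  assumes "off + k \<le> n" "i < k" "c < n" "c \<notin> {off..<off + k}"
  shows "exchange off k i c \<in> ksubsets k n"
proof -
  have "card ({off..<off + k} - {off + i}) = k - 1" using assms(2) by simp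
  then show ?thesis using assms by (auto simp: exchange_def ksubsets_def)
qed

lemma swap_minor_zero:
  fixes A :: "complex mat"
  assumes A: "A \<in> carrier_mat k n" and on: "off + k \<le> n" and i: "i < k" and c: "c < n" "c \<notin> {off..<off + k}"
    and id: "\<And>j. j < k \<Longrightarrow> A $$ (i, off + j) = (if i = j then 1 else 0)"
    and z: "A $$ (i, c) = 0"
  shows "max_minors k n A (exchange off k i c) = 0"
proof -
  note I = exchange_ksubset[OF on i c]
  have "det (submatrix A UNIV (exchange off k i c)) = 0"
  proof (rule minor_zero_row[OF A I i])
    fix d assume "d \<in> exchange off k i c"
    then show "A $$ (i, d) = 0"
      using z id[of "d - off"] by (auto simp: exchange_def)
  qed
  then show ?thesis by (simp add: max_minors_def)
qed

lemma swap_minor_nonzero: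
  fixes A :: "complex mat"
  assumes A: "A \<in> carrier_mat k n" and on: "off + k \<le> n" and i: "i < k" and c: "c < n" "c \<notin> {off..<off + k}"
    and id: "\<And>i j. i < k \<Longrightarrow> j < k \<Longrightarrow> A $$ (i, off + j) = (if i = j then 1 else 0)"
    and s: "s * s = 1" and cs: "\<And>j. j < k \<Longrightarrow> A $$ (j, c) = (if j = i then s else 0)"
  shows "max_minors k n A (exchange off k i c) \<noteq> 0"
proof -
  note I = exchange_ksubset[OF on i c]
  have "det (submatrix A UNIV (exchange off k i c)) \<noteq> 0"
  proof (rule minor_signed_permutation[OF A I, where \<tau> = "\<lambda>j. if j = i then c else off + j"
        and s = "\<lambda>j. if j = i then s else 1"])
    show "inj_on (\<lambda>j. if j = i then c else off + j) {..<k}"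
      using c(2) by (auto simp: inj_on_def)
    show "(\<lambda>j. if j = i then c else off + j) ` {..<k} \<subseteq> exchange off k i c"
      by (auto simp: exchange_def)
    fix j d assume j: "j < k" and d: "d \<in> exchange off k i c"
    show "A $$ (j, d) = (if d = (if j = i then c else off + j) then (if j = i then s else 1) else 0)"
    proof (cases "d = c")
      case True
      then show ?thesis using cs[OF j] c(2) j by auto
    next
      case False
      then have "d \<in> {off..<off + k}" "d \<noteq> off + i" using d by (auto simp: exchange_def)
      then show ?thesis using id[OF j, of "d - off"] False by auto
    qed
  qed (use s in auto)
  then show ?thesis using I by (simp add: max_minors_def)
qed

text \<open>Assigns to each column \<open>c\<close> with \<open>m \<le> c < k\<close> its own row of the basis of \<open>W\<close>. For \<open>c \<ge> n - k\<close> it is the row in which column \<open>c\<close> of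
\<open>[Y | Z | 1]\<close> has its fixed entry \<open>1\<close>; for smaller \<open>c\<close>, where column \<open>c\<close> belongs to \<open>Z\<close>, the shift by \<open>2 k - n\<close> (truncated at
zero) avoids the rows already taken.\<close>

definition pairing :: "nat \<Rightarrow> nat \<Rightarrow> nat \<Rightarrow> nat" where
  "pairing k n c = (if c < n - k then c + (2 * k - n) else c - (n - k))"

lemma pairing_less: "k \<le> n \<Longrightarrow> c < k \<Longrightarrow> pairing k n c < k"
  by (auto simp: pairing_def)

lemma pairing_inj: "k \<le> n \<Longrightarrow> c < k \<Longrightarrow> c' < k \<Longrightarrow> pairing k n c = pairing k n c' \<Longrightarrow> c = c'"
  by (auto simp: pairing_def split: if_splits)

text \<open>The entries of \<open>Z\<close> in the columns below \<open>k\<close> and in the rows paired with them. When only these and the entries of \<open>C\<close> are nonzero,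
columns \<open>m, \<dots>, k - 1\<close> of the basis of \<open>W\<close> are multiples of distinct unit vectors, so each entry of \<open>C\<close> is visible in
a single entry of \<open>Y\<close>.\<close>

definition paired_params :: "nat \<Rightarrow> nat \<Rightarrow> nat \<Rightarrow> (nat \<times> nat \<times> nat) set" where
  "paired_params k n m = {(2, pairing k n c, c) | c. m \<le> c \<and> c < k \<and> c < n - k}"

definition common_params :: "nat \<Rightarrow> nat \<Rightarrow> (nat \<times> nat \<times> nat) set" where
  "common_params k m = {1} \<times> {..<m} \<times> {m..<k}"

lemma paired_params_subset: "k \<le> n \<Longrightarrow> paired_params k n m \<subseteq> params k n m"
  using pairing_less by (auto simp: paired_params_def params_def)

lemma common_params_subset: "common_params k m \<subseteq> params k n m"
  by (auto simp: common_params_def params_def)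

text \<open>If \<open>X = 0\<close>, the orthogonality equations say that \<open>Y\<close> is minus the product of columns \<open>m, \<dots>, k - 1\<close> of \<open>[Y | Z | 1]\<close> with the transpose of
\<open>C\<close>; under the present assumption those columns are multiples of unit vectors.\<close>

lemma mu_mat_special:
  assumes kn: "k \<le> n" and mk: "m \<le> k" and mn: "m \<le> n - k"
    and t: "\<And>u. u \<notin> paired_params k n m \<union> common_params k m \<Longrightarrow> t u = 0"
    and a: "a < m" and j: "j < k"
  shows "mu_mat k n m t $$ (j, a) = - (\<Sum>c = m..<k. if j = pairing k n c then t (1, a, c) * mu_free k n t j c else 0)"
proof -
  have "(\<Sum>c'=m..<n. (common_mat k m t * lambda_mat k n t) $$ (a, c') * mu_free k n t j c')
      = (\<Sum>c'=m..<k. (common_mat k m t * lambda_mat k n t) $$ (a, c') * mu_free k n t j c') +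
        (\<Sum>c'=k..<n. (common_mat k m t * lambda_mat k n t) $$ (a, c') * mu_free k n t j c')"
    using sum.atLeastLessThan_concat[of m k n "\<lambda>c'. (common_mat k m t * lambda_mat k n t) $$ (a, c') * mu_free k n t j c'"] mk kn
    by simp
  also have "(\<Sum>c'=k..<n. (common_mat k m t * lambda_mat k n t) $$ (a, c') * mu_free k n t j c') = 0"
  proof (rule sum.neutral, rule ballI)
    fix c' assume c': "c' \<in> {k..<n}"
    have "(common_mat k m t * lambda_mat k n t) $$ (a, c') = (\<Sum>b = 0..<k. common_mat k m t $$ (a, b) * lambda_mat k n t $$ (b, c'))"
      using a c' by (simp add: scalar_prod_def lambda_mat_def common_mat_def)
    also have "\<dots> = 0"
    proof (rule sum.neutral, rule ballI)
      fix b assume "b \<in> {0..<k}"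
      moreover have "t (0, b, c') = 0" by (rule t) (auto simp: paired_params_def common_params_def)
      ultimately show "common_mat k m t $$ (a, b) * lambda_mat k n t $$ (b, c') = 0"
        using c' by (simp add: lambda_mat_def)
    qed
    finally show "(common_mat k m t * lambda_mat k n t) $$ (a, c') * mu_free k n t j c' = 0" by simp
  qed
  also have "(\<Sum>c'=m..<k. (common_mat k m t * lambda_mat k n t) $$ (a, c') * mu_free k n t j c') =
      (\<Sum>c = m..<k. if j = pairing k n c then t (1, a, c) * mu_free k n t j c else 0)"
  proof (rule sum.cong[OF refl])
    fix c assume c: "c \<in> {m..<k}"
    have e: "(common_mat k m t * lambda_mat k n t) $$ (a, c) = t (1, a, c)"
      using common_lambda_entry_low[OF kn mk mn a, of c t] c a by (simp add: common_mat_def)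
    have "mu_free k n t j c = 0" if "j \<noteq> pairing k n c"
    proof (cases "c < n - k")
      case True
      have "t (2, j, c) = 0" by (rule t) (use that in \<open>auto simp: paired_params_def common_params_def\<close>)
      then show ?thesis using True by (simp add: mu_free_def)
    next
      case False
      then show ?thesis using that by (auto simp: mu_free_def pairing_def)
    qed
    then show "(common_mat k m t * lambda_mat k n t) $$ (a, c) * mu_free k n t j c =
        (if j = pairing k n c then t (1, a, c) * mu_free k n t j c else 0)"
      by (simp add: e)
  qed
  finally show ?thesis using a j mk kn by (simp add: mu_mat_def)
qed

lemma mu_mat_identity:
  assumes "k \<le> n" "m \<le> n - k" "i < k" "j < k"
  shows "mu_mat k n m t $$ (i, n - k + j) = (if i = j then 1 else 0)"
  using assms by (auto simp: mu_mat_def mu_free_def)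

text \<open>The entry of \<open>Y\<close> in the row paired with \<open>b\<close> and column \<open>a\<close> is \<open>-C a b\<close> times the paired entry of \<open>[Z | 1]\<close>.\<close>

lemma detect_common_param:
  assumes kn: "k \<le> n" and mk: "m \<le> k" and mn: "m \<le> n - k" and ab: "a < m" "m \<le> b" "b < k"
  defines "J \<equiv> exchange (n - k) k (pairing k n b) a"
  shows "J \<in> ksubsets k n"
    "\<lbrakk>\<And>u. u \<notin> paired_params k n m \<union> common_params k m \<Longrightarrow> t u = 0; t (1, a, b) = 0\<rbrakk> \<Longrightarrow>
      max_minors k n (mu_mat k n m t) J = 0"
    "(\<And>u. t u = (if u \<in> insert (1, a, b) (paired_params k n m) then 1 else 0)) \<Longrightarrow>
      max_minors k n (mu_mat k n m t) J \<noteq> 0"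
proof -
  have on: "n - k + k \<le> n" using kn by simp
  have pj: "pairing k n b < k" using pairing_less[OF kn ab(3)] .
  have c: "a < n" "a \<notin> {n - k..<n - k + k}" using ab mk kn mn by auto
  show "J \<in> ksubsets k n" unfolding J_def by (rule exchange_ksubset[OF on pj c])
  show "max_minors k n (mu_mat k n m t) J = 0"
    if t: "\<And>u. u \<notin> paired_params k n m \<union> common_params k m \<Longrightarrow> t u = 0" and t0: "t (1, a, b) = 0"
    unfolding J_def
  proof (rule swap_minor_zero[OF mu_mat_carrier on pj c])
    show "mu_mat k n m t $$ (pairing k n b, n - k + j) = (if pairing k n b = j then 1 else 0)" if "j < k" for j
      by (rule mu_mat_identity[OF kn mn pj that])
    have "(\<Sum>c = m..<k. if pairing k n b = pairing k n c then t (1, a, c) * mu_free k n t (pairing k n b) c else 0) = 0"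
    proof (rule sum.neutral, rule ballI)
      fix c assume "c \<in> {m..<k}"
      then have "pairing k n b = pairing k n c \<Longrightarrow> b = c" using pairing_inj[OF kn ab(3), of c] by simp
      then show "(if pairing k n b = pairing k n c then t (1, a, c) * mu_free k n t (pairing k n b) c else 0) = 0"
        using t0 by auto
    qed
    then show "mu_mat k n m t $$ (pairing k n b, a) = 0"
      using mu_mat_special[OF kn mk mn t ab(1) pj] by simp
  qed
  show "max_minors k n (mu_mat k n m t) J \<noteq> 0"
    if t: "\<And>u. t u = (if u \<in> insert (1, a, b) (paired_params k n m) then 1 else 0)"
    unfolding J_def
  proof (rule swap_minor_nonzero[OF mu_mat_carrier on pj c, where s = "-1"])
    show "mu_mat k n m t $$ (i, n - k + j) = (if i = j then 1 else 0)" if "i < k" "j < k" for i j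
      by (rule mu_mat_identity[OF kn mn that])
    fix j assume j: "j < k"
    have sp: "mu_mat k n m t $$ (j, a) = - (\<Sum>c = m..<k. if j = pairing k n c then t (1, a, c) * mu_free k n t j c else 0)"
      by (rule mu_mat_special[OF kn mk mn _ ab(1) j]) (use ab in \<open>auto simp: t common_params_def\<close>)
    have t1: "t (1, a, c) = (if c = b then 1 else 0)" for c
      by (auto simp: t paired_params_def)
    have m0: "mu_free k n t (pairing k n b) b = 1"
    proof (cases "b < n - k")
      case True
      then have "(2, pairing k n b, b) \<in> paired_params k n m" using ab by (auto simp: paired_params_def)
      then show ?thesis using True by (simp add: mu_free_def t)
    next
      case False
      then show ?thesis by (simp add: mu_free_def pairing_def)
    qed
    have "(\<Sum>c = m..<k. if j = pairing k n c then t (1, a, c) * mu_free k n t j c else 0) =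
        (\<Sum>c = m..<k. if c = b then (if j = pairing k n b then 1 else 0) else 0)"
      by (rule sum.cong) (auto simp: t1[unfolded One_nat_def] m0)
    also have "\<dots> = (if j = pairing k n b then 1 else 0)" using ab by simp
    finally show "mu_mat k n m t $$ (j, a) = (if j = pairing k n b then - 1 else 0)" unfolding sp by simp
  qed simp
qed

lemma detect_lambda_param:
  assumes kn: "k \<le> n" and ic: "i < k" "k \<le> c" "c < n"
  defines "I \<equiv> exchange 0 k i c"
  shows "I \<in> ksubsets k n"
    "t (0, i, c) = 0 \<Longrightarrow> max_minors k n (lambda_mat k n t) I = 0"
    "(\<And>u. t u = (if u = (0, i, c) then 1 else 0)) \<Longrightarrow> max_minors k n (lambda_mat k n t) I \<noteq> 0"
proof -
  have on: "0 + k \<le> n" using kn by simp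
  have c: "c < n" "c \<notin> {0..<0 + k}" using ic by auto
  show "I \<in> ksubsets k n" unfolding I_def by (rule exchange_ksubset[OF on ic(1) c])
  show "max_minors k n (lambda_mat k n t) I = 0" if "t (0, i, c) = 0"
    unfolding I_def
    by (rule swap_minor_zero[OF lambda_mat_carrier on ic(1) c]) (use that ic kn in \<open>auto simp: lambda_mat_def\<close>)
  show "max_minors k n (lambda_mat k n t) I \<noteq> 0" if t: "\<And>u. t u = (if u = (0, i, c) then 1 else 0)"
    unfolding I_def
    by (rule swap_minor_nonzero[OF lambda_mat_carrier on ic(1) c, where s = 1]) (use t ic kn in \<open>auto simp: lambda_mat_def\<close>)
qed

lemma detect_mu_param:
  assumes kn: "k \<le> n" and mn: "m \<le> n - k" and jc: "j < k" "m \<le> c" "c < n - k"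
  defines "J \<equiv> exchange (n - k) k j c"
  shows "J \<in> ksubsets k n"
    "t (2, j, c) = 0 \<Longrightarrow> max_minors k n (mu_mat k n m t) J = 0"
    "(\<And>u. t u = (if u = (2, j, c) then 1 else 0)) \<Longrightarrow> max_minors k n (mu_mat k n m t) J \<noteq> 0"
proof -
  have on: "n - k + k \<le> n" using kn by simp
  have c: "c < n" "c \<notin> {n - k..<n - k + k}" using jc by auto
  show "J \<in> ksubsets k n" unfolding J_def by (rule exchange_ksubset[OF on jc(1) c])
  show "max_minors k n (mu_mat k n m t) J = 0" if "t (2, j, c) = 0"
    unfolding J_def
    by (rule swap_minor_zero[OF mu_mat_carrier on jc(1) c mu_mat_identity[OF kn mn jc(1)]])
      (use that jc in \<open>auto simp: mu_mat_def mu_free_def\<close>)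
  show "max_minors k n (mu_mat k n m t) J \<noteq> 0" if t: "\<And>u. t u = (if u = (2, j, c) then 1 else 0)"
    unfolding J_def
    by (rule swap_minor_nonzero[OF mu_mat_carrier on jc(1) c mu_mat_identity[OF kn mn], where s = 1])
      (use t jc in \<open>auto simp: mu_mat_def mu_free_def\<close>)
qed

text \<open>The order of the parameters: first the paired entries of \<open>Z\<close>, then \<open>C\<close>, then all others. The entries of \<open>X\<close> and \<open>Z\<close> are
Pluecker coordinates up to sign and are detected at any time. The entries of \<open>C\<close> do not occur among the entries of the
two bases; they are detected through \<open>Y\<close> while \<open>X\<close> and the other entries of \<open>Z\<close> are still zero.\<close>

lemma detect_param:
  assumes kn: "k \<le> n" and mk: "m \<le> k" and mn: "m \<le> n - k"
    and us: "distinct (l1 @ l2 @ l3)" "set l1 = paired_params k n m" "set l2 = common_params k m"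
      "set l3 = params k n m - paired_params k n m - common_params k m"
    and i: "i < length (l1 @ l2 @ l3)"
  defines "us \<equiv> l1 @ l2 @ l3"
  shows "\<exists>f. bihom (ksubsets k n) (ksubsets k n) f \<and>
    (\<forall>t. f (max_minors k n (lambda_mat k n (zero_outside (set (take i us)) t)))
          (max_minors k n (mu_mat k n m (zero_outside (set (take i us)) t))) = 0) \<and>
    (\<exists>t. f (max_minors k n (lambda_mat k n (zero_outside (set (take (Suc i) us)) t)))
          (max_minors k n (mu_mat k n m (zero_outside (set (take (Suc i) us)) t))) \<noteq> 0)"
proof -
  let ?u = "us ! i"
  have i': "i < length us" using i by (simp add: us_def)
  have dist: "distinct us" using us(1) by (simp add: us_def)
  have nu: "?u \<notin> set (take i us)"
    using dist i' by (auto simp: in_set_conv_nth nth_eq_iff_index_eq)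
  have tS: "set (take (Suc i) us) = insert ?u (set (take i us))"
    by (simp add: take_Suc_conv_app_nth[OF i'])
  have z0: "zero_outside (set (take i us)) t ?u = 0" for t by (simp add: zero_outside_def nu)
  have uU: "?u \<in> set l1 \<union> set l2 \<union> set l3" using nth_mem[OF i'] by (auto simp: us_def)
  define one :: "(nat \<times> nat \<times> nat) set \<Rightarrow> nat \<times> nat \<times> nat \<Rightarrow> complex"
    where "one D u = (if u \<in> D then 1 else 0)" for D u
  have one: "zero_outside (set (take (Suc i) us)) (one D) = one D" if "D \<subseteq> set (take (Suc i) us)" for D
    using that by (auto simp: zero_outside_def one_def fun_eq_iff)
  have x_bihom: "bihom (ksubsets k n) (ksubsets k n) (\<lambda>x y. x I)" if "I \<in> ksubsets k n" for I
    unfolding bihom_def using bihom_poly.var1[OF that] by (intro exI)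
  have y_bihom: "bihom (ksubsets k n) (ksubsets k n) (\<lambda>x y. y I)" if "I \<in> ksubsets k n" for I
    unfolding bihom_def using bihom_poly.var2[OF that] by (intro exI)
  show ?thesis
  proof (cases "?u \<in> common_params k m")
    case True
    then obtain a b where ab: "?u = (1, a, b)" "a < m" "m \<le> b" "b < k" by (auto simp: common_params_def)
    have il1: "length l1 \<le> i"
    proof (rule ccontr)
      assume "\<not> length l1 \<le> i"
      then have "?u \<in> set l1" by (simp add: us_def nth_append)
      then show False using us(1,3) True by auto
    qed
    have il2: "i < length l1 + length l2"
    proof (rule ccontr)
      assume "\<not> i < length l1 + length l2"
      then have "\<not> i < length l1" "\<not> i - length l1 < length l2" "i - length l1 - length l2 < length l3"
        using i' il1 by (auto simp: us_def)
      then have "?u \<in> set l3" by (simp add: us_def nth_append del: diff_diff_left)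
      then show False using us(4) True by auto
    qed
    have tk: "take i us = l1 @ take (i - length l1) l2" using il1 il2 by (simp add: us_def)
    have sub: "set (take i us) \<subseteq> paired_params k n m \<union> common_params k m"
      unfolding tk using us(2,3) set_take_subset[of "i - length l1" l2] by auto
    have sup: "paired_params k n m \<subseteq> set (take i us)" unfolding tk using us(2) by auto
    note det = detect_common_param[OF kn mk mn ab(2-4)]
    let ?J = "exchange (n - k) k (pairing k n b) a"
    show ?thesis
    proof (intro exI[of _ "\<lambda>x y. y ?J"] conjI allI)
      show "bihom (ksubsets k n) (ksubsets k n) (\<lambda>x y. y ?J)" by (rule y_bihom[OF det(1)])
      show "max_minors k n (mu_mat k n m (zero_outside (set (take i us)) t)) ?J = 0" for t
        by (rule det(2)) (use sub z0[of t] ab(1) in \<open>auto simp: zero_outside_def\<close>)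
      have "insert (1, a, b) (paired_params k n m) \<subseteq> set (take (Suc i) us)" using sup ab(1) tS by auto
      from one[OF this] det(3)[of "one (insert (1, a, b) (paired_params k n m))"]
      show "\<exists>t. max_minors k n (mu_mat k n m (zero_outside (set (take (Suc i) us)) t)) ?J \<noteq> 0"
        by (intro exI[of _ "one (insert (1, a, b) (paired_params k n m))"]) (simp add: one_def)
    qed
  next
    case False
    have one_u: "zero_outside (set (take (Suc i) us)) (one {?u}) = one {?u}" by (rule one) (simp add: tS)
    note paired_sub = paired_params_subset[OF kn, of m]
    have "?u \<in> paired_params k n m \<union> common_params k m \<union> (params k n m - paired_params k n m - common_params k m)"
      using uU unfolding us(2) us(3) us(4) .
    then have uP: "?u \<in> params k n m" using False subsetD[OF paired_sub, of ?u] by (simp only: Un_iff Diff_iff) blast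
    obtain s j c where u: "?u = (s, j, c)" by (cases ?u)
    have "(s, j, c) \<in> params k n m" "(s, j, c) \<notin> common_params k m" using uP False unfolding u .
    then consider j c where "?u = (0, j, c)" "j < k" "k \<le> c" "c < n"
      | j c where "?u = (2, j, c)" "j < k" "m \<le> c" "c < n - k"
      unfolding u params_def common_params_def by auto
    then show ?thesis
    proof cases
      case (1 j c)
      note det = detect_lambda_param[OF kn 1(2-4)]
      show ?thesis
      proof (intro exI[of _ "\<lambda>x y. x (exchange 0 k j c)"] conjI allI)
        show "bihom (ksubsets k n) (ksubsets k n) (\<lambda>x y. x (exchange 0 k j c))" by (rule x_bihom[OF det(1)])
        show "max_minors k n (lambda_mat k n (zero_outside (set (take i us)) t)) (exchange 0 k j c) = 0" for t
          by (rule det(2)) (use z0[of t] 1(1) in simp)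
        show "\<exists>t. max_minors k n (lambda_mat k n (zero_outside (set (take (Suc i) us)) t)) (exchange 0 k j c) \<noteq> 0"
          by (rule exI[of _ "one {?u}"], unfold one_u, rule det(3)) (simp add: one_def 1(1))
      qed
    next
      case (2 j c)
      note det = detect_mu_param[OF kn mn 2(2-4)]
      show ?thesis
      proof (intro exI[of _ "\<lambda>x y. y (exchange (n - k) k j c)"] conjI allI)
        show "bihom (ksubsets k n) (ksubsets k n) (\<lambda>x y. y (exchange (n - k) k j c))" by (rule y_bihom[OF det(1)])
        show "max_minors k n (mu_mat k n m (zero_outside (set (take i us)) t)) (exchange (n - k) k j c) = 0" for t
          by (rule det(2)) (use z0[of t] 2(1) in simp)
        show "\<exists>t. max_minors k n (mu_mat k n m (zero_outside (set (take (Suc i) us)) t)) (exchange (n - k) k j c) \<noteq> 0"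
          by (rule exI[of _ "one {?u}"], unfold one_u, rule det(3)) (simp add: one_def 2(1))
      qed
    qed
  qed
qed

theorem SH_variety_irreducible_dim:
  assumes rk: "r \<le> k" and krn: "2 * k \<le> r + n"
  shows "SH_variety k n r \<noteq> {}"
    "irreduciblein (zariski (ksubsets k n) (ksubsets k n)) (SH_variety k n r)"
    "krull_dim (subtopology (zariski (ksubsets k n) (ksubsets k n)) (SH_variety k n r))
      = enat (2 * k * (n - k) - (k - r)^2)"
proof -
  define m where "m = k - r"
  have kn: "k \<le> n" and mk: "m \<le> k" and mn: "m \<le> n - k" using rk krn by (auto simp: m_def)
  interpret parametrised "ksubsets k n" "ksubsets k n" "SH_variety k n r" "params k n m"
    "\<lambda>t. max_minors k n (lambda_mat k n t)" "\<lambda>t. max_minors k n (mu_mat k n m t)"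
    by (rule parametrised_SH[OF rk krn m_def])
  show "SH_variety k n r \<noteq> {}" using prime_on_X by (simp add: prime_on_def)
  show "irreduciblein (zariski (ksubsets k n) (ksubsets k n)) (SH_variety k n r)" by (rule irreduciblein_X)
  have sub: "paired_params k n m \<subseteq> params k n m" "common_params k m \<subseteq> params k n m"
    by (rule paired_params_subset[OF kn], rule common_params_subset)
  obtain l1 where l1: "distinct l1" "set l1 = paired_params k n m"
    using finite_distinct_list[OF finite_subset[OF sub(1) finite_params]] by (elim exE conjE) (rule that; assumption)
  obtain l2 where l2: "distinct l2" "set l2 = common_params k m"
    using finite_distinct_list[OF finite_subset[OF sub(2) finite_params]] by (elim exE conjE) (rule that; assumption)
  have fin: "finite (params k n m - paired_params k n m - common_params k m)" by (simp add: finite_params)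
  obtain l3 where l3: "distinct l3" "set l3 = params k n m - paired_params k n m - common_params k m"
    using finite_distinct_list[OF fin] by (elim exE conjE) (rule that; assumption)
  have "paired_params k n m \<inter> common_params k m = {}" by (auto simp: paired_params_def common_params_def)
  then have dist: "distinct (l1 @ l2 @ l3)" using l1 l2 l3 by auto
  have set: "set (l1 @ l2 @ l3) = params k n m" using l1(2) l2(2) l3(2) sub by auto
  show "krull_dim (subtopology (zariski (ksubsets k n) (ksubsets k n)) (SH_variety k n r))
      = enat (2 * k * (n - k) - (k - r)^2)"
    using krull_dim_X[OF dist set detect_param[OF kn mk mn dist l1(2) l2(2) l3(2)]]
    unfolding card_params[OF kn mk mn] by (simp only: m_def)
qed

section \<open>Orthogonal complements and complementary minors\<close>

text \<open>A basis of \<open>Q\<close> extends to a basis of \<open>V\<close>, which cannot be larger.\<close>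

lemma subspace_eq_if_dim_le:
  assumes Q: "subspace class_ring Q (Cn n)" and V: "subspace class_ring V (Cn n)" and QV: "Q \<subseteq> V"
    and dim: "sdim n V \<le> sdim n Q"
  shows "Q = V"
proof -
  interpret vec_space "TYPE(complex)" n .
  have li0: "lin_indpt {}" by (simp add: lin_dep_def)
  obtain B where B: "B \<subseteq> Q" "lin_indpt B" "span B = Q"
    "card B = sdim n Q"
    using basis_of_subspace_extending[OF Q li0 empty_subsetI] by (elim exE conjE) (rule that; assumption)
  obtain B' where B': "finite B'" "B \<subseteq> B'" "span B' = V"
    "card B' = sdim n V"
    using basis_of_subspace_extending[OF V B(2) subset_trans[OF B(1) QV]] by (elim exE conjE) (rule that; assumption)
  have "B = B'" by (rule card_seteq[OF B'(1,2)]) (use B(4) B'(4) dim in simp)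
  then show ?thesis using B(3) B'(3) by simp
qed

lemma Gr_subspace: "V \<in> Gr k n \<Longrightarrow> subspace class_ring V (Cn n)"
  and Gr_dim: "V \<in> Gr k n \<Longrightarrow> sdim n V = k"
  and Gr_carrier: "V \<in> Gr k n \<Longrightarrow> V \<subseteq> carrier_vec n"
  by (auto simp: Gr_def subspace_def submodule_def module_vec_def)

lemma Gr_subset_eq:
  assumes "V \<in> Gr k n" "V' \<in> Gr k n" "V \<subseteq> V'"
  shows "V = V'"
  by (rule subspace_eq_if_dim_le[OF Gr_subspace[OF assms(1)] Gr_subspace[OF assms(2)] assms(3)])
    (simp add: Gr_dim[OF assms(1)] Gr_dim[OF assms(2)])

lemma SH_0_iff:
  "(V, W) \<in> SH k n 0 \<longleftrightarrow> V \<in> Gr k n \<and> W \<in> Gr k n \<and> V \<subseteq> perp n W"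
proof
  let ?Q = "V \<inter> perp n W"
  assume "(V, W) \<in> SH k n 0"
  then have V: "V \<in> Gr k n" and W: "W \<in> Gr k n"
    and d: "k \<le> sdim n ?Q" by (auto simp: SH_def)
  have "?Q = V"
    by (rule subspace_eq_if_dim_le[OF subspace_Int_orthogonal_complement[OF V Gr_carrier[OF W]] Gr_subspace[OF V]])
      (use d in \<open>simp_all add: Gr_dim[OF V]\<close>)
  then show "V \<in> Gr k n \<and> W \<in> Gr k n \<and> V \<subseteq> perp n W" using V W by auto
next
  assume VW: "V \<in> Gr k n \<and> W \<in> Gr k n \<and> V \<subseteq> perp n W"
  then have "V \<inter> perp n W = V" by auto
  then show "(V, W) \<in> SH k n 0" using VW Gr_dim[of V k n] by (auto simp: SH_def)
qed

text \<open>Lists the complement of \<open>I\<close> increasingly and then \<open>I\<close> increasingly. The determinant of the permutation matrix is the sign in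
Jacobi's theorem; only the fact that it is nonzero and depends on \<open>I\<close> alone matters.\<close>

definition block_perm :: "nat \<Rightarrow> nat \<Rightarrow> nat set \<Rightarrow> nat \<Rightarrow> nat" where
  "block_perm k n I i = (if i < k then pick ({..<n} - I) i else pick I (i - k))"

definition perm_mat :: "nat \<Rightarrow> nat \<Rightarrow> nat set \<Rightarrow> complex mat" where
  "perm_mat k n I = mat n n (\<lambda>(i, c). if c = block_perm k n I i then 1 else 0)"

lemma perm_mat_carrier: "perm_mat k n I \<in> carrier_mat n n" by (simp add: perm_mat_def)

lemma complement_ksubset:
  assumes "k \<le> n" "I \<in> ksubsets (n - k) n"
  shows "{..<n} - I \<in> ksubsets k n"
  using assms ksubsetsD(1)[OF assms(2)] by (auto simp: ksubsets_def card_Diff_subset)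

lemma block_perm_less:
  assumes kn: "k \<le> n" and I: "I \<in> ksubsets (n - k) n" and i: "i < n"
  shows "block_perm k n I i < n"
  using pick_ksubset[OF complement_ksubset[OF kn I], of i] pick_ksubset[OF I, of "i - k"] i
  by (auto simp: block_perm_def)

lemma block_perm_inj:
  assumes kn: "k \<le> n" and I: "I \<in> ksubsets (n - k) n"
  shows "inj_on (block_perm k n I) {..<n}"
proof (rule inj_onI)
  let ?J = "{..<n} - I"
  note J = complement_ksubset[OF kn I]
  have injJ: "inj_on (pick ?J) {..<k}" using bij_betw_pick[OF ksubsetsD(1)[OF J]] ksubsetsD(2)[OF J]
    by (simp add: bij_betw_def)
  have injI: "inj_on (pick I) {..<n - k}" using bij_betw_pick[OF ksubsetsD(1)[OF I]] ksubsetsD(2)[OF I]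
    by (simp add: bij_betw_def)
  fix i j assume ij: "i \<in> {..<n}" "j \<in> {..<n}" "block_perm k n I i = block_perm k n I j"
  have inJ: "pick ?J l \<in> ?J" if "l < k" for l using pick_ksubset(1)[OF J that] .
  have inI: "pick I l \<in> I" if "l < n - k" for l using pick_ksubset(1)[OF I that] .
  have l: "p - k < n - k" if "\<not> p < k" "p < n" for p using that by linarith
  have ne: "pick ?J p \<noteq> pick I (q - k)" if "p < k" "\<not> q < k" "q < n" for p q
    using inJ[OF that(1)] inI[OF l[OF that(2,3)]] by auto
  show "i = j"
  proof (cases "i < k")
    case True
    show ?thesis
    proof (cases "j < k")
      case True
      then show ?thesis using ij(3) inj_onD[OF injJ, of i j] \<open>i < k\<close> by (simp add: block_perm_def)
    next
      case False
      then show ?thesis using ij ne[OF True False] True by (simp add: block_perm_def)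
    qed
  next
    case False
    show ?thesis
    proof (cases "j < k")
      case True
      then show ?thesis using ij ne[OF True False] False by (simp add: block_perm_def)
    next
      case j: False
      then have "i - k = j - k"
        using ij inj_onD[OF injI, of "i - k" "j - k"] False l[of i] l[of j] by (simp add: block_perm_def)
      then show ?thesis using False j by simp
    qed
  qed
qed

lemma mult_perm_mat_transpose:
  assumes kn: "k \<le> n" and I: "I \<in> ksubsets (n - k) n" and K: "K \<in> carrier_mat n n" and ij: "i < n" "j < n"
  shows "(K * (perm_mat k n I)\<^sup>T) $$ (i, j) = K $$ (i, block_perm k n I j)"
proof -
  have "(K * (perm_mat k n I)\<^sup>T) $$ (i, j) = (\<Sum>c = 0..<n. K $$ (i, c) * perm_mat k n I $$ (j, c))"
    using K ij perm_mat_carrier[of k n I] by (simp add: scalar_prod_def perm_mat_def)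
  also have "\<dots> = (\<Sum>c = 0..<n. if c = block_perm k n I j then K $$ (i, c) else 0)"
    using ij by (intro sum.cong) (auto simp: perm_mat_def)
  also have "\<dots> = K $$ (i, block_perm k n I j)" using block_perm_less[OF kn I ij(2)] by simp
  finally show ?thesis .
qed

lemma det_perm_mat:
  assumes kn: "k \<le> n" and I: "I \<in> ksubsets (n - k) n"
  shows "det (perm_mat k n I) * det (perm_mat k n I) = 1"
proof -
  let ?P = "perm_mat k n I"
  have "?P * ?P\<^sup>T = 1\<^sub>m n"
  proof (rule eq_matI)
    fix i j assume "i < dim_row (1\<^sub>m n :: complex mat)" "j < dim_col (1\<^sub>m n :: complex mat)"
    then have ij: "i < n" "j < n" by auto
    have "(?P * ?P\<^sup>T) $$ (i, j) = (if block_perm k n I j = block_perm k n I i then 1 else 0)"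
      using mult_perm_mat_transpose[OF kn I perm_mat_carrier ij] ij block_perm_less[OF kn I ij(2)]
      by (simp add: perm_mat_def)
    also have "\<dots> = (if i = j then 1 else 0)"
      using inj_onD[OF block_perm_inj[OF kn I], of i j] ij by auto
    finally show "(?P * ?P\<^sup>T) $$ (i, j) = 1\<^sub>m n $$ (i, j)" using ij by simp
  qed (simp_all add: perm_mat_def)
  then have "det (?P * ?P\<^sup>T) = 1" by simp
  then show ?thesis
    using det_mult[OF perm_mat_carrier[of k n I], of "?P\<^sup>T"] det_transpose[OF perm_mat_carrier[of k n I]] perm_mat_carrier[of k n I] by simp
qed

text \<open>Jacobi's theorem: for \<open>H = G\<^sup>-\<^sup>1\<close> the minors of the last columns of \<open>H\<close> are, up to sign and the factor \<open>det G\<close>, the complementary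
minors of the first rows of \<open>G\<close>. Let \<open>K\<close> have as its rows the unit vectors for the complement of \<open>I\<close>, followed by the rows of \<open>M\<close>. Both
\<open>G K\<^sup>T\<close> and, after sorting the columns, \<open>K\<close> itself are block triangular with an identity block on the diagonal; the other
diagonal blocks are the two minors.\<close>

lemma complementary_minors:
  fixes G H :: "complex mat"
  assumes kn: "k \<le> n" and I: "I \<in> ksubsets (n - k) n"
    and G: "G \<in> carrier_mat n n" and H: "H \<in> carrier_mat n n" and GH: "G * H = 1\<^sub>m n"
    and L: "L = mat k n (\<lambda>(i, j). G $$ (i, j))" and M: "M = mat (n - k) n (\<lambda>(i, j). H $$ (j, k + i))"
  shows "det G * det (submatrix M UNIV I) = det (perm_mat k n I) * det (submatrix L UNIV ({..<n} - I))"
proof -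
  let ?J = "{..<n} - I" and ?\<rho> = "block_perm k n I"
  note J = complement_ksubset[OF kn I]
  have Lc: "L \<in> carrier_mat k n" and Mc: "M \<in> carrier_mat (n - k) n" by (simp_all add: L M)
  define K where "K = mat n n (\<lambda>(i, c). if i < k then (if c = ?\<rho> i then 1 else 0) else M $$ (i - k, c))"
  have K: "K \<in> carrier_mat n n" by (simp add: K_def)
  have nk: "k + (n - k) = n" using kn by simp
  have GK_entry: "(G * K\<^sup>T) $$ (a, i) = (if i < k then G $$ (a, ?\<rho> i) else if a = i then 1 else 0)"
    if ai: "a < n" "i < n" for a i
  proof -
    have e: "(G * K\<^sup>T) $$ (a, i) = (\<Sum>c = 0..<n. G $$ (a, c) * K $$ (i, c))"
      using G K ai by (simp add: scalar_prod_def)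
    show ?thesis
    proof (cases "i < k")
      case True
      have "(\<Sum>c = 0..<n. G $$ (a, c) * K $$ (i, c)) = (\<Sum>c = 0..<n. if c = ?\<rho> i then G $$ (a, c) else 0)"
        using ai True by (intro sum.cong) (auto simp: K_def)
      also have "\<dots> = G $$ (a, ?\<rho> i)" using block_perm_less[OF kn I ai(2)] by simp
      finally show ?thesis using e True by simp
    next
      case False
      have "(\<Sum>c = 0..<n. G $$ (a, c) * K $$ (i, c)) = (\<Sum>c = 0..<n. G $$ (a, c) * H $$ (c, i))"
        using ai False by (intro sum.cong) (auto simp: K_def M)
      also have "\<dots> = (G * H) $$ (a, i)" using G H ai by (simp add: scalar_prod_def)
      finally show ?thesis using e False ai by (simp add: GH)
    qed
  qed
  have GK: "G * K\<^sup>T = four_block_mat (submatrix L UNIV ?J) (0\<^sub>m k (n - k))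
      (mat (n - k) k (\<lambda>(a, i). G $$ (k + a, ?\<rho> i))) (1\<^sub>m (n - k))" (is "_ = ?F")
  proof (rule eq_matI)
    have SJ: "submatrix L UNIV ?J \<in> carrier_mat k k" by (rule submatrix_UNIV_carrier[OF Lc J])
    then show dims: "dim_row (G * K\<^sup>T) = dim_row ?F" "dim_col (G * K\<^sup>T) = dim_col ?F"
      using G K kn by auto
    fix a i assume "a < dim_row ?F" "i < dim_col ?F"
    then have ai: "a < n" "i < n" using SJ kn by auto
    have "L $$ (a, pick ?J i) = G $$ (a, pick ?J i)" if "a < k" "i < k"
      using that pick_ksubset[OF J, of i] by (simp add: L)
    then show "(G * K\<^sup>T) $$ (a, i) = ?F $$ (a, i)"
      unfolding GK_entry[OF ai] using ai SJ kn
      by (auto simp: submatrix_UNIV_index[OF Lc J] block_perm_def)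
  qed
  have KP: "K * (perm_mat k n I)\<^sup>T = four_block_mat (1\<^sub>m k) (0\<^sub>m k (n - k))
      (mat (n - k) k (\<lambda>(a, i). M $$ (a, ?\<rho> i))) (submatrix M UNIV I)" (is "_ = ?F")
  proof (rule eq_matI)
    have SI: "submatrix M UNIV I \<in> carrier_mat (n - k) (n - k)" by (rule submatrix_UNIV_carrier[OF Mc I])
    then show dims: "dim_row (K * (perm_mat k n I)\<^sup>T) = dim_row ?F" "dim_col (K * (perm_mat k n I)\<^sup>T) = dim_col ?F"
      using K kn by (auto simp: perm_mat_def)
    fix i j assume "i < dim_row ?F" "j < dim_col ?F"
    then have ij: "i < n" "j < n" using SI kn by auto
    have e: "(K * (perm_mat k n I)\<^sup>T) $$ (i, j) = K $$ (i, ?\<rho> j)"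
      by (rule mult_perm_mat_transpose[OF kn I K ij])
    have inj: "?\<rho> j = ?\<rho> i \<longleftrightarrow> j = i"
      using inj_onD[OF block_perm_inj[OF kn I], of i j] ij by auto
    have Ke: "K $$ (i, ?\<rho> j) = (if i < k then (if j = i then 1 else 0) else M $$ (i - k, ?\<rho> j))"
      using ij block_perm_less[OF kn I ij(2)] inj by (simp add: K_def)
    have rj: "?\<rho> j = pick I (j - k)" if "\<not> j < k" using that by (simp add: block_perm_def)
    show "(K * (perm_mat k n I)\<^sup>T) $$ (i, j) = ?F $$ (i, j)"
      unfolding e Ke using ij SI kn rj
      by (auto simp: submatrix_UNIV_index[OF Mc I])
  qed
  have d1: "det G * det K = det (submatrix L UNIV ?J)"
  proof -
    have "det (G * K\<^sup>T) = det (submatrix L UNIV ?J) * det (1\<^sub>m (n - k) :: complex mat)"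
      unfolding GK by (rule det_four_block_mat_upper_right_zero[OF submatrix_UNIV_carrier[OF Lc J] refl]) simp_all
    moreover have "det (G * K\<^sup>T) = det G * det K"
      using det_mult[OF G, of "K\<^sup>T"] det_transpose[OF K] K by simp
    ultimately show ?thesis by simp
  qed
  have d2: "det K * det (perm_mat k n I) = det (submatrix M UNIV I)"
  proof -
    have "det (K * (perm_mat k n I)\<^sup>T) = det (1\<^sub>m k :: complex mat) * det (submatrix M UNIV I)"
      unfolding KP by (rule det_four_block_mat_upper_right_zero[OF one_carrier_mat refl _ submatrix_UNIV_carrier[OF Mc I]]) simp
    moreover have "det (K * (perm_mat k n I)\<^sup>T) = det K * det (perm_mat k n I)"
      using det_mult[OF K, of "(perm_mat k n I)\<^sup>T"] det_transpose[OF perm_mat_carrier[of k n I]] perm_mat_carrier[of k n I] by simp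
    ultimately show ?thesis by simp
  qed
  show ?thesis unfolding d1[symmetric] d2[symmetric] by (simp add: algebra_simps)
qed

text \<open>The linear map on Pluecker coordinates induced by passing to the orthogonal complement.\<close>

definition dual_map :: "nat \<Rightarrow> nat \<Rightarrow> (nat set \<Rightarrow> complex) \<Rightarrow> nat set \<Rightarrow> complex" where
  "dual_map k n y = (\<lambda>I. if I \<in> ksubsets (n - k) n then det (perm_mat k n I) * y ({..<n} - I) else 0)"

lemma image_proj_pt:
  assumes "\<And>c. A (\<lambda>i. c * x i) = (\<lambda>j. c * A x j)"
  shows "A ` proj_pt x = proj_pt (A x)"
  unfolding proj_pt_def using assms by (auto simp: image_iff) metis

lemma lin_iso_dual_map:
  assumes kn: "k \<le> n"
  shows "lin_iso_on (coord_space (ksubsets k n)) (coord_space (ksubsets (n - k) n)) (dual_map k n)"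
  unfolding lin_iso_on_def
proof (intro conjI ballI allI)
  have comp: "{..<n} - J \<in> ksubsets (n - k) n" if "J \<in> ksubsets k n" for J
    using complement_ksubset[of "n - k" n J] that kn by simp
  have dc: "{..<n} - ({..<n} - I) = I" if "I \<in> ksubsets l n" for I l
    using ksubsetsD(3)[OF that] by auto
  have d0: "det (perm_mat k n I) \<noteq> 0" if "I \<in> ksubsets (n - k) n" for I
    using det_perm_mat[OF kn that] by auto
  define undual where "undual z = (\<lambda>J. if J \<in> ksubsets k n
    then z ({..<n} - J) / det (perm_mat k n ({..<n} - J)) else 0)" for z :: "nat set \<Rightarrow> complex"
  show "bij_betw (dual_map k n) (coord_space (ksubsets k n)) (coord_space (ksubsets (n - k) n))"
  proof (rule bij_betw_byWitness[where f' = undual])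
    show "\<forall>y\<in>coord_space (ksubsets k n). undual (dual_map k n y) = y"
    proof
      fix y assume y: "y \<in> coord_space (ksubsets k n)"
      show "undual (dual_map k n y) = y"
      proof
        fix J show "undual (dual_map k n y) J = y J"
          using y comp[of J] d0[OF comp, of J] dc[of J k] by (auto simp: undual_def dual_map_def coord_space_def)
      qed
    qed
    show "\<forall>z\<in>coord_space (ksubsets (n - k) n). dual_map k n (undual z) = z"
    proof
      fix z assume z: "z \<in> coord_space (ksubsets (n - k) n)"
      show "dual_map k n (undual z) = z"
      proof
        fix I show "dual_map k n (undual z) I = z I"
          using z complement_ksubset[OF kn, of I] d0[of I] dc[of I "n - k"]
          by (auto simp: undual_def dual_map_def coord_space_def)
      qed
    qed
  qed (auto simp: coord_space_def dual_map_def undual_def)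
next
  fix x y :: "nat set \<Rightarrow> complex"
  show "dual_map k n (\<lambda>i. x i + y i) = (\<lambda>j. dual_map k n x j + dual_map k n y j)"
    by (auto simp: dual_map_def algebra_simps)
next
  fix c and x :: "nat set \<Rightarrow> complex"
  show "dual_map k n (\<lambda>i. c * x i) = (\<lambda>j. c * dual_map k n x j)"
    by (auto simp: dual_map_def)
qed

text \<open>The last \<open>n - k\<close> columns of \<open>H\<close>, written as rows.\<close>

definition dual_mat :: "nat \<Rightarrow> nat \<Rightarrow> complex mat \<Rightarrow> complex mat" where
  "dual_mat k n H = mat (n - k) n (\<lambda>(i, j). H $$ (j, k + i))"

text \<open>If \<open>G H = 1\<close>, the columns of \<open>H\<close> form the basis dual to the rows of \<open>G\<close>. A vector orthogonal to the first \<open>k\<close> rows of \<open>G\<close> has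
zero coefficients at the first \<open>k\<close> columns of \<open>H\<close>.\<close>

lemma row_space_dual_mat:
  assumes kn: "k \<le> n" and G: "G \<in> carrier_mat n n" and H: "H \<in> carrier_mat n n" and GH: "G * H = 1\<^sub>m n"
    and L: "L = mat k n (\<lambda>(i, j). G $$ (i, j))"
  shows "full_row_rank (n - k) n (dual_mat k n H)"
    "row_sp n (dual_mat k n H) = perp n (row_sp n L)"
proof -
  let ?M = "dual_mat k n H"
  have M: "?M \<in> carrier_mat (n - k) n" by (simp add: dual_mat_def)
  have Lc: "L \<in> carrier_mat k n" by (simp add: L)
  have HG: "H * G = 1\<^sub>m n" by (rule mat_mult_left_right_inverse[OF G H GH])
  have pair: "(\<Sum>c = 0..<n. G $$ (a, c) * H $$ (c, b)) = (if a = b then 1 else 0)" if "a < n" "b < n" for a b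
  proof -
    have "(G * H) $$ (a, b) = (\<Sum>c = 0..<n. G $$ (a, c) * H $$ (c, b))"
      using that G H by (simp add: scalar_prod_def)
    then show ?thesis using that by (simp add: GH)
  qed
  define N where "N = mat n (n - k) (\<lambda>(c, j). G $$ (k + j, c))"
  have "?M * N = 1\<^sub>m (n - k)"
  proof (rule eq_matI)
    fix i j assume "i < dim_row (1\<^sub>m (n - k) :: complex mat)" "j < dim_col (1\<^sub>m (n - k) :: complex mat)"
    then have ij: "i < n - k" "j < n - k" by auto
    then have kij: "k + i < n" "k + j < n" by linarith+
    have "(?M * N) $$ (i, j) = (\<Sum>c = 0..<n. G $$ (k + j, c) * H $$ (c, k + i))"
      using ij by (simp add: scalar_prod_def dual_mat_def N_def mult.commute)
    then show "(?M * N) $$ (i, j) = 1\<^sub>m (n - k) $$ (i, j)" using pair[OF kij(2,1)] ij by simp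
  qed (simp_all add: dual_mat_def N_def)
  then show "full_row_rank (n - k) n ?M" using M by (auto simp: full_row_rank_def N_def)
  show "row_sp n ?M = perp n (row_sp n L)"
  proof (intro Set.set_eqI iffI)
    fix x assume "x \<in> row_sp n ?M"
    then obtain y where y: "y \<in> carrier_vec (n - k)" "x = ?M\<^sup>T *\<^sub>v y" using row_space_iff[OF M] by blast
    have x: "x \<in> carrier_vec n" unfolding y(2) using M by (intro mult_mat_vec_carrier[OF _ y(1)]) simp
    have xc: "x $ c = (\<Sum>i = 0..<n - k. H $$ (c, k + i) * y $ i)" if "c < n" for c
      unfolding y(2) using that y(1) by (simp add: scalar_prod_def dual_mat_def)
    have "x \<bullet> row L j = 0" if j: "j < k" for j
    proof -
      have "x \<bullet> row L j = (\<Sum>c = 0..<n. x $ c * G $$ (j, c))"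
        using x j by (simp add: scalar_prod_def L)
      also have "\<dots> = (\<Sum>c = 0..<n. \<Sum>i = 0..<n - k. G $$ (j, c) * H $$ (c, k + i) * y $ i)"
        by (intro sum.cong refl) (simp add: xc sum_distrib_left sum_distrib_right mult_ac)
      also have "\<dots> = (\<Sum>i = 0..<n - k. (\<Sum>c = 0..<n. G $$ (j, c) * H $$ (c, k + i)) * y $ i)"
        by (subst sum.swap) (simp add: sum_distrib_right)
      also have "\<dots> = 0"
      proof (rule sum.neutral, rule ballI)
        fix i assume "i \<in> {0..<n - k}"
        then have i: "k + i < n" by auto
        have "(\<Sum>c = 0..<n. G $$ (j, c) * H $$ (c, k + i)) = 0"
          using pair[of j "k + i"] j i kn by simp
        then show "(\<Sum>c = 0..<n. G $$ (j, c) * H $$ (c, k + i)) * y $ i = 0" by simp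
      qed
      finally show ?thesis .
    qed
    then show "x \<in> perp n (row_sp n L)"
      using mem_orthogonal_complement_row_space[OF Lc x] by simp
  next
    fix x assume xo: "x \<in> perp n (row_sp n L)"
    then have x: "x \<in> carrier_vec n" by (simp add: vec_module.orthogonal_complement_def)
    have xL: "x \<bullet> row L j = 0" if "j < k" for j
      using xo that mem_orthogonal_complement_row_space[OF Lc x] by simp
    define z where "z = G *\<^sub>v x"
    have z: "z \<in> carrier_vec n" using G x by (simp add: z_def)
    have z0: "z $ j = 0" if j: "j < k" for j
    proof -
      have "z $ j = x \<bullet> row L j"
        using j kn x G by (simp add: z_def scalar_prod_def L mult.commute)
      then show ?thesis using xL[OF j] by simp
    qed
    have xz: "x = H *\<^sub>v z"
      unfolding z_def using assoc_mult_mat_vec[OF H G x] HG x by simp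
    define y where "y = vec (n - k) (\<lambda>i. z $ (k + i))"
    have y: "y \<in> carrier_vec (n - k)" by (simp add: y_def)
    have "x = ?M\<^sup>T *\<^sub>v y"
    proof (rule eq_vecI)
      fix c assume "c < dim_vec (?M\<^sup>T *\<^sub>v y)"
      then have c: "c < n" using M by simp
      have "x $ c = (\<Sum>i = 0..<n. H $$ (c, i) * z $ i)"
        unfolding xz using c H z by (simp add: scalar_prod_def)
      also have "\<dots> = (\<Sum>i = 0..<k. H $$ (c, i) * z $ i) + (\<Sum>i = k..<n. H $$ (c, i) * z $ i)"
        using sum.atLeastLessThan_concat[of 0 k n "\<lambda>i. H $$ (c, i) * z $ i"] kn by simp
      also have "(\<Sum>i = 0..<k. H $$ (c, i) * z $ i) = 0" by (rule sum.neutral) (simp add: z0)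
      also have "(\<Sum>i = k..<n. H $$ (c, i) * z $ i) = (\<Sum>i = 0..<n - k. H $$ (c, k + i) * z $ (k + i))"
        using sum.shift_bounds_nat_ivl[of "\<lambda>i. H $$ (c, i) * z $ i" 0 k "n - k"] kn by (simp add: add.commute)
      finally show "x $ c = (?M\<^sup>T *\<^sub>v y) $ c"
        using c by (simp add: scalar_prod_def dual_mat_def y_def)
    qed (use M x in auto)
    then show "x \<in> row_sp n ?M" unfolding row_space_iff[OF M] using y by (rule bexI)
  qed
qed

lemma orthogonal_complement_dual:
  assumes kn: "k \<le> n" and W: "W \<in> Gr k n"
  shows "perp n W \<in> Gr (n - k) n"
    "plucker (n - k) n (perp n W) = dual_map k n ` plucker k n W"
proof -
  let ?W' = "perp n W"
  obtain L where L: "full_row_rank k n L" "row_sp n L = W" by (rule Gr_obtain_matrix[OF W])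
  note Lc = full_row_rank_carrier[OF L(1)]
  have rows: "set (rows L) \<subseteq> carrier_vec n" using Lc by (metis rows_carrier carrier_matD(2))
  obtain G where G: "G \<in> carrier_mat n n" "det G \<noteq> 0" "\<forall>i<length (rows L). row G i = rows L ! i"
    using mat_of_independent_rows_extends[OF full_row_rank_rows(1)[OF L(1)] rows full_row_rank_rows(2)[OF L(1)]]
    by (elim bexE conjE) (rule that; assumption)
  obtain H where H: "H \<in> carrier_mat n n" "G * H = 1\<^sub>m n" "H * G = 1\<^sub>m n"
    by (rule det_nonzero_inverse[OF G(1,2)])
  have Ltop: "L = mat k n (\<lambda>(i, j). G $$ (i, j))"
  proof (rule eq_matI)
    fix i j assume "i < dim_row (mat k n (\<lambda>(i, j). G $$ (i, j)))" "j < dim_col (mat k n (\<lambda>(i, j). G $$ (i, j)))"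
    then have ij: "i < k" "j < n" by auto
    have "row G i = row L i" using G(3) ij Lc by simp
    then have "row G i $ j = row L i $ j" by simp
    then show "L $$ (i, j) = mat k n (\<lambda>(i, j). G $$ (i, j)) $$ (i, j)" using ij kn Lc G(1) by simp
  qed (use Lc in auto)
  let ?M = "dual_mat k n H"
  note M = row_space_dual_mat[OF kn G(1) H(1,2) Ltop, unfolded L(2)]
  show "?W' \<in> Gr (n - k) n" using full_row_rank_Gr[OF M(1)] M(2) by simp
  have minors: "max_minors (n - k) n ?M = (\<lambda>I. (1 / det G) * dual_map k n (max_minors k n L) I)"
  proof
    fix I
    show "max_minors (n - k) n ?M I = (1 / det G) * dual_map k n (max_minors k n L) I"
    proof (cases "I \<in> ksubsets (n - k) n")
      case True
      have "det G * det (submatrix ?M UNIV I) = det (perm_mat k n I) * det (submatrix L UNIV ({..<n} - I))"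
        by (rule complementary_minors[OF kn True G(1) H(1,2) Ltop dual_mat_def])
      then show ?thesis
        using True complement_ksubset[OF kn True] G(2) by (simp add: max_minors_def dual_map_def field_simps)
    qed (simp add: max_minors_def dual_map_def)
  qed
  have "plucker (n - k) n ?W' = proj_pt (max_minors (n - k) n ?M)"
    using plucker_row_space[OF M(1)] by (simp only: M(2))
  also have "\<dots> = proj_pt (dual_map k n (max_minors k n L))"
    unfolding minors by (rule proj_pt_scale) (use G(2) in simp)
  also have "\<dots> = dual_map k n ` proj_pt (max_minors k n L)"
    by (rule image_proj_pt[symmetric]) (auto simp: dual_map_def)
  also have "proj_pt (max_minors k n L) = plucker k n W"
    using plucker_row_space[OF L(1)] by (simp only: L(2))
  finally show "plucker (n - k) n ?W' = dual_map k n ` plucker k n W" .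
qed

text \<open>\<open>U\<close> is contained in its double complement, and both have dimension \<open>n - k\<close>.\<close>

lemma orthogonal_complement_twice:
  assumes kn: "k \<le> n" and U: "U \<in> Gr (n - k) n"
  obtains W where "W \<in> Gr k n" "perp n W = U"
proof
  let ?W = "perp n U"
  have "?W \<in> Gr (n - (n - k)) n" by (rule orthogonal_complement_dual(1)[OF _ U]) simp
  then show W: "?W \<in> Gr k n" using kn by simp
  have "U \<subseteq> perp n ?W"
  proof
    fix u assume u: "u \<in> U"
    then have uc: "u \<in> carrier_vec n" using Gr_carrier[OF U] by blast
    have "u \<bullet> x = 0" if x: "x \<in> ?W" for x
    proof -
      have "x \<in> carrier_vec n" "x \<bullet> u = 0" using x u by (auto simp: vec_module.orthogonal_complement_def)
      then show ?thesis using comm_scalar_prod[OF uc] by simp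
    qed
    then show "u \<in> perp n ?W"
      using uc by (simp add: vec_module.orthogonal_complement_def)
  qed
  then have "U = perp n ?W"
    by (rule Gr_subset_eq[OF U orthogonal_complement_dual(1)[OF kn W]])
  then show "perp n ?W = U" by simp
qed

text \<open>The isomorphism is the identity on the first factor and the complementary coordinates on the second.\<close>

theorem SH_0_isomorphic_Fl:
  assumes kn: "k \<le> n"
  shows "linearly_isomorphic (ksubsets k n) (ksubsets k n) (SH_variety k n 0)
    (ksubsets k n) (ksubsets (n - k) n) (Fl_variety k (n - k) n)"
  unfolding linearly_isomorphic_def
proof (intro exI conjI)
  show "lin_iso_on (coord_space (ksubsets k n)) (coord_space (ksubsets k n)) (\<lambda>x. x)"
    by (auto simp: lin_iso_on_def bij_betw_def)
  show "lin_iso_on (coord_space (ksubsets k n)) (coord_space (ksubsets (n - k) n)) (dual_map k n)"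
    by (rule lin_iso_dual_map[OF kn])
  let ?o = "perp n"
  have Fl: "Fl k (n - k) n = (\<lambda>(V, W). (V, ?o W)) ` SH k n 0"
  proof (intro Set.set_eqI iffI)
    fix p assume "p \<in> Fl k (n - k) n"
    then obtain V U where p: "p = (V, U)" "V \<in> Gr k n" "U \<in> Gr (n - k) n" "V \<subseteq> U" by (auto simp: Fl_def)
    obtain W where "W \<in> Gr k n" "?o W = U" by (rule orthogonal_complement_twice[OF kn p(3)])
    then have "(V, W) \<in> SH k n 0" "p = (\<lambda>(V, W). (V, ?o W)) (V, W)" using p by (auto simp: SH_0_iff)
    then show "p \<in> (\<lambda>(V, W). (V, ?o W)) ` SH k n 0" by (rule rev_image_eqI)
  next
    fix p assume "p \<in> (\<lambda>(V, W). (V, ?o W)) ` SH k n 0"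
    then obtain V W where "(V, W) \<in> SH k n 0" "p = (V, ?o W)" by auto
    then show "p \<in> Fl k (n - k) n"
      using orthogonal_complement_dual(1)[OF kn, of W] by (auto simp: SH_0_iff Fl_def)
  qed
  have "map_prod ((`) (\<lambda>x. x)) ((`) (dual_map k n)) (map_prod (plucker k n) (plucker k n) q) =
      map_prod (plucker k n) (plucker (n - k) n) ((\<lambda>(V, W). (V, ?o W)) q)" if "q \<in> SH k n 0" for q
    using that orthogonal_complement_dual(2)[OF kn] by (cases q) (simp add: SH_0_iff)
  then show "map_prod ((`) (\<lambda>x. x)) ((`) (dual_map k n)) ` SH_variety k n 0 = Fl_variety k (n - k) n"
    unfolding SH_variety_def Fl_variety_def Fl image_image by (rule image_cong[OF refl])
qed

theorem proposition2p5:
  fixes k n r :: nat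
  assumes "r \<le> k" and "2 * k \<le> r + n"
  shows "SH_variety k n r \<noteq> {} \<and>
    irreduciblein (zariski (ksubsets k n) (ksubsets k n)) (SH_variety k n r) \<and>
    krull_dim (subtopology (zariski (ksubsets k n) (ksubsets k n)) (SH_variety k n r))
      = enat (2 * k * (n - k) - (k - r)^2) \<and>
    (r = 0 \<longrightarrow>
      linearly_isomorphic
        (ksubsets k n) (ksubsets k n) (SH_variety k n 0)
        (ksubsets k n) (ksubsets (n - k) n) (Fl_variety k (n - k) n))"
proof (intro conjI impI)
  show "SH_variety k n r \<noteq> {}"
    by (rule SH_variety_irreducible_dim(1)[OF assms])
  show "irreduciblein (zariski (ksubsets k n) (ksubsets k n)) (SH_variety k n r)"
    by (rule SH_variety_irreducible_dim(2)[OF assms])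
  show "krull_dim (subtopology (zariski (ksubsets k n) (ksubsets k n)) (SH_variety k n r))
      = enat (2 * k * (n - k) - (k - r)^2)"
    by (rule SH_variety_irreducible_dim(3)[OF assms])
  have "k \<le> n" using assms by linarith
  then show "linearly_isomorphic
        (ksubsets k n) (ksubsets k n) (SH_variety k n 0)
        (ksubsets k n) (ksubsets (n - k) n) (Fl_variety k (n - k) n)"
    by (rule SH_0_isomorphic_Fl)
qed

end
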